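(* Let $\mathcal{G}=(G,\lambda)$ be a temporal graph with lifetime $\tau$ ($G$ undirected or directed) and $s,t\in V(G)$. There is an algorithm that either finds 2 t-vertex disjoint temporal $s,t$-paths in $\mathcal{G}$, if they exist, or otherwise outputs that $tp(s,t)\le 1$, in time $O(mn\tau^2)$, where $n=|V(G)|$ and $m=|E(G)|$.
   Context: A temporal graph with lifetime $\tau$ is a pair $(G,\lambda)$ where $G$ is a finite simple (undirected or directed) graph and $\lambda$ assigns to each edge (arc) a subset of $[\tau]$. A temporal vertex is an element of $V(G)\times[\tau]$. A (non-strict) temporal $s,t$-path is a sequence $(s=v_1,t_1,v_2,\dots,t_{p-1},v_p=t)$ of pairwise distinct vertices with $v_iv_{i+1}\in E(G)$ (arc if directed), $t_i\in\lambda(v_iv_{i+1})$, and $t_1\le\dots\le t_{p-1}$. The temporal vertices contained in $P$, $V^T(P)$, are $(s,t_1)$, $(t,t_{p-1})$, and for each $2\le i\le p-1$ all $(v_i,j)$ with $t_{i-1}\le j\le t_i$. Two temporal $s,t$-paths $P,Q$ are t-vertex disjoint if $V^T(P)\cap V^T(Q)\subseteq\{s,t\}\times[\tau]$; $tp(s,t)$ is the maximum number of pairwise t-vertex disjoint temporal $s,t$-paths. *)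

theory Defs
  imports Main
begin

section \<open>Temporal graphs and temporal paths\<close>

text \<open>
  Undirected edges are two-element sets and arcs are ordered pairs; both live in one type so that
  directed and undirected graphs can be treated uniformly.
\<close>

datatype 'v edge = Arc 'v 'v | Edge "'v set"

record 'v temporal_graph =
  directed :: bool
  verts :: "'v set"
  edges :: "'v edge set"
  labels :: "'v edge \<Rightarrow> nat set"
  lifetime :: nat

definition link :: "'v temporal_graph \<Rightarrow> 'v \<Rightarrow> 'v \<Rightarrow> 'v edge" where
  "link G u v = (if directed G then Arc u v else Edge {u, v})"

definition temporal_graph :: "'v temporal_graph \<Rightarrow> bool" where
  "temporal_graph G \<longleftrightarrow>
     finite (verts G) \<and>
     edges G \<subseteq> {link G u v | u v. u \<in> verts G \<and> v \<in> verts G \<and> u \<noteq> v} \<and>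
     (\<forall>e \<in> edges G. labels G e \<subseteq> {1..lifetime G})"

text \<open>
  The sequence $(v_1,t_1,v_2,\dots,t_{p-1},v_p)$ is the pair of lists
  $([v_1,\dots,v_p],[t_1,\dots,t_{p-1}])$.
\<close>

type_synonym 'v tpath = "'v list \<times> nat list"

definition temporal_path :: "'v temporal_graph \<Rightarrow> 'v \<Rightarrow> 'v \<Rightarrow> 'v tpath \<Rightarrow> bool" where
  "temporal_path G s t P \<longleftrightarrow> (case P of (vs, ts) \<Rightarrow>
     length vs = Suc (length ts) \<and> hd vs = s \<and> last vs = t \<and>
     set vs \<subseteq> verts G \<and> distinct vs \<and> sorted ts \<and>
     (\<forall>i < length ts. link G (vs ! i) (vs ! Suc i) \<in> edges G \<and>
                      ts ! i \<in> labels G (link G (vs ! i) (vs ! Suc i))))"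

text \<open>
  Lists are indexed from 0, so the inner vertex \<open>vs ! i\<close> is entered at time \<open>ts ! (i - 1)\<close> and
  left at time \<open>ts ! i\<close>. A one-vertex path, possible only if $s = t$, has no times and hence
  no temporal vertices.
\<close>

definition temporal_verts :: "'v tpath \<Rightarrow> ('v \<times> nat) set" where
  "temporal_verts P = (case P of (vs, ts) \<Rightarrow>
     (if ts = [] then {} else {(hd vs, hd ts), (last vs, last ts)}) \<union>
     {(vs ! i, j) | i j. 0 < i \<and> i < length ts \<and> ts ! (i - 1) \<le> j \<and> j \<le> ts ! i})"

definition t_vertex_disjoint ::
  "'v temporal_graph \<Rightarrow> 'v \<Rightarrow> 'v \<Rightarrow> 'v tpath \<Rightarrow> 'v tpath \<Rightarrow> bool" where
  "t_vertex_disjoint G s t P Q \<longleftrightarrow>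
     temporal_verts P \<inter> temporal_verts Q \<subseteq> {s, t} \<times> {1..lifetime G}"

definition tp :: "'v temporal_graph \<Rightarrow> 'v \<Rightarrow> 'v \<Rightarrow> nat" where
  "tp G s t = Max {card \<P> | \<P>. finite \<P> \<and> \<P> \<subseteq> {P. temporal_path G s t P} \<and>
     (\<forall>P \<in> \<P>. \<forall>Q \<in> \<P>. P \<noteq> Q \<longrightarrow> t_vertex_disjoint G s t P Q)}"


section \<open>Model of computation\<close>

text \<open>
  Algorithms are while-programs over finitely many scalar variables and arrays of natural numbers,
  under the uniform cost criterion: every access, arithmetic operation, comparison and branch costs
  one time unit. As usual for uniform-cost random access machines, addition and (truncated)
  subtraction are the only arithmetic primitives; unit-cost multiplication of unbounded numbers
  would be too powerful. Programs are syntactic objects, so no other function comes for free.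
\<close>

type_synonym name = string

datatype aexp =
    Const nat
  | Var name
  | Read name aexp
  | Add aexp aexp
  | Sub aexp aexp

datatype bexp =
    Less aexp aexp
  | Equal aexp aexp
  | Neg bexp
  | Conj bexp bexp

datatype com =
    Skip
  | Assign name aexp
  | Store name aexp aexp
  | Seq com com
  | Cond bexp com com
  | While bexp com

record state =
  vars :: "name \<Rightarrow> nat"
  arrs :: "name \<Rightarrow> nat \<Rightarrow> nat"

fun aval :: "aexp \<Rightarrow> state \<Rightarrow> nat" where
  "aval (Const k) \<sigma> = k"
| "aval (Var x) \<sigma> = vars \<sigma> x"
| "aval (Read A a) \<sigma> = arrs \<sigma> A (aval a \<sigma>)"
| "aval (Add a b) \<sigma> = aval a \<sigma> + aval b \<sigma>"
| "aval (Sub a b) \<sigma> = aval a \<sigma> - aval b \<sigma>"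

fun bval :: "bexp \<Rightarrow> state \<Rightarrow> bool" where
  "bval (Less a b) \<sigma> \<longleftrightarrow> aval a \<sigma> < aval b \<sigma>"
| "bval (Equal a b) \<sigma> \<longleftrightarrow> aval a \<sigma> = aval b \<sigma>"
| "bval (Neg b) \<sigma> \<longleftrightarrow> \<not> bval b \<sigma>"
| "bval (Conj b b') \<sigma> \<longleftrightarrow> bval b \<sigma> \<and> bval b' \<sigma>"

fun acost :: "aexp \<Rightarrow> nat" where
  "acost (Const k) = 1"
| "acost (Var x) = 1"
| "acost (Read A a) = 1 + acost a"
| "acost (Add a b) = 1 + acost a + acost b"
| "acost (Sub a b) = 1 + acost a + acost b"

fun bcost :: "bexp \<Rightarrow> nat" where
  "bcost (Less a b) = 1 + acost a + acost b"
| "bcost (Equal a b) = 1 + acost a + acost b"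
| "bcost (Neg b) = 1 + bcost b"
| "bcost (Conj b b') = 1 + bcost b + bcost b'"

text \<open>
  \<open>exec c \<sigma> k \<sigma>'\<close>: started in \<open>\<sigma>\<close>, the program \<open>c\<close> halts after exactly \<open>k\<close> time units in \<open>\<sigma>'\<close>.
\<close>

inductive exec :: "com \<Rightarrow> state \<Rightarrow> nat \<Rightarrow> state \<Rightarrow> bool" where
  Skip: "exec Skip \<sigma> 1 \<sigma>"
| Assign: "exec (Assign x a) \<sigma> (1 + acost a) (\<sigma>\<lparr>vars := (vars \<sigma>)(x := aval a \<sigma>)\<rparr>)"
| Store: "exec (Store A i a) \<sigma> (1 + acost i + acost a)
            (\<sigma>\<lparr>arrs := (arrs \<sigma>)(A := (arrs \<sigma> A)(aval i \<sigma> := aval a \<sigma>))\<rparr>)"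
| Seq: "exec c \<sigma> k \<sigma>' \<Longrightarrow> exec d \<sigma>' l \<sigma>'' \<Longrightarrow> exec (Seq c d) \<sigma> (k + l) \<sigma>''"
| CondTrue: "bval b \<sigma> \<Longrightarrow> exec c \<sigma> k \<sigma>' \<Longrightarrow> exec (Cond b c d) \<sigma> (1 + bcost b + k) \<sigma>'"
| CondFalse: "\<not> bval b \<sigma> \<Longrightarrow> exec d \<sigma> k \<sigma>' \<Longrightarrow> exec (Cond b c d) \<sigma> (1 + bcost b + k) \<sigma>'"
| WhileFalse: "\<not> bval b \<sigma> \<Longrightarrow> exec (While b c) \<sigma> (1 + bcost b) \<sigma>"
| WhileTrue: "bval b \<sigma> \<Longrightarrow> exec c \<sigma> k \<sigma>' \<Longrightarrow> exec (While b c) \<sigma>' l \<sigma>'' \<Longrightarrow>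
    exec (While b c) \<sigma> (1 + bcost b + k + l) \<sigma>''"

lemma exec_deterministic:
  assumes "exec c \<sigma> k \<sigma>'" and "exec c \<sigma> l \<sigma>''"
  shows "l = k \<and> \<sigma>'' = \<sigma>'"
  using assms
proof (induction arbitrary: l \<sigma>'' rule: exec.induct)
  case (Seq c \<sigma> k \<sigma>' d k' \<tau>)
  from Seq.prems show ?case by cases (use Seq.IH in blast)
next
  case (CondTrue b \<sigma> c k \<sigma>' d)
  from CondTrue.prems show ?case by cases (use CondTrue in blast)+
next
  case (CondFalse b \<sigma> d k \<sigma>' c)
  from CondFalse.prems show ?case by cases (use CondFalse in blast)+
next
  case (WhileFalse b \<sigma> c)
  from WhileFalse.prems show ?case by cases (use WhileFalse.hyps in blast)+
next
  case (WhileTrue b \<sigma> c k \<sigma>' k' \<tau>)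
  from WhileTrue.prems show ?case by cases (use WhileTrue.hyps(1) WhileTrue.IH in blast)+
qed (erule exec.cases; simp)+


section \<open>Input and output format\<close>

text \<open>
  A numbering of the vertices by $0,\dots,n-1$ and a listing of the edges without repetition, each
  given by its (first and second) end vertex; an undirected edge is listed once, in either
  orientation.
\<close>

definition presentation :: "'v temporal_graph \<Rightarrow> ('v \<Rightarrow> nat) \<Rightarrow> ('v \<times> 'v) list \<Rightarrow> bool" where
  "presentation G num es \<longleftrightarrow>
     bij_betw num (verts G) {..<card (verts G)} \<and>
     set es \<subseteq> verts G \<times> verts G \<and>
     distinct (map (case_prod (link G)) es) \<and>
     set (map (case_prod (link G)) es) = edges G"

definition load :: "nat list \<Rightarrow> nat \<Rightarrow> nat" where
  "load xs i = (if i < length xs then xs ! i else 0)"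

text \<open>
  The label sets of the listed edges are stored one after the other, each in increasing order,
  in the array \<open>lab\<close>; their sizes are in \<open>cnt\<close>. Everything not part of the input is 0.
\<close>

definition input_state ::
  "'v temporal_graph \<Rightarrow> ('v \<Rightarrow> nat) \<Rightarrow> ('v \<times> 'v) list \<Rightarrow> 'v \<Rightarrow> 'v \<Rightarrow> state" where
  "input_state G num es s t = \<lparr>
     vars = (\<lambda>_. 0)
       (''dir'' := (if directed G then 1 else 0),
        ''n'' := card (verts G),
        ''m'' := card (edges G),
        ''tau'' := lifetime G,
        ''s'' := num s,
        ''t'' := num t),
     arrs = (\<lambda>_ _. 0)
       (''src'' := load (map (num \<circ> fst) es),
        ''dst'' := load (map (num \<circ> snd) es),
        ''cnt'' := load (map (\<lambda>(u, v). card (labels G (link G u v))) es),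
        ''lab'' := load (concat (map (\<lambda>(u, v). sorted_list_of_set (labels G (link G u v))) es)))\<rparr>"

definition stored :: "nat list \<Rightarrow> (nat \<Rightarrow> nat) \<Rightarrow> bool" where
  "stored xs a \<longleftrightarrow> (\<forall>i < length xs. a i = xs ! i)"

text \<open>
  The two paths are returned as their numbers of edges and their sequences of vertex numbers and
  of times.
\<close>

definition outputs_paths :: "state \<Rightarrow> ('v \<Rightarrow> nat) \<Rightarrow> 'v tpath \<Rightarrow> 'v tpath \<Rightarrow> bool" where
  "outputs_paths \<sigma> num P Q \<longleftrightarrow>
     vars \<sigma> ''found'' = 1 \<and>
     vars \<sigma> ''plen'' = length (snd P) \<and>
     stored (map num (fst P)) (arrs \<sigma> ''pv'') \<and> stored (snd P) (arrs \<sigma> ''pt'') \<and>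
     vars \<sigma> ''qlen'' = length (snd Q) \<and>
     stored (map num (fst Q)) (arrs \<sigma> ''qv'') \<and> stored (snd Q) (arrs \<sigma> ''qt'')"

definition outputs_at_most_one :: "state \<Rightarrow> bool" where
  "outputs_at_most_one \<sigma> \<longleftrightarrow> vars \<sigma> ''found'' = 0"

end

theory Submission
  imports Defs
begin

text \<open>
  Single-step paths from \<open>s\<close> to \<open>t\<close> are treated separately. Otherwise let \<open>P\<close> be a path from \<open>s\<close>
  to \<open>t\<close> all of whose prefixes arrive as early as possible, the spine, and let \<open>x\<^sub>1, x\<^sub>2, \<dots>\<close> be its
  temporal vertices in order. Sweep over the \<open>x\<^sub>a\<close>: phase \<open>a\<close> labels with \<open>a\<close> all still unlabelled
  temporal vertices that are reachable from \<open>x\<^sub>a\<close> off the spine without entering the vertex of \<open>x\<^sub>a\<close> again, and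
  notes how far along the spine such a detour can return. Detours of different phases are disjoint
  because every temporal vertex is labelled once.

  Whenever the sweep arrives at the point \<open>x\<^sub>\<beta>\<close> where the last chosen detour returned to the spine, it chooses
  the detour found so far that returns farthest. If none returns beyond \<open>x\<^sub>\<beta>\<close>, then every temporal
  path contains \<open>x\<^sub>\<beta>\<close>: a path that avoids \<open>x\<^sub>\<beta>\<close> = \<open>(w, i)\<close> visits \<open>w\<close> only before or only after
  time \<open>i\<close>, and in either case it never leaves the set of labelled temporal vertices. If the sweep
  reaches \<open>t\<close>, then two walks that alternate between spine segments and detours are disjoint; they
  are paths since a vertex of the spine is visited by a detour only after the spine has left it, and
  since waiting is always propagated at once.
\<close>

section \<open>Weakest preconditions with time credits\<close>

text \<open>Earliest arrival is what turns the failure of the sweep into a cut. The spine occupies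
  each of its vertices from the earliest possible time on, so whatever enters such a vertex before
  the spine leaves it does so at a point of the spine, whose position can be compared with others.
  The order of discovery separates simultaneous arrivals, so that the spine passes through each
  vertex in one contiguous stretch.

  An arc from \<open>s\<close> to \<open>t\<close> has no inner temporal vertex and cannot be cut.
  Two of them at different times are a solution; a single one serves as a detour from
  \<open>s\<close> to \<open>t\<close> known in advance, and then the sweep cannot fail.

  One pointer per temporal vertex records both walks, since they are disjoint; a pointer is
  overwritten only where a chosen detour returns to the spine.

  The bound is amortised. A scan of the at most \<open>2 * m * T\<close> arcs, with \<open>T\<close>
  the lifetime, is repeated only if a temporal vertex was labelled or the sweep moves on. There are
  at most \<open>n * (T + 1)\<close> labels to give and \<open>n * (T + 1) + 2\<close> positions,
  hence the order of m n T^2.\<close>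

text \<open>The integer is the time left; it may become negative, so that only loops need a side condition.\<close>

definition wp :: "com \<Rightarrow> (state \<Rightarrow> int \<Rightarrow> bool) \<Rightarrow> state \<Rightarrow> int \<Rightarrow> bool" where
  "wp c Q \<sigma> n \<longleftrightarrow> (\<exists>k \<sigma>'. exec c \<sigma> k \<sigma>' \<and> Q \<sigma>' (n - int k))"

lemma wp_mono:
  assumes "wp c Q \<sigma> n" and "\<And>\<sigma>' n'. Q \<sigma>' n' \<Longrightarrow> R \<sigma>' n'"
  shows "wp c R \<sigma> n"
  using assms unfolding wp_def by blast

lemma wp_Skip: "wp Skip Q \<sigma> n \<longleftrightarrow> Q \<sigma> (n - 1)"
  unfolding wp_def by (metis exec.Skip exec_deterministic of_nat_1)

lemma wp_Assign: "wp (Assign x a) Q \<sigma> n \<longleftrightarrow>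
    Q \<lparr>vars = (vars \<sigma>)(x := aval a \<sigma>), arrs = arrs \<sigma>\<rparr> (n - int (1 + acost a))"
proof -
  have "wp (Assign x a) Q \<sigma> n \<longleftrightarrow>
    Q (\<sigma>\<lparr>vars := (vars \<sigma>)(x := aval a \<sigma>)\<rparr>) (n - int (1 + acost a))"
    unfolding wp_def by (metis exec.Assign exec_deterministic)
  then show ?thesis by (cases \<sigma>) simp
qed

lemma wp_Store: "wp (Store A i a) Q \<sigma> n \<longleftrightarrow>
    Q \<lparr>vars = vars \<sigma>, arrs = (arrs \<sigma>)(A := (arrs \<sigma> A)(aval i \<sigma> := aval a \<sigma>))\<rparr>
      (n - int (1 + acost i + acost a))"
proof -
  have "wp (Store A i a) Q \<sigma> n \<longleftrightarrow>
    Q (\<sigma>\<lparr>arrs := (arrs \<sigma>)(A := (arrs \<sigma> A)(aval i \<sigma> := aval a \<sigma>))\<rparr>) (n - int (1 + acost i + acost a))"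
    unfolding wp_def by (metis exec.Store exec_deterministic)
  then show ?thesis by (cases \<sigma>) simp
qed

lemma wp_Seq: "wp (Seq c d) Q \<sigma> n \<longleftrightarrow> wp c (wp d Q) \<sigma> n"
proof
  assume "wp (Seq c d) Q \<sigma> n"
  then obtain k \<tau> where "exec (Seq c d) \<sigma> k \<tau>" and "Q \<tau> (n - int k)"
    unfolding wp_def by blast
  then show "wp c (wp d Q) \<sigma> n"
    by (cases rule: exec.cases[of "Seq c d" \<sigma> k \<tau>]) (auto simp: wp_def algebra_simps)
next
  assume "wp c (wp d Q) \<sigma> n"
  then show "wp (Seq c d) Q \<sigma> n"
    unfolding wp_def by (metis exec.Seq diff_diff_eq of_nat_add)
qed

lemma wp_Cond: "wp (Cond b c d) Q \<sigma> n \<longleftrightarrow>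
    (if bval b \<sigma> then wp c Q \<sigma> (n - int (1 + bcost b)) else wp d Q \<sigma> (n - int (1 + bcost b)))"
proof
  assume "wp (Cond b c d) Q \<sigma> n"
  then obtain k \<tau> where "exec (Cond b c d) \<sigma> k \<tau>" and "Q \<tau> (n - int k)"
    unfolding wp_def by blast
  then show "if bval b \<sigma> then wp c Q \<sigma> (n - int (1 + bcost b))
      else wp d Q \<sigma> (n - int (1 + bcost b))"
    by (cases rule: exec.cases[of "Cond b c d" \<sigma> k \<tau>])
       (auto simp: wp_def algebra_simps)
next
  assume R: "if bval b \<sigma> then wp c Q \<sigma> (n - int (1 + bcost b)) else wp d Q \<sigma> (n - int (1 + bcost b))"
  show "wp (Cond b c d) Q \<sigma> n"
  proof (cases "bval b \<sigma>")
    case True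
    with R obtain k \<tau> where "exec c \<sigma> k \<tau>" and "Q \<tau> (n - int (1 + bcost b) - int k)"
      unfolding wp_def by auto
    with True exec.CondTrue[of b \<sigma> c k \<tau> d] show ?thesis
      unfolding wp_def by (metis diff_diff_eq of_nat_add)
  next
    case False
    with R obtain k \<tau> where "exec d \<sigma> k \<tau>" and "Q \<tau> (n - int (1 + bcost b) - int k)"
      unfolding wp_def by auto
    with False exec.CondFalse[of b \<sigma> d k \<tau> c] show ?thesis
      unfolding wp_def by (metis diff_diff_eq of_nat_add)
  qed
qed

lemmas wp_simps = wp_Skip wp_Assign wp_Store wp_Seq wp_Cond

text \<open>The time left doubles as the termination measure: each iteration has to start with
  nonnegative credit, and testing the guard costs at least one unit, so \<open>nat (n + 1)\<close>
  decreases. No separate variant is needed.\<close>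

lemma wp_While:
  assumes init: "I \<sigma> n"
    and step: "\<And>\<sigma> n. I \<sigma> n \<Longrightarrow> bval b \<sigma> \<Longrightarrow> 0 \<le> n \<and> wp c I \<sigma> (n - int (1 + bcost b))"
    and exit: "\<And>\<sigma> n. I \<sigma> n \<Longrightarrow> \<not> bval b \<sigma> \<Longrightarrow> Q \<sigma> (n - int (1 + bcost b))"
  shows "wp (While b c) Q \<sigma> n"
  using init
proof (induction "nat (n + 1)" arbitrary: \<sigma> n rule: less_induct)
  case less
  show ?case
  proof (cases "bval b \<sigma>")
    case True
    with step[OF less.prems] obtain k \<sigma>' where k: "0 \<le> n" "exec c \<sigma> k \<sigma>'"
      "I \<sigma>' (n - int (1 + bcost b) - int k)"
      unfolding wp_def by blast
    have "wp (While b c) Q \<sigma>' (n - int (1 + bcost b) - int k)"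
      by (rule less.hyps[OF _ k(3)]) (use k(1) in linarith)
    then obtain l \<tau> where l: "exec (While b c) \<sigma>' l \<tau>"
      "Q \<tau> (n - int (1 + bcost b) - int k - int l)"
      unfolding wp_def by blast
    then have "Q \<tau> (n - int (1 + bcost b + k + l))"
      by (simp add: algebra_simps)
    with exec.WhileTrue[OF True k(2) l(1)] show ?thesis unfolding wp_def by blast
  next
    case False
    then show ?thesis
      using exit[OF less.prems False] exec.WhileFalse[OF False] unfolding wp_def by blast
  qed
qed

section \<open>Frame conditions read off the program text\<close>

fun wvars :: "com \<Rightarrow> name set" where
  "wvars Skip = {}"
| "wvars (Assign x a) = {x}"
| "wvars (Store A i a) = {}"
| "wvars (Seq c d) = wvars c \<union> wvars d"
| "wvars (Cond b c d) = wvars c \<union> wvars d"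
| "wvars (While b c) = wvars c"

fun warrs :: "com \<Rightarrow> name set" where
  "warrs Skip = {}"
| "warrs (Assign x a) = {}"
| "warrs (Store A i a) = {A}"
| "warrs (Seq c d) = warrs c \<union> warrs d"
| "warrs (Cond b c d) = warrs c \<union> warrs d"
| "warrs (While b c) = warrs c"

definition unchanged :: "com \<Rightarrow> state \<Rightarrow> state \<Rightarrow> bool" where
  "unchanged c \<sigma> \<sigma>' \<longleftrightarrow>
     (\<forall>x. x \<notin> wvars c \<longrightarrow> vars \<sigma>' x = vars \<sigma> x) \<and> (\<forall>A. A \<notin> warrs c \<longrightarrow> arrs \<sigma>' A = arrs \<sigma> A)"

lemma exec_unchanged: "exec c \<sigma> k \<sigma>' \<Longrightarrow> unchanged c \<sigma> \<sigma>'"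
  by (induction rule: exec.induct) (auto simp: unchanged_def)

lemma wp_frame:
  assumes "wp c Q \<sigma> n" and "\<And>\<sigma>' n'. Q \<sigma>' n' \<Longrightarrow> unchanged c \<sigma> \<sigma>' \<Longrightarrow> R \<sigma>' n'"
  shows "wp c R \<sigma> n"
  using assms exec_unchanged unfolding wp_def by blast

text \<open>Carrying the frame along inside the invariant frees \<open>I\<close> from all statements
  about names that the body does not write.\<close>

lemma wp_loop:
  assumes init: "I \<sigma> n"
    and step: "\<And>\<sigma>' n'. I \<sigma>' n' \<Longrightarrow> unchanged c \<sigma> \<sigma>' \<Longrightarrow> bval b \<sigma>' \<Longrightarrow>
      0 \<le> n' \<and> wp c I \<sigma>' (n' - int (1 + bcost b))"
    and exit: "\<And>\<sigma>' n'. I \<sigma>' n' \<Longrightarrow> unchanged c \<sigma> \<sigma>' \<Longrightarrow> \<not> bval b \<sigma>' \<Longrightarrow>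
      Q \<sigma>' (n' - int (1 + bcost b))"
  shows "wp (While b c) Q \<sigma> n"
proof (rule wp_While[where I = "\<lambda>\<sigma>' n'. I \<sigma>' n' \<and> unchanged c \<sigma> \<sigma>'"])
  show "I \<sigma> n \<and> unchanged c \<sigma> \<sigma>"
    using init by (simp add: unchanged_def)
next
  fix \<sigma>' n' assume *: "I \<sigma>' n' \<and> unchanged c \<sigma> \<sigma>'" and b: "bval b \<sigma>'"
  then have "0 \<le> n'" and w: "wp c I \<sigma>' (n' - int (1 + bcost b))"
    using step by blast+
  moreover have "wp c (\<lambda>\<sigma>' n'. I \<sigma>' n' \<and> unchanged c \<sigma> \<sigma>') \<sigma>' (n' - int (1 + bcost b))"
    by (rule wp_frame[OF w]) (use * in \<open>auto simp: unchanged_def\<close>)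
  ultimately show "0 \<le> n' \<and> wp c (\<lambda>\<sigma>' n'. I \<sigma>' n' \<and> unchanged c \<sigma> \<sigma>') \<sigma>' (n' - int (1 + bcost b))"
    by blast
qed (use exit in blast)

section \<open>Disjoint temporal paths and cuts\<close>

text \<open>\<open>A\<close> omits the arcs from \<open>s\<close> to \<open>t\<close>; their times
  are kept apart in \<open>D\<close>. Such an arc can be neither labelled nor cut, and without them
  every spine has an inner vertex.\<close>

locale net =
  fixes n T s t :: nat and A :: "(nat \<times> nat \<times> nat) set" and D :: "nat set"
  assumes arc: "(u, i, v) \<in> A \<Longrightarrow> u < n \<and> v < n \<and> 1 \<le> i \<and> i \<le> T \<and> u \<noteq> v"
    and s: "s < n" and t: "t < n" and st: "s \<noteq> t"
    and no_direct: "(s, i, t) \<notin> A"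
    and D: "D \<subseteq> {1..T}"
begin

definition AF :: "(nat \<times> nat \<times> nat) set" where
  "AF = A \<union> {(s, i, t) | i. i \<in> D}"

lemma AF_arc: "(u, i, v) \<in> AF \<Longrightarrow> u < n \<and> v < n \<and> 1 \<le> i \<and> i \<le> T \<and> u \<noteq> v"
  using arc s t st D unfolding AF_def by auto

definition npath :: "nat tpath \<Rightarrow> bool" where
  "npath P \<longleftrightarrow> (case P of (vs, ts) \<Rightarrow>
     length vs = Suc (length ts) \<and> hd vs = s \<and> last vs = t \<and>
     set vs \<subseteq> {..<n} \<and> distinct vs \<and> sorted ts \<and>
     (\<forall>i < length ts. (vs ! i, ts ! i, vs ! Suc i) \<in> AF))"

text \<open>
  \<open>par v i\<close> is the vertex before \<open>(v, i)\<close>: if it is \<open>v\<close>, then \<open>(v, i)\<close> is reached by waiting from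
  \<open>(v, i - 1)\<close>, otherwise by an arc at time \<open>i\<close>. The set collects the temporal vertices outside \<open>s\<close>.
\<close>

inductive tr :: "(nat \<Rightarrow> nat \<Rightarrow> nat) \<Rightarrow> nat \<Rightarrow> nat \<Rightarrow> nat list \<Rightarrow> nat list \<Rightarrow> (nat \<times> nat) set \<Rightarrow> bool"
  for par where
  start: "tr par s i [s] [] {}"
| wait: "tr par v i vs ts Z \<Longrightarrow> v \<noteq> s \<Longrightarrow> par v (Suc i) = v \<Longrightarrow>
    tr par v (Suc i) vs ts (insert (v, Suc i) Z)"
| move: "tr par u i vs ts Z \<Longrightarrow> par v i = u \<Longrightarrow> (u, i, v) \<in> A \<Longrightarrow> v \<notin> set vs \<Longrightarrow>
    tr par v i (vs @ [v]) (ts @ [i]) (insert (v, i) Z)"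

text \<open>A trace reads \<open>par\<close> only on \<open>Z\<close>. Pointers are changed only at
  unlabelled cells or where a detour will return, so existing traces survive.\<close>

lemma tr_cong:
  assumes "tr par v i vs ts Z" and "\<And>v' i'. (v', i') \<in> Z \<Longrightarrow> par' v' i' = par v' i'"
  shows "tr par' v i vs ts Z"
  using assms by (induction rule: tr.induct) (auto intro: tr.intros)

lemma tr_last: "tr par v i vs ts Z \<Longrightarrow> vs \<noteq> [] \<and> last vs = v"
  by (induction rule: tr.induct) auto

lemma tr_hd: "tr par v i vs ts Z \<Longrightarrow> hd vs = s \<and> s \<in> set vs"
  by (induction rule: tr.induct) (auto simp: tr_last hd_append dest: tr_last)

lemma tr_Z: "tr par v i vs ts Z \<Longrightarrow>
    (\<forall>(v', i') \<in> Z. i' \<le> i \<and> v' \<in> set vs \<and> v' \<noteq> s) \<and> (v \<noteq> s \<longrightarrow> (v, i) \<in> Z) \<and>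
    (\<forall>v' \<in> set vs. v' = s \<or> (\<exists>i'. (v', i') \<in> Z))"
proof (induction rule: tr.induct)
  case (wait v i vs ts Z)
  then show ?case using tr_last[of par v i vs ts Z] by (auto simp: le_Suc_eq)
next
  case (move u i vs ts Z v)
  have "v \<noteq> s" using move tr_hd by blast
  with move show ?case by auto
qed auto

lemma tr_visit:
  assumes "tr par v i vs ts Z" "w \<in> set vs" "w \<noteq> s"
  obtains j where "(w, j) \<in> Z" "j \<le> i"
proof -
  obtain j where "(w, j) \<in> Z" using tr_Z[OF assms(1)] assms(2,3) by blast
  then show ?thesis using tr_Z[OF assms(1)] that by auto
qed

lemma tr_list: "tr par v i vs ts Z \<Longrightarrow>
    length vs = Suc (length ts) \<and> set vs \<subseteq> {..<n} \<and> distinct vs \<and> sorted ts \<and>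
    (\<forall>x \<in> set ts. x \<le> i \<and> 1 \<le> x) \<and> (\<forall>h < length ts. (vs ! h, ts ! h, vs ! Suc h) \<in> A)"
proof (induction rule: tr.induct)
  case start
  then show ?case using s by simp
next
  case (wait v i vs ts Z)
  then show ?case by (auto simp: le_Suc_eq)
next
  case (move u i vs ts Z v)
  have l: "vs \<noteq> []" "last vs = u" using tr_last[OF move(1)] by auto
  have "(( vs @ [v]) ! h, (ts @ [i]) ! h, (vs @ [v]) ! Suc h) \<in> A" if "h < Suc (length ts)" for h
  proof (cases "h < length ts")
    case True
    then show ?thesis using move by (simp add: nth_append)
  next
    case False
    then have "h = length ts" using that by simp
    then show ?thesis using move l by (simp add: nth_append last_conv_nth)
  qed
  then show ?case using move arc[OF move(3)] by (auto simp: sorted_append)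
qed

text \<open>Waiting enters the cells of a vertex one at a time, so the whole stay from entry to
  departure is collected. The last vertex is regarded as left at the current time, hence
  \<open>ts @ [i]\<close>.\<close>

lemma tr_stays:
  assumes "tr par v i vs ts Z" and "0 < h" and "h < length vs"
    and "ts ! (h - 1) \<le> j" and "j \<le> (ts @ [i]) ! h"
  shows "(vs ! h, j) \<in> Z"
  using assms
proof (induction arbitrary: h j rule: tr.induct)
  case (wait v i vs ts Z)
  have len: "length vs = Suc (length ts)" using tr_list[OF wait.hyps(1)] by auto
  show ?case
  proof (cases "h < length ts \<or> j \<le> i")
    case True
    have "j \<le> (ts @ [i]) ! h"
      using True wait.prems len by (cases "h < length ts") (auto simp: nth_append)
    then show ?thesis using wait.IH wait.prems by blast
  next
    case False
    then have h: "h = length ts" using wait.prems len by simp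
    then have "j = Suc i" using wait.prems False by simp
    moreover have "vs ! h = v"
      using h len tr_last[OF wait.hyps(1)] by (auto simp: last_conv_nth)
    ultimately show ?thesis by simp
  qed
next
  case (move u i vs ts Z v)
  have len: "length vs = Suc (length ts)" using tr_list[OF move.hyps(1)] by auto
  show ?case
  proof (cases "h < length vs")
    case True
    moreover from this have "h - 1 < length ts" using move.prems len by simp
    ultimately have "(vs ! h, j) \<in> Z"
      using move.prems len by (intro move.IH) (auto simp: nth_append split: if_splits)
    with True show ?thesis by (simp add: nth_append)
  next
    case False
    then have h: "h = Suc (length ts)" using move.prems len by simp
    then have "j = i" using move.prems by (simp add: nth_append)
    then show ?thesis using h len by (simp add: nth_append)
  qed
qed simp

text \<open>\<open>Z\<close> has to cover the inner vertices only: cells of \<open>s\<close> and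
  \<open>t\<close> may be shared. Two traces with disjoint \<open>Z\<close> therefore complete to
  t-vertex disjoint paths.\<close>

lemma tr_complete:
  assumes "tr par v i vs ts Z" and "(v, i, t) \<in> AF" and "t \<notin> set vs"
  shows "npath (vs @ [t], ts @ [i])"
    and "temporal_verts (vs @ [t], ts @ [i]) \<subseteq> {s, t} \<times> {1..T} \<union> Z"
proof -
  have l: "vs \<noteq> []" "last vs = v" using tr_last[OF assms(1)] by auto
  note L = tr_list[OF assms(1)]
  have "((vs @ [t]) ! h, (ts @ [i]) ! h, (vs @ [t]) ! Suc h) \<in> AF" if "h < Suc (length ts)" for h
  proof (cases "h < length ts")
    case True
    then show ?thesis using L by (simp add: nth_append AF_def)
  next
    case False
    then have "h = length ts" using that by simp
    then show ?thesis using L l assms by (simp add: nth_append last_conv_nth)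
  qed
  then show "npath (vs @ [t], ts @ [i])"
    using L tr_hd[OF assms(1)] assms t l unfolding npath_def by (auto simp: sorted_append hd_append)
  have i: "1 \<le> i \<and> i \<le> T" using AF_arc[OF assms(2)] by simp
  then have "hd (ts @ [i]) \<in> {1..T}" using L by (cases ts) auto
  moreover have "hd (vs @ [t]) = s" using tr_hd[OF assms(1)] l by (simp add: hd_append)
  moreover have "((vs @ [t]) ! h, j) \<in> Z"
    if "0 < h" "h < length (ts @ [i])" "(ts @ [i]) ! (h - 1) \<le> j" "j \<le> (ts @ [i]) ! h" for h j
  proof -
    have "h < length vs" using that L by simp
    then have "(vs @ [t]) ! h = vs ! h" "(ts @ [i]) ! (h - 1) = ts ! (h - 1)"
      using L that by (auto simp: nth_append)
    then show ?thesis using tr_stays[OF assms(1), of h j] that \<open>h < length vs\<close> L by (auto simp: nth_append)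
  qed
  note inner = this
  ultimately have ends: "{(hd (vs @ [t]), hd (ts @ [i])), (last (vs @ [t]), last (ts @ [i]))} \<subseteq> {s, t} \<times> {1..T}"
    using i by simp
  show "temporal_verts (vs @ [t], ts @ [i]) \<subseteq> {s, t} \<times> {1..T} \<union> Z"
  proof
    fix x assume "x \<in> temporal_verts (vs @ [t], ts @ [i])"
    then consider "x \<in> {(hd (vs @ [t]), hd (ts @ [i])), (last (vs @ [t]), last (ts @ [i]))}"
      | h j where "x = ((vs @ [t]) ! h, j)" "0 < h" "h < length (ts @ [i])" "(ts @ [i]) ! (h - 1) \<le> j" "j \<le> (ts @ [i]) ! h"
      unfolding temporal_verts_def by force
    then show "x \<in> {s, t} \<times> {1..T} \<union> Z"
      by cases (use ends inner in blast)+
  qed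
qed

end

text \<open>\<open>arr\<close> is the earliest arrival time, with 0 for unreachable vertices, and
  \<open>rk\<close> orders the vertices by discovery. By \<open>arr_closed\<close> no walk from
  \<open>s\<close> enters a vertex before its \<open>arr\<close>, and the arcs of the spine enter at
  exactly that time. The positions \<open>L\<close> and \<open>N\<close> stand for all copies of
  \<open>s\<close> and of \<open>t\<close>, so \<open>xi L\<close> and \<open>xi N\<close> carry no
  information. \<open>0 < L\<close> leaves 0 for unlabelled cells.\<close>

locale spine = net +
  fixes arr rk :: "nat \<Rightarrow> nat" and L N :: nat and xv xi :: "nat \<Rightarrow> nat"
  assumes arr_s: "arr s = 1"
    and arr_closed: "(u, i, v) \<in> A \<Longrightarrow> 0 < arr u \<Longrightarrow> arr u \<le> i \<Longrightarrow> 0 < arr v \<and> arr v \<le> i"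
    and rk_inj: "0 < arr u \<Longrightarrow> 0 < arr v \<Longrightarrow> rk u = rk v \<Longrightarrow> u = v"
    and L: "0 < L" "Suc L < N"
    and xL: "xv L = s" and xN: "xv N = t"
    and X1: "L < c \<Longrightarrow> c < N \<Longrightarrow>
      xv c < n \<and> xv c \<noteq> s \<and> xv c \<noteq> t \<and> 0 < arr (xv c) \<and> arr (xv c) \<le> xi c \<and> xi c \<le> T"
    and X2: "L < c \<Longrightarrow> Suc c < N \<Longrightarrow>
      xv (Suc c) = xv c \<and> xi (Suc c) = Suc (xi c) \<or>
      (xv c, xi c, xv (Suc c)) \<in> A \<and> xi (Suc c) = xi c \<and> xi (Suc c) = arr (xv (Suc c)) \<and>
        rk (xv c) < rk (xv (Suc c))"
    and X3: "(s, xi (Suc L), xv (Suc L)) \<in> A" "xi (Suc L) = arr (xv (Suc L))"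
    and X4: "(xv (N - 1), xi (N - 1), t) \<in> A"
begin

section \<open>How the spine runs through a vertex\<close>

lemma rk_mono: "c \<le> c' \<Longrightarrow> L < c \<Longrightarrow> c' < N \<Longrightarrow> rk (xv c) \<le> rk (xv c')"
proof (induction c' rule: dec_induct)
  case (step c')
  then show ?case using X2[of c'] by fastforce
qed simp

text \<open>Ranks never decrease along the spine, so all positions between two visits of a vertex
  have the rank of this vertex, and ranks identify reached vertices.\<close>

lemma contiguous:
  assumes "L < c" "c \<le> c'" "c' \<le> c''" "c'' < N" "xv c = xv c''"
  shows "xv c' = xv c"
proof (rule rk_inj)
  show "rk (xv c') = rk (xv c)"
    using rk_mono[of c c'] rk_mono[of c' c''] assms by simp
qed (use X1 assms in auto)

lemma stay_step:
  assumes "L < c" "c < c'" "c' < N" "xv c = xv c'"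
  shows "xv (Suc c) = xv c \<and> xi (Suc c) = Suc (xi c)"
proof -
  have "xv (Suc c) = xv c" using contiguous[of c "Suc c" c'] assms by simp
  then show ?thesis using X2[of c] assms by auto
qed

lemma stay_time:
  assumes "L < c" "c \<le> c'" "c' < N" "xv c = xv c'"
  shows "xi c' = xi c + (c' - c)"
  using assms(2,1,3,4)
proof (induction c' rule: dec_induct)
  case (step c')
  have "xv c' = xv c" using contiguous[of c c' "Suc c'"] step by simp
  then show ?case using stay_step[of c' "Suc c'"] step by simp
qed simp

text \<open>Going back from position \<open>c\<close>, the time drops in unit steps while the vertex
  stays the same, until the arc by which the spine entered it at time \<open>arr\<close>. No time in
  between is skipped, so a detour cannot get in front of the spine.\<close>

lemma stay_down:
  assumes "L < c" "c < N" "arr (xv c) \<le> i" "i \<le> xi c"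
  shows "\<exists>c'. L < c' \<and> c' \<le> c \<and> xv c' = xv c \<and> xi c' = i"
proof -
  have "Suc L \<le> c" using assms by simp
  then show ?thesis using assms
  proof (induction c rule: dec_induct)
    case base
    then show ?case using X3 by auto
  next
    case (step c)
    show ?case
    proof (cases "i = xi (Suc c)")
      case True then show ?thesis using step by (intro exI[of _ "Suc c"]) auto
    next
      case False
      with step have "i < xi (Suc c)" "arr (xv (Suc c)) \<noteq> xi (Suc c)" by auto
      then have e: "xv (Suc c) = xv c" "xi (Suc c) = Suc (xi c)" using X2[of c] step by auto
      then have "\<exists>c'>L. c' \<le> c \<and> xv c' = xv c \<and> xi c' = i"
        using step \<open>i < xi (Suc c)\<close> by auto
      then show ?thesis using e by (metis le_SucI)
    qed
  qed
qed

text \<open>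
  Label 0 means unlabelled; all copies of \<open>s\<close> have the label \<open>L\<close>, all copies of \<open>t\<close> the label \<open>N\<close>,
  and the \<open>c\<close>-th temporal vertex \<open>(xv c, xi c)\<close> of the spine has the label \<open>c\<close>.
\<close>

definition on_spine :: "(nat \<Rightarrow> nat \<Rightarrow> nat) \<Rightarrow> nat \<Rightarrow> nat \<Rightarrow> bool" where
  "on_spine lab v i \<longleftrightarrow> L < lab v i \<and> lab v i < N \<and> xv (lab v i) = v \<and> xi (lab v i) = i"

definition labelled :: "(nat \<Rightarrow> nat \<Rightarrow> nat) \<Rightarrow> nat \<Rightarrow> bool" where
  "labelled lab a \<longleftrightarrow>
     (\<forall>v i. T < i \<longrightarrow> lab v i = 0) \<and> (\<forall>i \<le> T. lab s i = L) \<and> (\<forall>i \<le> T. lab t i = N) \<and>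
     (\<forall>c. L < c \<and> c < N \<longrightarrow> lab (xv c) (xi c) = c) \<and>
     (\<forall>v i. 0 < lab v i \<longrightarrow> v \<noteq> s \<longrightarrow> v \<noteq> t \<longrightarrow>
        v < n \<and> 0 < arr v \<and> arr v \<le> i \<and> (on_spine lab v i \<or> L \<le> lab v i \<and> lab v i \<le> a))"

text \<open>The last alternative is the waiting of the spine itself: from one of its points to the
  next one at the same vertex the label rises by one.\<close>

definition waited :: "(nat \<Rightarrow> nat \<Rightarrow> nat) \<Rightarrow> nat \<Rightarrow> bool" where
  "waited lab a \<longleftrightarrow> (\<forall>v i. 0 < lab v i \<longrightarrow> lab v i < a \<longrightarrow> Suc i \<le> T \<longrightarrow>
     0 < lab v (Suc i) \<and> lab v (Suc i) \<le> lab v i \<or> lab v (Suc i) = Suc (lab v i) \<and> on_spine lab v (Suc i))"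

text \<open>Arcs back into the vertex of the point whose phase labelled the tail are exempt, because
  a detour taking one would visit this vertex twice. Along all other arcs a label can rise only by a
  return to the spine or to \<open>t\<close>, and then at most to \<open>best\<close>.\<close>

definition moved :: "(nat \<Rightarrow> nat \<Rightarrow> nat) \<Rightarrow> nat \<Rightarrow> nat \<Rightarrow> bool" where
  "moved lab best a \<longleftrightarrow> (\<forall>u i v. (u, i, v) \<in> A \<longrightarrow> 0 < lab u i \<longrightarrow> lab u i < a \<longrightarrow> v \<noteq> xv (lab u i) \<longrightarrow>
     0 < lab v i \<and> (lab v i \<le> lab u i \<or> lab v i \<le> best \<and> (on_spine lab v i \<or> v = t)))"

lemma labelledD:
  assumes "labelled lab a"
  shows "0 < lab v i \<Longrightarrow> i \<le> T" "i \<le> T \<Longrightarrow> lab s i = L" "i \<le> T \<Longrightarrow> lab t i = N"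
    "L < c \<Longrightarrow> c < N \<Longrightarrow> lab (xv c) (xi c) = c"
    "0 < lab v i \<Longrightarrow> v \<noteq> s \<Longrightarrow> v \<noteq> t \<Longrightarrow>
        v < n \<and> 0 < arr v \<and> arr v \<le> i \<and> (on_spine lab v i \<or> L \<le> lab v i \<and> lab v i \<le> a)"
  using assms unfolding labelled_def by (auto simp: not_less[symmetric])

lemma labelled_ge:
  assumes "labelled lab a" "0 < lab v i"
  shows "L \<le> lab v i \<and> lab v i \<le> max a N"
  using assms labelledD(1,2,3)[OF assms(1)] labelledD(5)[OF assms(1), of v i] L
  by (cases "v = s"; cases "v = t") (auto simp: on_spine_def)

text \<open>Any entry into a spine vertex up to time \<open>xi c\<close> meets the spine itself. The
  cut argument and the proofs that a trace does not visit a vertex twice both rest on this.\<close>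

lemma spine_label:
  assumes "labelled lab a" "L < c" "c < N" "xv c = v" "arr v \<le> i" "i \<le> xi c"
  shows "L < lab v i \<and> lab v i \<le> c \<and> on_spine lab v i"
proof -
  obtain c' where "L < c'" "c' \<le> c" "xv c' = xv c" "xi c' = i"
    using stay_down[of c i] assms by auto
  moreover from this have "lab v i = c'" using labelledD(4)[OF assms(1), of c'] assms by simp
  ultimately show ?thesis using assms by (auto simp: on_spine_def)
qed

text \<open>
  The tail of the cut argument, with \<open>\<theta>\<close> either the index of the cut or the first index of its
  vertex.
\<close>

lemma wait_below:
  assumes w: "waited lab a" and "\<theta> \<le> a"
    and "0 < lab v j" "lab v j < \<theta>" "j \<le> i" "i \<le> T"
    and avoid: "\<And>j'. j < j' \<Longrightarrow> j' \<le> i \<Longrightarrow> \<not> (xv \<theta> = v \<and> xi \<theta> = j')"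
  shows "0 < lab v i \<and> lab v i < \<theta>"
  using \<open>j \<le> i\<close> assms(3,4) \<open>i \<le> T\<close> avoid
proof (induction i rule: dec_induct)
  case (step i)
  then have i: "0 < lab v i" "lab v i < \<theta>" by auto
  then consider "0 < lab v (Suc i)" "lab v (Suc i) \<le> lab v i"
    | "lab v (Suc i) = Suc (lab v i)" "on_spine lab v (Suc i)"
    using w \<open>\<theta> \<le> a\<close> step.prems unfolding waited_def by (meson le_trans less_le_trans)
  then show ?case
  proof cases
    case 1 then show ?thesis using i by simp
  next
    case 2
    then have "lab v (Suc i) \<noteq> \<theta>"
      using step.prems(4)[of "Suc i"] step.hyps by (auto simp: on_spine_def)
    then show ?thesis using 2 i by simp
  qed
qed simp

text \<open>If a path avoids position \<open>b\<close>, all cells from which it departs have labels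
  below some \<theta>. Its last arc then forces the label \<open>N\<close> of \<open>t\<close> to be
  at most \<open>b\<close>, a contradiction. The bound \<theta> is \<open>b\<close> itself if the
  path leaves the vertex of position \<open>b\<close> in time or never visits it, and the first
  position of this vertex if the path enters it too late; \<open>core\<close> treats both.\<close>

lemma cut:
  assumes lab: "labelled lab a" and w: "waited lab b" and m: "moved lab b b"
    and b: "L < b" "b < N" and P: "npath (vs, ts)" and "D = {}"
  shows "(xv b, xi b) \<in> temporal_verts (vs, ts)"
proof (rule ccontr)
  assume avoid: "(xv b, xi b) \<notin> temporal_verts (vs, ts)"
  let ?w = "xv b"
  have vs: "length vs = Suc (length ts)" "vs \<noteq> []" "vs ! 0 = s" "vs ! length ts = t" "distinct vs" "sorted ts"
    using P hd_conv_nth[of vs] last_conv_nth[of vs] unfolding npath_def by (cases "vs = []"; simp)+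
  have arcs: "(vs ! h, ts ! h, vs ! Suc h) \<in> A" if "h < length ts" for h
    using P that \<open>D = {}\<close> unfolding npath_def AF_def by auto
  have ts: "ts \<noteq> []" using vs st by auto
  have bT: "?w \<noteq> s" "?w \<noteq> t" "arr ?w \<le> xi b" "xi b \<le> T" "0 < arr ?w" using X1 b by auto
  have reach: "0 < arr v \<and> arr v \<le> i" if "(u, i, v) \<in> A" "0 < lab u i" "u \<noteq> t" for u i v
  proof -
    have "0 < arr u \<and> arr u \<le> i"
      using labelledD(5)[OF lab, of u i] that arr_s arc[OF that(1)] by (cases "u = s") auto
    then show ?thesis using arr_closed that by blast
  qed
  \<comment> \<open>The cases differ in three points. \<open>p1\<close>: waiting never passes
    position \<theta>. \<open>p2\<close>: a return to the spine at a position up to \<open>b\<close>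
    is in fact below \<theta>. \<open>p3\<close>: an arc back into the vertex of position
    \<open>b\<close>, about which \<open>moved\<close> is silent, still ends below \<theta>.\<close>
  have core: False if \<theta>: "L < \<theta>" "\<theta> \<le> b"
    and p1: "\<And>h j. 0 < h \<Longrightarrow> h < length ts \<Longrightarrow> ts ! (h - 1) \<le> j \<Longrightarrow> j \<le> ts ! h \<Longrightarrow>
      \<not> (xv \<theta> = vs ! h \<and> xi \<theta> = j)"
    and p2: "\<And>h. 0 < h \<Longrightarrow> h < length ts \<Longrightarrow> on_spine lab (vs ! h) (ts ! (h - 1)) \<Longrightarrow>
      lab (vs ! h) (ts ! (h - 1)) \<le> b \<Longrightarrow> lab (vs ! h) (ts ! (h - 1)) < \<theta>"
    and p3: "\<And>h c. 0 < h \<Longrightarrow> h < length ts \<Longrightarrow> L < c \<Longrightarrow> c < \<theta> \<Longrightarrow> xv c = vs ! h \<Longrightarrow>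
      arr (vs ! h) \<le> ts ! (h - 1) \<Longrightarrow> vs ! h = ?w \<Longrightarrow>
      0 < lab (vs ! h) (ts ! (h - 1)) \<and> lab (vs ! h) (ts ! (h - 1)) < \<theta>"
    and p4: "xv \<theta> = ?w"
    for \<theta>
  proof -
    have below: "0 < lab (vs ! h) (ts ! h) \<and> lab (vs ! h) (ts ! h) < \<theta>" if "h < length ts" for h
      using that
    proof (induction h)
      case 0
      then show ?case using labelledD(2)[OF lab, of "ts ! 0"] arc[OF arcs[of 0]] vs L \<theta> by simp
    next
      case (Suc h)
      let ?u = "vs ! h" and ?v = "vs ! Suc h" and ?i = "ts ! h" and ?j = "ts ! Suc h"
      let ?c = "lab ?u ?i"
      have ih: "0 < ?c" "?c < \<theta>" using Suc by auto
      have a: "(?u, ?i, ?v) \<in> A" using arcs[of h] Suc by simp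
      have neq: "?v \<noteq> s" "?v \<noteq> t" "?u \<noteq> t"
        using vs Suc.prems nth_eq_iff_index_eq[OF vs(5), of "Suc h" 0]
          nth_eq_iff_index_eq[OF vs(5), of "Suc h" "length ts"] nth_eq_iff_index_eq[OF vs(5), of h "length ts"] by auto
      have iT: "?i \<le> T" "?j \<le> T" using arc[OF a] arc[OF arcs[of "Suc h"]] Suc.prems by auto
      have ij: "?i \<le> ?j" using vs Suc.prems by (simp add: sorted_nth_mono)
      have r: "arr ?v \<le> ?i" using reach[OF a ih(1) neq(3)] by simp
      have "0 < lab ?v ?i \<and> lab ?v ?i < \<theta>"
      proof (cases "?v = xv ?c")
        case False
        then have "0 < lab ?v ?i" "lab ?v ?i \<le> ?c \<or> lab ?v ?i \<le> b \<and> on_spine lab ?v ?i"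
          using m a ih \<theta> neq unfolding moved_def by (meson less_le_trans)+
        then show ?thesis using p2[of "Suc h"] Suc.prems ih by auto
      next
        \<comment> \<open>\<open>moved\<close> says nothing about this arc. If it arrives no later
          than position \<open>?c\<close>, the cell is a point of the spine at or before
          \<open>?c\<close>; if it arrives later, the cell is also reached by waiting from position
          \<open>?c\<close>.\<close>
        case True
        have c: "L < ?c" "?c < N" using True neq xL labelled_ge[OF lab ih(1)] ih \<theta> b
          by (auto simp: le_less)
        show ?thesis
        proof (cases "?v = ?w")
          case True
          then show ?thesis using p3[of "Suc h" ?c] Suc.prems c ih \<open>?v = xv ?c\<close> r by auto
        next
          case vw: False
          show ?thesis
          proof (cases "?i \<le> xi ?c")
            case i: True
            show ?thesis using spine_label[OF lab c True[symmetric] r i] ih by auto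
          next
            case False
            show ?thesis
              by (rule wait_below[OF w \<theta>(2), of "?v" "xi ?c"])
                 (use labelledD(4)[OF lab c] True c ih False iT p4 vw in auto)
          qed
        qed
      qed
      then show ?case
        by (intro wait_below[OF w \<theta>(2), of "?v" "?i"]) (use ij iT p1[of "Suc h"] Suc.prems in auto)
    qed
    let ?h = "length ts - 1"
    have h: "?h < length ts" "Suc ?h = length ts" using ts by auto
    have a: "(vs ! ?h, ts ! ?h, t) \<in> A" using arcs[OF h(1)] h vs by simp
    let ?c = "lab (vs ! ?h) (ts ! ?h)"
    have c: "0 < ?c" "?c < \<theta>" using below[OF h(1)] by auto
    have "t \<noteq> xv ?c"
      using xL X1[of ?c] labelled_ge[OF lab c(1)] c \<theta> b st by (cases "?c = L") auto
    then have "lab t (ts ! ?h) \<le> ?c \<or> lab t (ts ! ?h) \<le> b"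
      using m a c \<theta> unfolding moved_def by (meson less_le_trans)
    then show False using labelledD(3)[OF lab, of "ts ! ?h"] arc[OF a] c \<theta> b by auto
  qed
  have stay: "\<not> (ts ! (h - 1) \<le> xi b \<and> xi b \<le> ts ! h)" if "0 < h" "h < length ts" "vs ! h = ?w" for h
    using avoid that unfolding temporal_verts_def by auto
  have uniq: "h' = h" if "vs ! h = ?w" "vs ! h' = ?w" "h < length ts" "h' < length ts" for h h'
    using that vs nth_eq_iff_index_eq[OF vs(5), of h h'] by auto
  show False
  proof (cases "\<exists>h. 0 < h \<and> h < length ts \<and> vs ! h = ?w \<and> xi b < ts ! (h - 1)")
    \<comment> \<open>This includes the paths that never visit \<open>?w\<close>; for them
      \<open>before\<close> is vacuous.\<close>
    case False
    then have before: "ts ! h < xi b" if "0 < h" "h < length ts" "vs ! h = ?w" for h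
      using stay[OF that] that by auto
    show False
    proof (rule core[of b])
      fix h assume h: "0 < h" "h < length ts" "on_spine lab (vs ! h) (ts ! (h - 1))"
        "lab (vs ! h) (ts ! (h - 1)) \<le> b"
      moreover have "ts ! (h - 1) \<le> ts ! h" using vs h by (simp add: sorted_nth_mono)
      ultimately show "lab (vs ! h) (ts ! (h - 1)) < b"
        using before[of h] by (cases "lab (vs ! h) (ts ! (h - 1)) = b") (auto simp: on_spine_def)
    next
      fix h c assume h: "0 < h" "h < length ts" "arr (vs ! h) \<le> ts ! (h - 1)" "vs ! h = ?w"
      have "ts ! (h - 1) < xi b"
        using before[of h] h vs sorted_nth_mono[OF vs(6), of "h - 1" h] by simp
      moreover from this have "lab (vs ! h) (ts ! (h - 1)) \<le> b" "on_spine lab (vs ! h) (ts ! (h - 1))"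
        using spine_label[OF lab b h(4)[symmetric] h(3)] by auto
      ultimately show "0 < lab (vs ! h) (ts ! (h - 1)) \<and> lab (vs ! h) (ts ! (h - 1)) < b"
        by (cases "lab (vs ! h) (ts ! (h - 1)) = b") (auto simp: on_spine_def)
    next
      fix h j assume h: "0 < h" "h < length ts" "ts ! (h - 1) \<le> j" "j \<le> ts ! h"
      show "\<not> (xv b = vs ! h \<and> xi b = j)"
        using before[of h] h by auto
    qed (use b in simp_all)
  next
    case True
    then obtain h0 where h0: "0 < h0" "h0 < length ts" "vs ! h0 = ?w" "xi b < ts ! (h0 - 1)" by blast
    have after: "xi b < j" if "h < length ts" "vs ! h = ?w" "ts ! (h - 1) \<le> j" for h j
      using uniq[of h0 h] h0 that by simp
    \<comment> \<open>All positions from \<theta> to \<open>b\<close> lie at \<open>?w\<close> and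
      at times up to \<open>xi b\<close>, which this path misses. The bound can thus be lowered to
      the first of them, and then \<open>p3\<close> is vacuous: no position strictly between
      \<open>L\<close> and \<theta> has the vertex \<open>?w\<close>.\<close>
    define \<theta> where "\<theta> = (LEAST c. L < c \<and> xv c = ?w)"
    have \<theta>: "L < \<theta>" "xv \<theta> = ?w" "\<theta> \<le> b"
      using LeastI[of "\<lambda>c. L < c \<and> xv c = ?w" b] Least_le[of "\<lambda>c. L < c \<and> xv c = ?w" b] b
      unfolding \<theta>_def by auto
    have least: "xv c \<noteq> ?w" if "L < c" "c < \<theta>" for c
      using not_less_Least[of c "\<lambda>c. L < c \<and> xv c = ?w"] that unfolding \<theta>_def by blast
    have "xi \<theta> = arr ?w"
    proof (cases "\<theta> = Suc L")
      case True
      then show ?thesis using X3 \<theta> by simp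
    next
      case False
      then obtain c where c: "\<theta> = Suc c" "L < c" using \<theta> by (cases \<theta>) auto
      then show ?thesis using X2[of c] least[of c] \<theta> b by auto
    qed
    show False
    proof (rule core[of \<theta>])
      fix h j assume "0 < h" "h < length ts" "ts ! (h - 1) \<le> j"
      then show "\<not> (xv \<theta> = vs ! h \<and> xi \<theta> = j)"
        using after[of h j] \<theta> \<open>xi \<theta> = arr ?w\<close> bT by auto
    next
      fix h assume h: "0 < h" "h < length ts" "on_spine lab (vs ! h) (ts ! (h - 1))"
        "lab (vs ! h) (ts ! (h - 1)) \<le> b"
      let ?c = "lab (vs ! h) (ts ! (h - 1))"
      show "?c < \<theta>"
      proof (rule ccontr)
        assume "\<not> ?c < \<theta>"
        then have "xv ?c = ?w" using contiguous[of \<theta> ?c b] \<theta> h b by simp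
        then have "xi ?c \<le> xi b" "vs ! h = ?w" "xi ?c = ts ! (h - 1)"
          using stay_time[of ?c b] h b by (auto simp: on_spine_def)
        then show False using after[of h "ts ! (h - 1)"] h by simp
      qed
    qed (use \<theta> least in auto)
  qed
qed

text \<open>
  The colour of the labels alternates between consecutive points \<open>x\<^sub>\<beta>\<close>. Each of the two walks is
  monochromatic outside \<open>s\<close> and they have different colours, hence they are disjoint.
\<close>

definition colored :: "(nat \<Rightarrow> nat \<Rightarrow> nat) \<Rightarrow> (nat \<Rightarrow> bool) \<Rightarrow> nat \<Rightarrow> bool \<Rightarrow> (nat \<times> nat) set \<Rightarrow> bool" where
  "colored lab col l k Z \<longleftrightarrow> (\<forall>(v, i) \<in> Z. 0 < lab v i \<and> lab v i \<le> l \<and> col (lab v i) = k)"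

text \<open>A trace uses only labels of the colour of its end and none above it. Labels given later
  cannot spoil it, and traces of different colours have no cell in common.\<close>

definition traced :: "(nat \<Rightarrow> nat \<Rightarrow> nat) \<Rightarrow> (nat \<Rightarrow> nat \<Rightarrow> nat) \<Rightarrow> (nat \<Rightarrow> bool) \<Rightarrow> nat \<Rightarrow> bool" where
  "traced lab par col a \<longleftrightarrow> (\<forall>v i. 0 < lab v i \<longrightarrow> lab v i \<le> a \<longrightarrow>
     (\<exists>vs ts Z. tr par v i vs ts Z \<and> colored lab col (lab v i) (col (lab v i)) Z))"

lemma tracedD:
  "traced lab par col a \<Longrightarrow> 0 < lab v i \<Longrightarrow> lab v i \<le> a \<Longrightarrow>
    \<exists>vs ts Z. tr par v i vs ts Z \<and> colored lab col (lab v i) (col (lab v i)) Z"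
  unfolding traced_def by blast

text \<open>The exception is position \<open>beta\<close>, whose pointer already leads into the
  detour that returns there.\<close>

definition linked :: "(nat \<Rightarrow> nat \<Rightarrow> nat) \<Rightarrow> nat \<Rightarrow> nat \<Rightarrow> bool" where
  "linked par a beta \<longleftrightarrow>
     (\<forall>c. a \<le> c \<longrightarrow> Suc c < N \<longrightarrow> Suc c \<noteq> beta \<longrightarrow> par (xv (Suc c)) (xi (Suc c)) = xv c)"

text \<open>\<open>(bv, bi)\<close> is the tail of the arc by which the farthest detour returns. Its
  colour is that of the walk now on the spine, which is the one to take this detour. A return into
  the vertex where the detour started is excluded; otherwise this vertex would be visited twice.
  \<open>AF\<close> admits the direct arc as a detour.\<close>

definition event :: "(nat \<Rightarrow> nat \<Rightarrow> nat) \<Rightarrow> (nat \<Rightarrow> bool) \<Rightarrow> nat \<Rightarrow> nat \<Rightarrow> nat \<Rightarrow> nat \<Rightarrow> bool" where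
  "event lab col a best bv bi \<longleftrightarrow>
     L \<le> lab bv bi \<and> lab bv bi \<le> a \<and> col (lab bv bi) = col a \<and>
     (if best < N then xi best = bi \<and> (bv, bi, xv best) \<in> A \<and> xv best \<noteq> xv (lab bv bi)
      else (bv, bi, t) \<in> AF)"

text \<open>This is the walk that is off the spine at the moment, in the opposite colour. It comes
  back by the pointer of position \<open>beta\<close>; if \<open>beta = N\<close>, no pointer is
  available for \<open>t\<close> and the tail is found in \<open>bv\<close> and
  \<open>bi\<close>.\<close>

definition pending ::
  "(nat \<Rightarrow> nat \<Rightarrow> nat) \<Rightarrow> (nat \<Rightarrow> nat \<Rightarrow> nat) \<Rightarrow> (nat \<Rightarrow> bool) \<Rightarrow> nat \<Rightarrow> nat \<Rightarrow> nat \<Rightarrow> nat \<Rightarrow> bool" where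
  "pending lab par col a beta bv bi \<longleftrightarrow>
     (\<exists>u i vs ts Z. tr par u i vs ts Z \<and> colored lab col a (\<not> col a) Z \<and> xv beta \<notin> set vs \<and>
        (if beta < N then i = xi beta \<and> u = par (xv beta) i \<and> (u, i, xv beta) \<in> A
         else u = bv \<and> i = bi \<and> (u, i, t) \<in> AF))"

text \<open>Waiting is left out, because it is violated for a moment whenever the sweep reaches a
  new position. A direct arc is a detour that nothing surpasses, hence \<open>best = N\<close> as
  soon as \<open>D\<close> is nonempty.\<close>

definition core ::
  "(nat \<Rightarrow> nat \<Rightarrow> nat) \<Rightarrow> (nat \<Rightarrow> nat \<Rightarrow> nat) \<Rightarrow> (nat \<Rightarrow> bool) \<Rightarrow> nat \<Rightarrow> nat \<Rightarrow> nat \<Rightarrow> nat \<Rightarrow> nat \<Rightarrow> bool" where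
  "core lab par col a beta best bv bi \<longleftrightarrow>
     L \<le> a \<and> a < beta \<and> beta \<le> best \<and> best \<le> N \<and> (D \<noteq> {} \<longrightarrow> best = N) \<and>
     labelled lab a \<and> moved lab best a \<and> traced lab par col a \<and> linked par a beta \<and>
     (beta < best \<longrightarrow> event lab col a best bv bi) \<and> pending lab par col a beta bv bi"

definition inv where
  "inv lab par col a beta best bv bi \<longleftrightarrow> core lab par col a beta best bv bi \<and> waited lab (Suc a)"

section \<open>Labelling a run of unlabelled times\<close>

definition fresh :: "(nat \<Rightarrow> nat \<Rightarrow> nat) \<Rightarrow> nat \<Rightarrow> nat \<Rightarrow> nat \<Rightarrow> bool" where
  "fresh lab v i j \<longleftrightarrow> i \<le> j \<and> j \<le> T \<and> (\<forall>j'. i \<le> j' \<longrightarrow> j' \<le> j \<longrightarrow> lab v j' = 0)"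

text \<open>The effect of propagating waiting from \<open>(v, i)\<close> in one step: the run of
  unlabelled cells is filled up to the first labelled one, and nothing happens if
  \<open>(v, i)\<close> is labelled already.\<close>

definition mark :: "(nat \<Rightarrow> nat \<Rightarrow> nat) \<Rightarrow> nat \<Rightarrow> nat \<Rightarrow> nat \<Rightarrow> nat \<Rightarrow> nat \<Rightarrow> nat" where
  "mark lab v i a = (\<lambda>v' j. if v' = v \<and> fresh lab v i j then a else lab v' j)"

definition mark_par ::
  "(nat \<Rightarrow> nat \<Rightarrow> nat) \<Rightarrow> (nat \<Rightarrow> nat \<Rightarrow> nat) \<Rightarrow> nat \<Rightarrow> nat \<Rightarrow> nat \<Rightarrow> nat \<Rightarrow> nat \<Rightarrow> nat" where
  "mark_par par lab v i u =
     (\<lambda>v' j. if v' = v \<and> fresh lab v i j then (if j = i then u else v) else par v' j)"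

lemma mark_old: "0 < lab v' j \<Longrightarrow> mark lab v i a v' j = lab v' j"
  unfolding mark_def fresh_def by auto

lemma mark_par_old: "0 < lab v' j \<Longrightarrow> mark_par par lab v i u v' j = par v' j"
  unfolding mark_par_def fresh_def by auto

lemma mark_new: "mark lab v i a v' j \<noteq> lab v' j \<Longrightarrow> v' = v \<and> fresh lab v i j \<and> mark lab v i a v' j = a"
  unfolding mark_def by (auto split: if_splits)

lemma on_spine_mark: "on_spine lab v' j \<Longrightarrow> on_spine (mark lab v i a) v' j"
  using mark_old[of lab v' j v i a] unfolding on_spine_def by auto

lemma labelled_mark:
  assumes lab: "labelled lab a" and a: "L \<le> a" and v: "v < n" "0 < arr v" "arr v \<le> i"
  shows "labelled (mark lab v i a) a"
proof -
  note D = labelledD[OF lab]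
  have old: "mark lab v i a v' j = lab v' j" if "0 < lab v' j" for v' j
    using mark_old[of lab, OF that] .
  have "mark lab v i a v' j = 0" if "T < j" for v' j
    using that D(1)[of v' j] unfolding mark_def fresh_def by auto
  moreover have "mark lab v i a s j = L" "mark lab v i a t j = N" if "j \<le> T" for j
    using old[of s j] old[of t j] D(2,3)[OF that] L by auto
  moreover have "mark lab v i a (xv c) (xi c) = c" if "L < c" "c < N" for c
    using old[of "xv c" "xi c"] D(4)[OF that] that by auto
  moreover have "v' < n \<and> 0 < arr v' \<and> arr v' \<le> j \<and>
      (on_spine (mark lab v i a) v' j \<or> L \<le> mark lab v i a v' j \<and> mark lab v i a v' j \<le> a)"
    if "0 < mark lab v i a v' j" "v' \<noteq> s" "v' \<noteq> t" for v' j
  proof (cases "mark lab v i a v' j = lab v' j")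
    case True
    then show ?thesis using D(5)[of v' j] that on_spine_mark[of lab v' j v i a] by auto
  next
    case False
    then show ?thesis using mark_new[OF False] v a unfolding fresh_def by auto
  qed
  ultimately show ?thesis unfolding labelled_def by blast
qed

lemma moved_mark:
  assumes "moved lab best a"
  shows "moved (mark lab v i a) best a"
  unfolding moved_def
proof (intro allI impI)
  fix u j v'
  assume h: "(u, j, v') \<in> A" "0 < mark lab v i a u j" "mark lab v i a u j < a" "v' \<noteq> xv (mark lab v i a u j)"
  then have e: "mark lab v i a u j = lab u j" using mark_new[of lab v i a u j] by auto
  then have r: "0 < lab v' j \<and> (lab v' j \<le> lab u j \<or> lab v' j \<le> best \<and> (on_spine lab v' j \<or> v' = t))"
    using assms h unfolding moved_def by auto
  then have "mark lab v i a v' j = lab v' j" using mark_old by blast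
  with r e on_spine_mark[of lab v' j v i a] show "0 < mark lab v i a v' j \<and>
    (mark lab v i a v' j \<le> mark lab v i a u j \<or>
     mark lab v i a v' j \<le> best \<and> (on_spine (mark lab v i a) v' j \<or> v' = t))"
    by auto
qed

text \<open>The last alternative of \<open>wa\<close> is the only unmet obligation, waiting at the
  position just reached, and the run starts right there. At its other end the run stops at time
  \<open>T\<close> or at a labelled cell. That cell is not on the spine, since the spine would also
  occupy the cell before it, which was unlabelled; so its label is at most \<open>a\<close>.\<close>

lemma waited_mark:
  assumes lab: "labelled lab a" and a: "L \<le> a" "a < N" and v: "arr v \<le> i"
    and w: "waited lab a"
    and wa: "\<And>v' j. lab v' j = a \<Longrightarrow> Suc j \<le> T \<Longrightarrow>
      0 < lab v' (Suc j) \<and> lab v' (Suc j) \<le> a \<or> lab v' (Suc j) = Suc a \<and> on_spine lab v' (Suc j) \<or>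
      v' = v \<and> Suc j = i \<and> on_spine lab v j"
  shows "waited (mark lab v i a) (Suc a)"
  unfolding waited_def
proof (intro allI impI)
  fix v' j
  let ?lab = "mark lab v i a"
  assume h: "0 < ?lab v' j" "?lab v' j < Suc a" "Suc j \<le> T"
  note D = labelledD[OF lab]
  show "0 < ?lab v' (Suc j) \<and> ?lab v' (Suc j) \<le> ?lab v' j \<or>
      ?lab v' (Suc j) = Suc (?lab v' j) \<and> on_spine ?lab v' (Suc j)"
  proof (cases "?lab v' j = lab v' j")
    case True
    consider "0 < lab v' (Suc j)" "lab v' (Suc j) \<le> lab v' j"
      | "lab v' (Suc j) = Suc (lab v' j)" "on_spine lab v' (Suc j)"
      | "v' = v" "Suc j = i" "on_spine lab v j" "lab v j = a"
    proof (cases "lab v' j = a")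
      case True
      then show ?thesis using wa[of v' j] h that by auto
    next
      case False
      then have "0 < lab v' j" "lab v' j < a" using h \<open>?lab v' j = lab v' j\<close> by auto
      then show ?thesis using w[unfolded waited_def, rule_format, of v' j] h that by auto
    qed
    then show ?thesis
    proof cases
      case 1
      then show ?thesis using mark_old[of lab v' "Suc j" v i a] True by auto
    next
      case 2
      then show ?thesis using mark_old[of lab v' "Suc j" v i a] True on_spine_mark[of lab v' "Suc j" v i a] by auto
    next
      case 3
      show ?thesis
      proof (cases "lab v i = 0")
        case True
        then have "fresh lab v i i" using 3 h unfolding fresh_def by auto
        then show ?thesis using 3 \<open>?lab v' j = lab v' j\<close> a L unfolding mark_def by auto
      next
        case False
        then have keep: "?lab v i = lab v i" by (simp add: mark_old)
        have x: "xv a = v" "xi a = j" "L < a" using 3 by (auto simp: on_spine_def)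
        have v: "v \<noteq> s" "v \<noteq> t" using X1[of a] x a by auto
        consider "lab v i \<le> a" | "on_spine lab v i" "a < lab v i"
          using D(5)[of v i] False v by force
        then show ?thesis
        proof cases
          case 1 then show ?thesis using keep 3 False \<open>?lab v' j = lab v' j\<close> by auto
        next
          case c: 2
          then have "xv (Suc a) = v" "xi (Suc a) = i"
            using stay_step[of a "lab v i"] x 3 by (auto simp: on_spine_def)
          then have "lab v i = Suc a" using D(4)[of "Suc a"] x c by (auto simp: on_spine_def)
          then show ?thesis using keep 3 c on_spine_mark[of lab v i v i a] \<open>?lab v' j = lab v' j\<close> by auto
        qed
      qed
    qed
  next
    case False
    then have new: "v' = v" "fresh lab v i j" "?lab v' j = a" using mark_new by blast+
    show ?thesis
    proof (cases "lab v (Suc j) = 0")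
      case True
      then have "fresh lab v i (Suc j)" using new h by (auto simp: fresh_def le_Suc_eq)
      then show ?thesis using new a L unfolding mark_def by auto
    next
      case False
      have z: "lab v j = 0" "i \<le> j" using new by (auto simp: fresh_def)
      then have "v \<noteq> s" "v \<noteq> t" using D(2,3)[of j] h L by auto
      moreover have "\<not> on_spine lab v (Suc j)"
        using spine_label[OF lab, of "lab v (Suc j)" v j] z v by (auto simp: on_spine_def)
      ultimately have "lab v (Suc j) \<le> a" using D(5)[of v "Suc j"] False by auto
      then show ?thesis using mark_old[of lab v "Suc j" v i a] False new by auto
    qed
  qed
qed

lemma colored_mark:
  "colored lab col l k Z \<Longrightarrow> colored (mark lab v i a) col l k Z"
  unfolding colored_def using mark_old[of lab] by (auto split: prod.splits)

lemma tr_mark: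
  "tr par u j vs ts Z \<Longrightarrow> colored lab col l k Z \<Longrightarrow> tr (mark_par par lab v i w) u j vs ts Z"
  by (erule tr_cong) (auto simp: colored_def intro!: mark_par_old)

text \<open>Only the first cell of the run needs a new argument, \<open>first\<close>; the trace of
  each further cell extends the previous one by waiting.\<close>

lemma traced_mark:
  assumes tra: "traced lab par col a" and lab: "labelled lab a"
    and first: "fresh lab v i i \<Longrightarrow> \<exists>vs ts Z. tr (mark_par par lab v i u) v i vs ts Z \<and>
      colored (mark lab v i a) col a (col a) Z"
  shows "traced (mark lab v i a) (mark_par par lab v i u) col a"
  unfolding traced_def
proof (intro allI impI)
  fix v' j
  let ?lab = "mark lab v i a" and ?par = "mark_par par lab v i u"
  assume h: "0 < ?lab v' j" "?lab v' j \<le> a"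
  show "\<exists>vs ts Z. tr ?par v' j vs ts Z \<and> colored ?lab col (?lab v' j) (col (?lab v' j)) Z"
  proof (cases "?lab v' j = lab v' j")
    case True
    then obtain vs ts Z where "tr par v' j vs ts Z" "colored lab col (lab v' j) (col (lab v' j)) Z"
      using tra[unfolded traced_def, rule_format, of v' j] h by auto
    then show ?thesis using tr_mark colored_mark True by metis
  next
    case False
    then have new: "v' = v" "fresh lab v i j" "?lab v' j = a" using mark_new by blast+
    have a0: "0 < a" using h new by simp
    have "i \<le> j" using new by (simp add: fresh_def)
    then have "\<exists>vs ts Z. tr ?par v j vs ts Z \<and> colored ?lab col a (col a) Z" using new(2)
    proof (induction j rule: dec_induct)
      case base then show ?case using first by blast
    next
      case (step j)
      then have f: "fresh lab v i j" by (auto simp: fresh_def)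
      then obtain vs ts Z where Z: "tr ?par v j vs ts Z" "colored ?lab col a (col a) Z"
        using step by blast
      have "v \<noteq> s" using labelledD(2)[OF lab, of i] L step.prems by (auto simp: fresh_def)
      moreover have "?par v (Suc j) = v" using step by (simp add: mark_par_def)
      ultimately have "tr ?par v (Suc j) vs ts (insert (v, Suc j) Z)" using tr.wait[OF Z(1)] by blast
      moreover have "?lab v (Suc j) = a" using step by (simp add: mark_def)
      then have "colored ?lab col a (col a) (insert (v, Suc j) Z)" using Z(2) a0 by (simp add: colored_def)
      ultimately show ?case by blast
    qed
    then show ?thesis using new by simp
  qed
qed

lemma core_mark:
  assumes c: "core lab par col a beta best bv bi" and a: "a < N"
    and v: "v < n" "0 < arr v" "arr v \<le> i"
    and first: "fresh lab v i i \<Longrightarrow> \<exists>vs ts Z. tr (mark_par par lab v i u) v i vs ts Z \<and>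
      colored (mark lab v i a) col a (col a) Z"
  shows "core (mark lab v i a) (mark_par par lab v i u) col a beta best bv bi"
proof -
  note c' = c[unfolded core_def]
  then have lab: "labelled lab a" and La: "L \<le> a" by auto
  have "linked (mark_par par lab v i u) a beta"
    unfolding linked_def
  proof (intro allI impI)
    fix c assume "a \<le> c" "Suc c < N" "Suc c \<noteq> beta"
    moreover from this have "0 < lab (xv (Suc c)) (xi (Suc c))"
      using labelledD(4)[OF lab, of "Suc c"] La by simp
    ultimately show "mark_par par lab v i u (xv (Suc c)) (xi (Suc c)) = xv c"
      using c' by (simp add: mark_par_old linked_def)
  qed
  moreover have "event (mark lab v i a) col a best bv bi" if "event lab col a best bv bi"
  proof -
    have "0 < lab bv bi" using that L unfolding event_def by auto
    then show ?thesis using that unfolding event_def by (simp add: mark_old)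
  qed
  moreover have "pending (mark lab v i a) (mark_par par lab v i u) col a beta bv bi"
  proof -
    obtain u' i' vs ts Z where "tr par u' i' vs ts Z" "colored lab col a (\<not> col a) Z"
      "xv beta \<notin> set vs" and p: "if beta < N then i' = xi beta \<and> u' = par (xv beta) i' \<and> (u', i', xv beta) \<in> A
         else u' = bv \<and> i' = bi \<and> (u', i', t) \<in> AF"
      using c' unfolding pending_def by blast
    moreover have "mark_par par lab v i u (xv beta) (xi beta) = par (xv beta) (xi beta)" if "beta < N"
      using labelledD(4)[OF lab, of beta] that c' by (simp add: mark_par_old)
    ultimately show ?thesis
      unfolding pending_def using tr_mark colored_mark
      by (intro exI[of _ u'] exI[of _ i'] exI[of _ vs] exI[of _ ts] exI[of _ Z]) (auto split: if_splits)
  qed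
  ultimately show ?thesis
    using c' labelled_mark[OF lab La v] moved_mark traced_mark[OF _ lab first]
    unfolding core_def by blast
qed

section \<open>One arc, one phase, one step along the spine\<close>

lemma lab_source:
  assumes lab: "labelled lab a" and a: "(u, i, v) \<in> A" "0 < lab u i" "lab u i < N"
  shows "0 < arr v \<and> arr v \<le> i"
proof -
  have "i \<le> T" "1 \<le> i" using arc[OF a(1)] by auto
  then have "u \<noteq> t" using labelledD(3)[OF lab, of i] a by auto
  then have "0 < arr u \<and> arr u \<le> i"
    using labelledD(5)[OF lab, of u i] a arr_s \<open>1 \<le> i\<close> by (cases "u = s") auto
  then show ?thesis using arr_closed a by blast
qed

text \<open>The point is that the trace of \<open>(u, i)\<close> does not visit \<open>v\<close>.
  After an earlier visit, waiting would have labelled \<open>(v, i)\<close> as well, unless it met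
  position \<open>Suc a\<close>. In that case the spine was at \<open>v\<close> one time unit
  earlier already, hence \<open>v = xv a\<close>, which is excluded.\<close>

lemma inv_mark:
  assumes I: "inv lab par col a beta best bv bi" and a: "a < N"
    and uv: "(u, i, v) \<in> A" "lab u i = a" "v \<noteq> xv a" and v0: "lab v i = 0"
  shows "inv (mark lab v i a) (mark_par par lab v i u) col a beta best bv bi"
proof -
  have c: "core lab par col a beta best bv bi" and w: "waited lab (Suc a)"
    using I unfolding inv_def by auto
  then have lab: "labelled lab a" and La: "L \<le> a" and tra: "traced lab par col a"
    unfolding core_def by auto
  note D = labelledD[OF lab]
  have i: "1 \<le> i" "i \<le> T" "v < n" using arc[OF uv(1)] by auto
  have av: "0 < arr v" "arr v \<le> i" using lab_source[OF lab uv(1)] uv a La L by auto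
  have v: "v \<noteq> s" "v \<noteq> t" using D(2,3)[OF i(2)] v0 L by auto
  let ?par = "mark_par par lab v i u"
  have first: "\<exists>vs ts Z. tr ?par v i vs ts Z \<and> colored (mark lab v i a) col a (col a) Z"
  proof -
    obtain vs ts Z where Z: "tr par u i vs ts Z" "colored lab col a (col a) Z"
      using tracedD[OF tra, of u i] uv La L by auto
    have "v \<notin> set vs"
    proof
      assume "v \<in> set vs"
      then obtain j where j: "(v, j) \<in> Z" "j \<le> i" using tr_Z[OF Z(1)] v by blast
      then have l: "0 < lab v j" "lab v j < Suc a" using Z(2) by (auto simp: colored_def)
      have "\<exists>j'. j < j' \<and> j' \<le> i \<and> xv (Suc a) = v \<and> xi (Suc a) = j'"
        using wait_below[OF w order_refl l j(2) i(2)] v0 by auto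
      then have x: "xv (Suc a) = v" "j < xi (Suc a)" by auto
      then have "Suc a < N" using a v xN by (cases "Suc a = N") auto
      have "arr v \<le> xi (Suc a) - 1" using D(5)[of v j] l v x by auto
      then obtain c where cc: "L < c" "c \<le> Suc a" "xv c = v" "xi c = xi (Suc a) - 1"
        using stay_down[of "Suc a" "xi (Suc a) - 1"] La \<open>Suc a < N\<close> x by auto
      then have "c \<noteq> Suc a" using x by auto
      then have "xv a = v" using contiguous[of c a "Suc a"] cc x \<open>Suc a < N\<close> by auto
      then show False using uv by simp
    qed
    moreover have "?par v i = u" using v0 i by (simp add: mark_par_def fresh_def)
    ultimately have "tr ?par v i (vs @ [v]) (ts @ [i]) (insert (v, i) Z)"
      using tr.move[OF tr_mark[OF Z]] uv by blast
    moreover have "mark lab v i a v i = a" using v0 i by (simp add: mark_def fresh_def)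
    then have "colored (mark lab v i a) col a (col a) (insert (v, i) Z)"
      using colored_mark[OF Z(2)] La L by (simp add: colored_def)
    ultimately show ?thesis by blast
  qed
  have "waited (mark lab v i a) (Suc a)"
  proof (rule waited_mark[OF lab La a av(2)])
    show "waited lab a" using w unfolding waited_def by auto
    fix v' j assume "lab v' j = a" "Suc j \<le> T"
    then show "0 < lab v' (Suc j) \<and> lab v' (Suc j) \<le> a \<or> lab v' (Suc j) = Suc a \<and> on_spine lab v' (Suc j) \<or>
      v' = v \<and> Suc j = i \<and> on_spine lab v j"
      using w[unfolded waited_def, rule_format, of v' j] La L by auto
  qed
  then show ?thesis using core_mark[OF c a i(3) av first] unfolding inv_def by simp
qed

text \<open>Labels off the spine are at most \<open>a\<close> and \<open>a < best\<close>. A larger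
  label than \<open>best\<close> is therefore found only on the spine or at \<open>t\<close>, so the
  arc is a genuine return.\<close>

lemma inv_event:
  assumes I: "inv lab par col a beta best bv bi" and a: "a < N"
    and uv: "(u, i, v) \<in> A" "lab u i = a" "v \<noteq> xv a" and l: "best < lab v i"
  shows "inv lab par col a beta (lab v i) u i"
proof -
  note c = I[unfolded inv_def core_def]
  then have lab: "labelled lab a" and La: "L \<le> a" and b: "a < beta" "beta \<le> best" "best \<le> N" by auto
  note D = labelledD[OF lab]
  have i: "1 \<le> i" "i \<le> T" "v < n" using arc[OF uv(1)] by auto
  have v: "v \<noteq> s" using D(2)[OF i(2)] l b La by auto
  have N: "lab v i \<le> N" using labelled_ge[OF lab, of v i] l a by auto
  have ev: "event lab col a (lab v i) u i"
  proof (cases "v = t")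
    case True
    then show ?thesis using D(3)[OF i(2)] uv La L unfolding event_def AF_def by auto
  next
    case False
    then have "on_spine lab v i" using D(5)[of v i] v l b by auto
    then show ?thesis using uv La unfolding event_def on_spine_def by auto
  qed
  have "moved lab (lab v i) a"
    using c l unfolding moved_def by (meson less_imp_le le_trans)
  moreover have "pending lab par col a beta u i"
    using c b l N unfolding pending_def by auto
  ultimately show ?thesis using c ev b l N unfolding inv_def core_def by auto
qed

lemma moved_Suc:
  assumes I: "inv lab par col a beta best bv bi"
    and closed: "\<And>u i v. (u, i, v) \<in> A \<Longrightarrow> lab u i = a \<Longrightarrow> v \<noteq> xv a \<Longrightarrow> 0 < lab v i \<and> lab v i \<le> best"
  shows "moved lab best (Suc a)"
  unfolding moved_def
proof (intro allI impI)
  fix u i v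
  assume h: "(u, i, v) \<in> A" "0 < lab u i" "lab u i < Suc a" "v \<noteq> xv (lab u i)"
  note c = I[unfolded inv_def core_def]
  then have lab: "labelled lab a" by auto
  show "0 < lab v i \<and> (lab v i \<le> lab u i \<or> lab v i \<le> best \<and> (on_spine lab v i \<or> v = t))"
  proof (cases "lab u i = a")
    case True
    then have "0 < lab v i" "lab v i \<le> best" using closed[of u i v] h by auto
    then show ?thesis
      using labelledD(5)[OF lab, of v i] labelledD(2)[OF lab, of i] labelledD(1)[OF lab, of v i] True c
      by (cases "v = s") auto
  next
    case False
    then show ?thesis using c h unfolding moved_def by auto
  qed
qed

text \<open>By \<open>core\<close>, \<open>best < N\<close> rules out direct arcs, so
  \<open>cut\<close> applies to every path.\<close>

lemma inv_cut:
  assumes I: "inv lab par col a beta best bv bi" and m: "moved lab best (Suc a)"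
    and b: "Suc a = beta" "beta = best" "best < N" and P: "npath P"
  shows "(xv beta, xi beta) \<in> temporal_verts P"
proof -
  note c = I[unfolded inv_def core_def]
  then have "labelled lab a" "waited lab beta" "moved lab beta beta" "L < beta" "beta < N" "D = {}"
    using m b by auto
  then show ?thesis using cut P by (metis surj_pair)
qed

text \<open>
  What the invariant looks like when the sweep arrives at \<open>x\<^sub>a\<close>: waiting at \<open>x\<^sub>a\<close> is still to be
  propagated.
\<close>

definition arrived where
  "arrived lab par col a beta best bv bi \<longleftrightarrow> core lab par col a beta best bv bi \<and> L < a \<and> a < N \<and>
     waited lab a \<and> (\<forall>v i. lab v i = a \<longrightarrow> on_spine lab v i)"

text \<open>Filling the run after the new position supplies exactly the waiting condition that
  \<open>arrived\<close> lacks.\<close>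

lemma inv_start:
  assumes R: "arrived lab par col a beta best bv bi"
  shows "inv (mark lab (xv a) (Suc (xi a)) a) (mark_par par lab (xv a) (Suc (xi a)) (xv a)) col a beta best bv bi"
proof -
  have c: "core lab par col a beta best bv bi" and a: "L < a" "a < N"
    and w: "waited lab a" and sp: "\<And>v i. lab v i = a \<Longrightarrow> on_spine lab v i"
    using R unfolding arrived_def by auto
  then have lab: "labelled lab a" and La: "L \<le> a" and tra: "traced lab par col a"
    unfolding core_def by auto
  note D = labelledD[OF lab]
  let ?v = "xv a" and ?i = "Suc (xi a)"
  let ?par = "mark_par par lab ?v ?i ?v"
  have v: "?v < n" "?v \<noteq> s" "0 < arr ?v" "arr ?v \<le> ?i" "lab ?v (xi a) = a"
    using X1[OF a] D(4)[OF a] by auto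
  have first: "\<exists>vs ts Z. tr ?par ?v ?i vs ts Z \<and> colored (mark lab ?v ?i a) col a (col a) Z"
    if f: "fresh lab ?v ?i ?i"
  proof -
    obtain vs ts Z where Z: "tr par ?v (xi a) vs ts Z" "colored lab col a (col a) Z"
      using tracedD[OF tra, of ?v "xi a"] v a by auto
    have "?par ?v ?i = ?v" using f by (simp add: mark_par_def)
    then have "tr ?par ?v ?i vs ts (insert (?v, ?i) Z)" using tr.wait[OF tr_mark[OF Z] v(2)] by blast
    moreover have "mark lab ?v ?i a ?v ?i = a" using f by (simp add: mark_def)
    then have "colored (mark lab ?v ?i a) col a (col a) (insert (?v, ?i) Z)"
      using colored_mark[OF Z(2)] a by (simp add: colored_def)
    ultimately show ?thesis by blast
  qed
  have "waited (mark lab ?v ?i a) (Suc a)"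
    by (rule waited_mark[OF lab La a(2) v(4) w]) (use sp in \<open>auto simp: on_spine_def\<close>)
  then show ?thesis using core_mark[OF c a(2) v(1,3,4) first] unfolding inv_def by simp
qed

lemma labelled_Suc:
  assumes "labelled lab a"
  shows "labelled lab (Suc a)" and "Suc a < N \<Longrightarrow> lab v i = Suc a \<Longrightarrow> L \<le> a \<Longrightarrow> on_spine lab v i"
proof -
  show "labelled lab (Suc a)" using assms unfolding labelled_def by (meson le_SucI)
  assume "Suc a < N" "lab v i = Suc a" "L \<le> a"
  moreover from this have "v \<noteq> s" "v \<noteq> t"
    using labelledD(1)[OF assms, of v i] labelledD(2,3)[OF assms, of i] by auto
  ultimately show "on_spine lab v i" using labelledD(5)[OF assms, of v i] by auto
qed

lemma colored_upd:
  assumes "l < b"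
  shows "colored lab (col(b := k')) l k Z \<longleftrightarrow> colored lab col l k Z"
  using assms unfolding colored_def by (auto split: prod.splits)

lemma traced_upd:
  assumes "traced lab par col a"
    and "tr par (xv (Suc a)) (xi (Suc a)) vs ts Z" "colored lab col' (Suc a) (col' (Suc a)) Z"
    and sp: "\<And>v i. lab v i = Suc a \<Longrightarrow> on_spine lab v i" and col: "col' = col(Suc a := k)"
  shows "traced lab par col' (Suc a)"
  unfolding traced_def
proof (intro allI impI)
  fix v i assume h: "0 < lab v i" "lab v i \<le> Suc a"
  show "\<exists>vs ts Z. tr par v i vs ts Z \<and> colored lab col' (lab v i) (col' (lab v i)) Z"
  proof (cases "lab v i = Suc a")
    case True
    then show ?thesis using sp[OF True] assms(2,3) unfolding on_spine_def by auto
  next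
    case False
    then have "lab v i \<le> a" using h by simp
    then show ?thesis using assms(1)[unfolded traced_def, rule_format, OF h(1)] colored_upd[of "lab v i" "Suc a" lab col k]
      unfolding col by auto
  qed
qed

text \<open>The walk on the spine keeps its colour and follows an intact pointer. When the spine
  changes its vertex it arrives there at the earliest time, so an earlier visit by the trace would
  have to be in the very same cell, whose label \<open>Suc a\<close> is too large.\<close>

lemma arrived_along_spine:
  assumes I: "inv lab par col a beta best bv bi" and m: "moved lab best (Suc a)"
    and a: "Suc a < N" "Suc a \<noteq> beta"
  shows "arrived lab par (col(Suc a := col a)) (Suc a) beta best bv bi"
proof -
  note c = I[unfolded inv_def core_def]
  then have lab: "labelled lab a" and La: "L \<le> a" and b: "a < beta" and tra: "traced lab par col a" by auto
  note D = labelledD[OF lab]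
  let ?col = "col(Suc a := col a)" and ?v = "xv (Suc a)" and ?i = "xi (Suc a)"
  have sp: "on_spine lab v i" if "lab v i = Suc a" for v i using labelled_Suc(2)[OF lab a(1) that La] .
  have par: "par ?v ?i = xv a" using c a unfolding linked_def by simp
  have l: "lab ?v ?i = Suc a" using D(4)[of "Suc a"] La a by simp
  have v: "?v \<noteq> s" using X1[of "Suc a"] La a by auto
  have "\<exists>vs ts Z. tr par ?v ?i vs ts Z \<and> colored lab ?col (Suc a) (col a) Z"
  proof (cases "a = L")
    case True
    have "tr par ?v ?i ([s] @ [?v]) ([] @ [?i]) (insert (?v, ?i) {})"
      by (rule tr.move[OF tr.start]) (use par True xL X3 v in auto)
    moreover have "colored lab ?col (Suc a) (col a) {(?v, ?i)}" using l by (simp add: colored_def)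
    ultimately show ?thesis by blast
  next
    case False
    then have La': "L < a" using La by simp
    have la: "lab (xv a) (xi a) = a" using D(4)[of a] La' a by simp
    obtain vs ts Z where Z: "tr par (xv a) (xi a) vs ts Z" "colored lab col a (col a) Z"
      using tracedD[OF tra, of "xv a" "xi a"] la La' by auto
    have Z': "colored lab ?col (Suc a) (col a) (insert (?v, ?i) Z)"
      using Z(2) l unfolding colored_def by (auto split: prod.splits)
    consider "?v = xv a" "?i = Suc (xi a)"
      | "(xv a, xi a, ?v) \<in> A" "?i = xi a" "?i = arr ?v"
      using X2[OF La' a(1)] by auto
    then show ?thesis
    proof cases
      case 1
      then show ?thesis using tr.wait[OF Z(1)] v par Z' by metis
    next
      case 2
      have "?v \<notin> set vs"
      proof
        assume "?v \<in> set vs"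
        then obtain j where jZ: "(?v, j) \<in> Z" using tr_Z[OF Z(1)] v by blast
        then have j: "(?v, j) \<in> Z" "j \<le> ?i" using tr_Z[OF Z(1)] 2(2) by auto
        then have lj: "0 < lab ?v j" "lab ?v j \<le> a" using Z(2) by (auto simp: colored_def)
        then have "arr ?v \<le> j" using D(5)[of ?v j] X1[of "Suc a"] La a by auto
        then show False using 2 j lj l by auto
      qed
      then show ?thesis using tr.move[OF Z(1), of ?v] 2 par Z' by metis
    qed
  qed
  then obtain vs ts Z where Z: "tr par ?v ?i vs ts Z" "colored lab ?col (Suc a) (?col (Suc a)) Z" by auto
  have "traced lab par ?col (Suc a)" by (rule traced_upd[OF tra Z sp refl])
  moreover have "linked par (Suc a) beta" using c unfolding linked_def by auto
  moreover have "event lab ?col (Suc a) best bv bi" if "event lab col a best bv bi"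
    using that unfolding event_def by auto
  moreover have "pending lab par ?col (Suc a) beta bv bi"
  proof -
    have "colored lab ?col (Suc a) (\<not> ?col (Suc a)) Z" if "colored lab col a (\<not> col a) Z" for Z
      using that unfolding colored_def by (auto split: prod.splits)
    then show ?thesis using c unfolding pending_def by blast
  qed
  ultimately show ?thesis using c m a b La labelled_Suc(1)[OF lab] sp unfolding arrived_def core_def by auto
qed

text \<open>The walks change roles. The pending one joins the spine at \<open>beta\<close> and gives
  its colour to the next segment, while the one on the spine leaves by the best detour and becomes
  pending. Redirecting the pointer at \<open>best\<close> is harmless, as no trace built so far
  contains a cell with this label.\<close>

lemma arrived_at_jump:
  assumes I: "inv lab par col a beta best bv bi" and m: "moved lab best (Suc a)"
    and a: "Suc a < N" "Suc a = beta" "beta < best"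
    and par': "par' = (\<lambda>v i. if v = xv best \<and> i = xi best then bv else par v i)"
  shows "arrived lab par' (col(beta := \<not> col a)) beta best best bv bi"
proof -
  note c = I[unfolded inv_def core_def]
  then have lab: "labelled lab a" and La: "L \<le> a" and tra: "traced lab par col a"
    and ev: "event lab col a best bv bi" and bN: "best \<le> N" and D0: "D \<noteq> {} \<longrightarrow> best = N" using a by auto
  note D = labelledD[OF lab]
  let ?col = "col(beta := \<not> col a)" and ?v = "xv beta" and ?i = "xi beta"
  have sp: "on_spine lab v i" if "lab v i = beta" for v i
    using labelled_Suc(2)[OF lab a(1) _ La] that a by simp
  have l: "lab ?v ?i = beta" using D(4)[of beta] La a by simp
  have keep: "par' v i = par v i" if "0 < lab v i" "lab v i < best" for v i
  proof (cases "best < N")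
    case True
    then have "lab (xv best) (xi best) = best" using D(4)[of best] La a by simp
    then show ?thesis using that unfolding par' by auto
  next
    case False
    then have "v \<noteq> xv best" using that D(1)[of v i] D(3)[of i] bN xN by auto
    then show ?thesis unfolding par' by simp
  qed
  have trk: "tr par' u i vs ts Z" if "tr par u i vs ts Z" "colored lab col m k Z" "m < best" for u i vs ts Z m k
    by (rule tr_cong[OF that(1)]) (use that keep in \<open>auto simp: colored_def\<close>)
  have tra': "traced lab par' col a"
    unfolding traced_def
  proof (intro allI impI)
    fix v i assume h: "0 < lab v i" "lab v i \<le> a"
    then have "lab v i < best" using a by simp
    then show "\<exists>vs ts Z. tr par' v i vs ts Z \<and> colored lab col (lab v i) (col (lab v i)) Z"
      using tracedD[OF tra h] trk by blast
  qed
  have "\<exists>vs ts Z. tr par' ?v ?i vs ts Z \<and> colored lab ?col beta (\<not> col a) Z"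
  proof -
    obtain u i vs ts Z where Z: "tr par u i vs ts Z" "colored lab col a (\<not> col a) Z"
      "?v \<notin> set vs" and p: "if beta < N then i = ?i \<and> u = par ?v i \<and> (u, i, ?v) \<in> A
         else u = bv \<and> i = bi \<and> (u, i, t) \<in> AF"
      using c unfolding pending_def by blast
    have "beta < N" using a by simp
    note p[unfolded if_P[OF this]]
    then have Z': "i = ?i" "u = par ?v i" "(u, i, ?v) \<in> A" by blast+
    have u: "par' ?v ?i = u" using keep[of ?v ?i] l a(2,3) La L Z'(1,2) by simp
    have "a < best" using a by simp
    then have "tr par' u ?i vs ts Z" using trk[OF Z(1,2)] Z'(1) by blast
    moreover have "(u, ?i, ?v) \<in> A" using Z'(1,3) by blast
    ultimately have "tr par' ?v ?i (vs @ [?v]) (ts @ [?i]) (insert (?v, ?i) Z)"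
      using tr.move u Z(3) by blast
    moreover have "colored lab ?col beta (\<not> col a) (insert (?v, ?i) Z)"
      using Z(2) l a unfolding colored_def by (auto split: prod.splits)
    ultimately show ?thesis by blast
  qed
  then obtain vs ts Z where Z: "tr par' ?v ?i vs ts Z" "colored lab ?col beta (?col beta) Z"
    unfolding fun_upd_same by blast
  have "traced lab par' ?col (Suc a)"
  proof (rule traced_upd[OF tra'])
    show "tr par' (xv (Suc a)) (xi (Suc a)) vs ts Z" "colored lab ?col (Suc a) (?col (Suc a)) Z"
      using Z unfolding a(2) .
    show "\<And>v i. lab v i = Suc a \<Longrightarrow> on_spine lab v i" using sp a(2) by simp
    show "?col = col(Suc a := \<not> col a)" using a(2) by simp
  qed
  then have "traced lab par' ?col beta" using a(2) by simp
  moreover have "linked par' beta best"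
    unfolding linked_def
  proof (intro allI impI)
    fix d assume d: "beta \<le> d" "Suc d < N" "Suc d \<noteq> best"
    have "lab (xv (Suc d)) (xi (Suc d)) = Suc d" using D(4)[of "Suc d"] d La a by simp
    have "\<not> (xv (Suc d) = xv best \<and> xi (Suc d) = xi best)"
    proof (cases "best < N")
      case True
      then show ?thesis using D(4)[of best] D(4)[of "Suc d"] d La a by auto
    next
      case False
      then show ?thesis using X1[of "Suc d"] d La a bN xN by auto
    qed
    then have "par' (xv (Suc d)) (xi (Suc d)) = par (xv (Suc d)) (xi (Suc d))" unfolding par' by auto
    then show "par' (xv (Suc d)) (xi (Suc d)) = xv d"
      using c d a unfolding linked_def by auto
  qed
  moreover have "pending lab par' ?col beta best bv bi"
  proof -
    let ?c = "lab bv bi"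
    have cc: "L \<le> ?c" "?c \<le> a" "col ?c = col a" using ev unfolding event_def by auto
    obtain vs ts Z where Z: "tr par bv bi vs ts Z" "colored lab col ?c (col a) Z"
      using tracedD[OF tra, of bv bi] cc L by auto
    have Z': "colored lab ?col beta (\<not> ?col beta) Z"
      using Z(2) cc a unfolding colored_def by fastforce
    \<comment> \<open>A visit up to time \<open>bi\<close> would happen on the spine, at a position
      not beyond the label of \<open>(bv, bi)\<close>. By contiguity the spine would still be at
      this vertex at the position given by that label, which \<open>event\<close> forbids.\<close>
    have v: "xv best \<notin> set vs"
    proof
      assume h: "xv best \<in> set vs"
      have s: "xv best \<noteq> s" using X1[of best] xN st La a bN by (cases "best < N") auto
      then obtain j where j: "(xv best, j) \<in> Z" "j \<le> bi" using tr_Z[OF Z(1)] h by blast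
      then have lj: "0 < lab (xv best) j" "lab (xv best) j \<le> ?c" using Z(2) by (auto simp: colored_def)
      show False
      proof (cases "best < N")
        case False
        then show ?thesis using D(1)[of t j] D(3)[of j] lj cc a bN xN by auto
      next
        case True
        then have e: "xi best = bi" "xv best \<noteq> xv ?c" using ev unfolding event_def by auto
        have "arr (xv best) \<le> j" using D(5)[of "xv best" j] lj s X1[of best] True La a by auto
        then have "on_spine lab (xv best) j"
          using spine_label[OF lab, of best "xv best" j] True La a j e by auto
        then have "xv ?c = xv best"
          using contiguous[of "lab (xv best) j" ?c best] lj cc a True unfolding on_spine_def by auto
        then show False using e by simp
      qed
    qed
    have fin: "if best < N then bi = xi best \<and> bv = par' (xv best) bi \<and> (bv, bi, xv best) \<in> A
         else bv = bv \<and> bi = bi \<and> (bv, bi, t) \<in> AF"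
      using ev unfolding event_def par' by auto
    have "tr par' bv bi vs ts Z" using trk[OF Z] cc a by simp
    then show ?thesis using Z' v fin unfolding pending_def by blast
  qed
  moreover have "waited lab beta" "moved lab best beta" using c m a by auto
  ultimately show ?thesis using La a bN D0 labelled_Suc(1)[OF lab] sp
    unfolding arrived_def core_def by auto
qed

text \<open>Both walks start at \<open>s\<close>, and the one declared pending is the first arc of
  the spine, so \<open>beta = Suc L\<close>. The value \<open>best = Suc L\<close> means that no
  detour is known, \<open>best = N\<close> that the direct arc at time \<open>bi\<close> is
  one.\<close>

lemma inv_init:
  assumes lab: "labelled lab L" and only: "\<And>v i. 0 < lab v i \<Longrightarrow> v = s \<or> v = t \<or> on_spine lab v i"
    and par: "\<And>c. L \<le> c \<Longrightarrow> Suc c < N \<Longrightarrow> par (xv (Suc c)) (xi (Suc c)) = xv c"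
    and best: "best = Suc L \<and> D = {} \<or> best = N \<and> bv = s \<and> bi \<in> D"
  shows "inv lab par col L (Suc L) best bv bi"
proof -
  note D = labelledD[OF lab]
  have low: "v = s" if "0 < lab v i" "lab v i \<le> L" for v i
    using only[OF that(1)] that D(1)[of t i] D(3)[of i] L by (auto simp: on_spine_def)
  have "waited lab (Suc L)"
    unfolding waited_def using low D(2) L by (auto simp: less_Suc_eq_le)
  moreover have "moved lab best L"
    unfolding moved_def using labelled_ge[OF lab] by (meson leD)
  moreover have "traced lab par col L"
    unfolding traced_def
  proof (intro allI impI)
    fix v i assume "0 < lab v i" "lab v i \<le> L"
    then have "v = s" by (rule low)
    then show "\<exists>vs ts Z. tr par v i vs ts Z \<and> colored lab col (lab v i) (col (lab v i)) Z"
      using tr.start[of par i] unfolding colored_def by blast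
  qed
  moreover have "event lab col L best bv bi" if "Suc L < best"
    using that best D(2)[of bi] AF_arc[of s bi t] L unfolding event_def AF_def by auto
  moreover have "pending lab par col L (Suc L) bv bi"
  proof -
    have "xv (Suc L) \<noteq> s" using X1[of "Suc L"] L by simp
    then have "tr par s (xi (Suc L)) [s] [] {} \<and> colored lab col L (\<not> col L) {} \<and> xv (Suc L) \<notin> set [s] \<and>
        (if Suc L < N then xi (Suc L) = xi (Suc L) \<and> s = par (xv (Suc L)) (xi (Suc L)) \<and> (s, xi (Suc L), xv (Suc L)) \<in> A
         else s = bv \<and> xi (Suc L) = bi \<and> (s, xi (Suc L), t) \<in> AF)"
      using X3 par[of L] L xL by (auto simp: tr.start colored_def)
    then show ?thesis unfolding pending_def by blast
  qed
  ultimately show ?thesis using lab par best L unfolding inv_def core_def linked_def by auto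
qed

text \<open>At the last position \<open>beta\<close> can only be \<open>N\<close>. The pending walk
  then ends at \<open>t\<close>, the other one follows the spine to its end, and their colours
  differ. \<open>Z'\<close> contains the last spine cell; its being nonempty is what later tells the
  two paths apart.\<close>

lemma inv_final:
  assumes I: "inv lab par col a beta best bv bi" and a: "Suc a = N"
  shows "\<exists>vs ts Z vs' ts' Z'. tr par bv bi vs ts Z \<and> (bv, bi, t) \<in> AF \<and> t \<notin> set vs \<and>
     tr par (xv a) (xi a) vs' ts' Z' \<and> (xv a, xi a, t) \<in> AF \<and> t \<notin> set vs' \<and> Z \<inter> Z' = {} \<and> Z' \<noteq> {}"
proof -
  note c = I[unfolded inv_def core_def]
  then have lab: "labelled lab a" and La: "L \<le> a" and tra: "traced lab par col a" and b: "beta = N" using a by auto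
  note D = labelledD[OF lab]
  have a': "L < a" "a < N" using a L by auto
  obtain vs ts Z where Z: "tr par bv bi vs ts Z" "colored lab col a (\<not> col a) Z"
      "t \<notin> set vs" "(bv, bi, t) \<in> AF"
  proof -
    have "pending lab par col a N bv bi" using c b by blast
    then show ?thesis using that unfolding pending_def xN by (simp only: less_irrefl if_False) blast
  qed
  have "0 < a" using a' by simp
  then obtain vs' ts' Z' where Z': "tr par (xv a) (xi a) vs' ts' Z'" "colored lab col a (col a) Z'"
    using tracedD[OF tra, of "xv a" "xi a", unfolded D(4)[OF a']] by blast
  have t': "t \<notin> set vs'"
  proof
    assume "t \<in> set vs'"
    then obtain j where "(t, j) \<in> Z'" using tr_visit[OF Z'(1) _ st[symmetric]] by metis
    then have "0 < lab t j" "lab t j \<le> a" using Z'(2) by (auto simp: colored_def)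
    then show False using D(1)[of t j] D(3)[of j] a by simp
  qed
  have disj: "Z \<inter> Z' = {}"
  proof (rule equals0I)
    fix x assume "x \<in> Z \<inter> Z'"
    then have "(fst x, snd x) \<in> Z" "(fst x, snd x) \<in> Z'" by auto
    then show False using Z(2) Z'(2) unfolding colored_def by fastforce
  qed
  have "(xv a, xi a) \<in> Z'" using tr_Z[OF Z'(1)] X1[OF a'] by blast
  then have "Z' \<noteq> {}" by blast
  have "N - 1 = a" using a by simp
  then have "(xv a, xi a, t) \<in> AF" using X4 unfolding AF_def by simp
  with \<open>Z' \<noteq> {}\<close> show ?thesis using Z Z'(1) t' disj by blast
qed

end

section \<open>Collecting the arcs and earliest arrival\<close>

abbreviation seq :: "com \<Rightarrow> com \<Rightarrow> com" (infixr ";;" 60) where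
  "c ;; d \<equiv> Seq c d"

abbreviation cell :: "name \<Rightarrow> aexp \<Rightarrow> aexp \<Rightarrow> aexp" where
  "cell X v i \<equiv> Read X (Add (Read ''off'' v) i)"

abbreviation Store_cell :: "name \<Rightarrow> aexp \<Rightarrow> aexp \<Rightarrow> aexp \<Rightarrow> com" where
  "Store_cell X v i a \<equiv> Store X (Add (Read ''off'' v) i) a"

text \<open>Multiplication is not a primitive of the machine, so the row starts are accumulated by
  addition. The final \<open>x\<close> also yields \<open>N\<close>.\<close>

definition offsets :: com where
  "offsets =
     Assign ''x'' (Const 0);; Assign ''v'' (Const 0);;
     While (Less (Var ''v'') (Var ''n''))
       (Store ''off'' (Var ''v'') (Var ''x'');;
        Assign ''x'' (Add (Var ''x'') (Add (Var ''tau'') (Const 1)));;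
        Assign ''v'' (Add (Var ''v'') (Const 1)))"

text \<open>Two different times of direct arcs already form a solution, and the sweep needs at most
  one, so \<open>d\<close> never has to exceed 2.\<close>

definition push :: com where
  "push =
     Cond (Conj (Equal (Var ''u'') (Var ''s'')) (Equal (Var ''v'') (Var ''t'')))
       (Cond (Equal (Var ''d'') (Const 0))
         (Assign ''d'' (Const 1);; Assign ''d1'' (Var ''i''))
         (Cond (Equal (Var ''i'') (Var ''d1'')) Skip
           (Assign ''d'' (Const 2);; Assign ''d2'' (Var ''i''))))
       (Store ''au'' (Var ''K'') (Var ''u'');; Store ''ai'' (Var ''K'') (Var ''i'');;
        Store ''av'' (Var ''K'') (Var ''v'');; Assign ''K'' (Add (Var ''K'') (Const 1)))"

text \<open>One loop for edges and labels together: an iteration either consumes a label or moves to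
  the next edge, so the iterations add up instead of multiplying.\<close>

definition build_body :: com where
  "build_body =
     Cond (Less (Var ''j'') (Read ''cnt'' (Var ''e'')))
       (Assign ''i'' (Read ''lab'' (Var ''p''));;
        Assign ''u'' (Read ''src'' (Var ''e''));; Assign ''v'' (Read ''dst'' (Var ''e''));;
        push;;
        Cond (Equal (Var ''dir'') (Const 0))
          (Assign ''u'' (Read ''dst'' (Var ''e''));; Assign ''v'' (Read ''src'' (Var ''e''));; push)
          Skip;;
        Assign ''p'' (Add (Var ''p'') (Const 1));; Assign ''j'' (Add (Var ''j'') (Const 1)))
       (Assign ''e'' (Add (Var ''e'') (Const 1));; Assign ''j'' (Const 0))"

definition build :: com where
  "build =
     Assign ''e'' (Const 0);; Assign ''j'' (Const 0);; Assign ''p'' (Const 0);;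
     Assign ''K'' (Const 0);; Assign ''d'' (Const 0);;
     While (Less (Var ''e'') (Var ''m'')) build_body"

lemma wp_offsets:
  assumes k: "30 + 30 * int (vars \<sigma> ''n'') \<le> k"
    and Q: "\<And>\<sigma>' k'. unchanged offsets \<sigma> \<sigma>' \<Longrightarrow>
      \<forall>v < vars \<sigma> ''n''. arrs \<sigma>' ''off'' v = v * Suc (vars \<sigma> ''tau'') \<Longrightarrow>
      vars \<sigma>' ''x'' = vars \<sigma> ''n'' * Suc (vars \<sigma> ''tau'') \<Longrightarrow>
      k - (30 + 30 * int (vars \<sigma> ''n'')) \<le> k' \<Longrightarrow> Q \<sigma>' k'"
  shows "wp offsets Q \<sigma> k"
proof (rule wp_frame)
  let ?I = "\<lambda>\<sigma>' k'. vars \<sigma>' ''v'' \<le> vars \<sigma> ''n'' \<and>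
    vars \<sigma>' ''x'' = vars \<sigma>' ''v'' * Suc (vars \<sigma> ''tau'') \<and>
    (\<forall>v < vars \<sigma>' ''v''. arrs \<sigma>' ''off'' v = v * Suc (vars \<sigma> ''tau'')) \<and>
    k - 10 - 20 * int (vars \<sigma>' ''v'') \<le> k'"
  let ?R = "\<lambda>\<sigma>' k'. (\<forall>v < vars \<sigma> ''n''. arrs \<sigma>' ''off'' v = v * Suc (vars \<sigma> ''tau'')) \<and>
      vars \<sigma>' ''x'' = vars \<sigma> ''n'' * Suc (vars \<sigma> ''tau'') \<and>
      k - (30 + 30 * int (vars \<sigma> ''n'')) \<le> k'"
  show "wp offsets ?R \<sigma> k"
    unfolding offsets_def wp_simps
    by (rule wp_loop[where I = ?I]) (use k in \<open>auto simp: wp_simps unchanged_def less_Suc_eq\<close>)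
qed (use Q in blast)

definition arcs :: "state \<Rightarrow> (nat \<times> nat \<times> nat) set" where
  "arcs \<sigma> = (\<lambda>k. (arrs \<sigma> ''au'' k, arrs \<sigma> ''ai'' k, arrs \<sigma> ''av'' k)) ` {..<vars \<sigma> ''K''}"

definition gathered ::
  "(nat \<times> nat \<times> nat) set \<Rightarrow> (nat \<times> nat \<times> nat) set \<Rightarrow> nat \<Rightarrow> nat \<Rightarrow> nat \<Rightarrow> nat \<Rightarrow> nat \<Rightarrow> bool" where
  "gathered S F s t d d1 d2 \<longleftrightarrow>
     S = {(u, i, v) \<in> F. \<not> (u = s \<and> v = t)} \<and>
     (let D = {i. (s, i, t) \<in> F} in
        d = 0 \<and> D = {} \<or> d = 1 \<and> D = {d1} \<or> d = 2 \<and> d1 \<in> D \<and> d2 \<in> D \<and> d1 \<noteq> d2)"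

definition collected :: "state \<Rightarrow> (nat \<times> nat \<times> nat) set \<Rightarrow> bool" where
  "collected \<sigma> F \<longleftrightarrow> gathered (arcs \<sigma>) F (vars \<sigma> ''s'') (vars \<sigma> ''t'') (vars \<sigma> ''d'') (vars \<sigma> ''d1'') (vars \<sigma> ''d2'')"

lemma gathered_insert:
  assumes "gathered S F s t d d1 d2"
  shows "\<not> (u = s \<and> v = t) \<Longrightarrow> gathered (insert (u, i, v) S) (insert (u, i, v) F) s t d d1 d2"
    and "d = 0 \<Longrightarrow> gathered S (insert (s, i, t) F) s t 1 i d2"
    and "d \<noteq> 0 \<Longrightarrow> gathered S (insert (s, d1, t) F) s t d d1 d2"
    and "d \<noteq> 0 \<Longrightarrow> i \<noteq> d1 \<Longrightarrow> gathered S (insert (s, i, t) F) s t 2 d1 i"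
  using assms unfolding gathered_def Let_def by auto

lemma wp_push:
  assumes c: "collected \<sigma> F" and "vars \<sigma> ''K'' \<le> l"
    and Q: "\<And>\<sigma>' k'. unchanged push \<sigma> \<sigma>' \<Longrightarrow>
      collected \<sigma>' (insert (vars \<sigma> ''u'', vars \<sigma> ''i'', vars \<sigma> ''v'') F) \<Longrightarrow> vars \<sigma>' ''K'' \<le> Suc l \<Longrightarrow>
      k - 30 \<le> k' \<Longrightarrow> Q \<sigma>' k'"
  shows "wp push Q \<sigma> k"
proof (rule wp_frame)
  let ?R = "\<lambda>\<sigma>' k'. collected \<sigma>' (insert (vars \<sigma> ''u'', vars \<sigma> ''i'', vars \<sigma> ''v'') F) \<and>
    vars \<sigma>' ''K'' \<le> Suc l \<and> k - 30 \<le> k'"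
  note g = gathered_insert[OF c[unfolded collected_def]]
  show "wp push ?R \<sigma> k"
  proof (cases "vars \<sigma> ''u'' = vars \<sigma> ''s'' \<and> vars \<sigma> ''v'' = vars \<sigma> ''t''")
    case True
    then show ?thesis using g(2)[of "vars \<sigma> ''i''"] g(3) g(4)[of "vars \<sigma> ''i''"] assms(2)
      unfolding push_def by (simp add: wp_simps arcs_def collected_def)
  next
    case False
    have "arcs \<lparr>vars = (vars \<sigma>)(''K'' := Suc (vars \<sigma> ''K'')),
      arrs = (arrs \<sigma>)
        (''au'' := (arrs \<sigma> ''au'')(vars \<sigma> ''K'' := vars \<sigma> ''u''),
         ''ai'' := (arrs \<sigma> ''ai'')(vars \<sigma> ''K'' := vars \<sigma> ''i''),
         ''av'' := (arrs \<sigma> ''av'')(vars \<sigma> ''K'' := vars \<sigma> ''v''))\<rparr>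
      = insert (vars \<sigma> ''u'', vars \<sigma> ''i'', vars \<sigma> ''v'') (arcs \<sigma>)"
      unfolding arcs_def by (simp add: lessThan_Suc)
    then show ?thesis using g(1)[OF False] assms(2) unfolding push_def
      by (simp add: wp_simps False collected_def)
  qed
qed (use Q in blast)

lemma unchanged_push:
  assumes "unchanged push \<sigma> \<sigma>'"
  shows "x \<notin> {''d'', ''d1'', ''d2'', ''K''} \<Longrightarrow> vars \<sigma>' x = vars \<sigma> x"
    and "X \<notin> {''au'', ''ai'', ''av''} \<Longrightarrow> arrs \<sigma>' X = arrs \<sigma> X"
  using assms unfolding unchanged_def push_def by auto

definition row :: "nat \<times> nat \<times> nat list \<Rightarrow> (nat \<times> nat \<times> nat) list" where
  "row r = (case r of (x, y, ls) \<Rightarrow> map (\<lambda>i. (x, i, y)) ls)"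

definition orient :: "nat \<Rightarrow> nat \<times> nat \<times> nat \<Rightarrow> (nat \<times> nat \<times> nat) set" where
  "orient dir a = (case a of (u, i, v) \<Rightarrow> {(u, i, v)} \<union> (if dir = 0 then {(v, i, u)} else {}))"

lemma flat_nth:
  assumes "e < length rows" "rows ! e = (x, y, ls)" "j < length ls"
    and p: "p = length (concat (map row (take e rows))) + j"
  shows "p < length (concat (map row rows))" "concat (map row rows) ! p = (x, ls ! j, y)"
proof -
  have "rows = take e rows @ (x, y, ls) # drop (Suc e) rows"
    using id_take_nth_drop[of e rows] assms by simp
  then have c: "concat (map row rows) =
      concat (map row (take e rows)) @ row (x, y, ls) @ concat (map row (drop (Suc e) rows))"
    by (metis append_Cons concat.simps(2) concat_append list.simps(9) map_append)
  show "p < length (concat (map row rows))" unfolding c using assms by (simp add: row_def)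
  show "concat (map row rows) ! p = (x, ls ! j, y)"
    unfolding c using assms by (simp add: nth_append row_def)
qed

lemma flat_step:
  assumes "e < length rows" "rows ! e = (x, y, ls)"
  shows "length (concat (map row (take (Suc e) rows))) = length (concat (map row (take e rows))) + length ls"
  using assms by (simp add: take_Suc_conv_app_nth row_def)

definition built :: "state \<Rightarrow> (nat \<times> nat \<times> nat list) list \<Rightarrow> bool" where
  "built \<sigma> rows \<longleftrightarrow> vars \<sigma> ''m'' = length rows \<and>
     (\<forall>e < length rows. case rows ! e of (x, y, ls) \<Rightarrow>
        arrs \<sigma> ''src'' e = x \<and> arrs \<sigma> ''dst'' e = y \<and> arrs \<sigma> ''cnt'' e = length ls) \<and>
     (\<forall>p < length (concat (map row rows)). arrs \<sigma> ''lab'' p = fst (snd (concat (map row rows) ! p)))"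

text \<open>An undirected edge contributes two arcs per label. This explains both
  \<open>2 * p\<close> and the price of a label, which has to cover two calls of
  \<open>push\<close>.\<close>

definition build_inv :: "nat \<Rightarrow> (nat \<times> nat \<times> nat list) list \<Rightarrow> int \<Rightarrow> state \<Rightarrow> int \<Rightarrow> bool" where
  "build_inv dir rows k \<sigma> k' \<longleftrightarrow> vars \<sigma> ''e'' \<le> length rows \<and>
    (vars \<sigma> ''e'' < length rows \<longrightarrow> vars \<sigma> ''j'' \<le> length (snd (snd (rows ! vars \<sigma> ''e'')))) \<and>
    (vars \<sigma> ''e'' = length rows \<longrightarrow> vars \<sigma> ''j'' = 0) \<and>
    vars \<sigma> ''p'' = length (concat (map row (take (vars \<sigma> ''e'') rows))) + vars \<sigma> ''j'' \<and>
    vars \<sigma> ''p'' \<le> length (concat (map row rows)) \<and>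
    collected \<sigma> (\<Union>a \<in> set (take (vars \<sigma> ''p'') (concat (map row rows))). orient dir a) \<and>
    vars \<sigma> ''K'' \<le> 2 * vars \<sigma> ''p'' \<and>
    k - 40 * int (vars \<sigma> ''e'') - 180 * int (vars \<sigma> ''p'') \<le> k'"

lemma collected_vars:
  assumes "collected \<sigma> F"
    and "vars \<sigma>' ''s'' = vars \<sigma> ''s'' \<and> vars \<sigma>' ''t'' = vars \<sigma> ''t'' \<and> vars \<sigma>' ''K'' = vars \<sigma> ''K'' \<and>
      vars \<sigma>' ''d'' = vars \<sigma> ''d'' \<and> vars \<sigma>' ''d1'' = vars \<sigma> ''d1'' \<and> vars \<sigma>' ''d2'' = vars \<sigma> ''d2''"
    and "arrs \<sigma>' ''au'' = arrs \<sigma> ''au'' \<and> arrs \<sigma>' ''ai'' = arrs \<sigma> ''ai'' \<and> arrs \<sigma>' ''av'' = arrs \<sigma> ''av''"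
  shows "collected \<sigma>' F"
  using assms unfolding collected_def arcs_def by simp

lemma wp_build_body:
  assumes b: "built \<sigma> rows" and dir: "vars \<sigma> ''dir'' = dir" and I: "build_inv dir rows k \<sigma> k'" and e: "vars \<sigma> ''e'' < length rows"
  shows "wp build_body (build_inv dir rows k) \<sigma> (k' - 4)"
proof -
  obtain x y ls where r: "rows ! vars \<sigma> ''e'' = (x, y, ls)" by (metis prod_cases3)
  have a: "arrs \<sigma> ''src'' (vars \<sigma> ''e'') = x" "arrs \<sigma> ''dst'' (vars \<sigma> ''e'') = y"
    "arrs \<sigma> ''cnt'' (vars \<sigma> ''e'') = length ls"
    using b e r unfolding built_def by fastforce+
  let ?flat = "concat (map row rows)"
  let ?p = "vars \<sigma> ''p''" and ?j = "vars \<sigma> ''j''"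
  have I': "vars \<sigma> ''j'' \<le> length ls" "?p = length (concat (map row (take (vars \<sigma> ''e'') rows))) + ?j"
    "?p \<le> length ?flat" "vars \<sigma> ''K'' \<le> 2 * ?p"
    "collected \<sigma> (\<Union>a \<in> set (take ?p ?flat). orient dir a)"
    "k - 40 * int (vars \<sigma> ''e'') - 180 * int ?p \<le> k'"
    using I e r unfolding build_inv_def by auto
  show ?thesis
  proof (cases "?j < length ls")
    case False
    then have j: "?j = length ls" using I' by simp
    have "build_inv dir rows k
        \<lparr>vars = (vars \<sigma>)(''e'' := Suc (vars \<sigma> ''e''), ''j'' := 0), arrs = arrs \<sigma>\<rparr> (k' - 20)"
    proof -
      have "collected \<lparr>vars = (vars \<sigma>)(''e'' := Suc (vars \<sigma> ''e''), ''j'' := 0), arrs = arrs \<sigma>\<rparr>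
         (\<Union>a \<in> set (take ?p ?flat). orient dir a)"
        by (rule collected_vars[OF I'(5)]) auto
      then show ?thesis using I' e flat_step[OF e r] j unfolding build_inv_def by simp
    qed
    then have w: "build_inv dir rows k
        \<lparr>vars = (vars \<sigma>)(''e'' := Suc (vars \<sigma> ''e''), ''j'' := 0), arrs = arrs \<sigma>\<rparr> l" if "k' - 20 \<le> l" for l
      using that unfolding build_inv_def by auto
    show ?thesis unfolding build_body_def by (simp add: wp_simps a False w)
  next
    case True
    note p = flat_nth[OF e r True I'(2)]
    have lab: "arrs \<sigma> ''lab'' ?p = ls ! ?j" using b p unfolding built_def by simp
    have t: "set (take (Suc ?p) ?flat) = insert (x, ls ! ?j, y) (set (take ?p ?flat))"
      using p by (simp add: take_Suc_conv_app_nth)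
    let ?F = "\<Union>a \<in> set (take ?p ?flat). orient dir a"
    let ?I = "build_inv dir rows k"
    have fin: "build_inv d rows k \<lparr>vars = (vars \<sigma>')(''p'' := Suc ?p, ''j'' := Suc ?j), arrs = arrs \<sigma>'\<rparr> l"
      if "collected \<sigma>' (\<Union>a \<in> set (take (Suc ?p) ?flat). orient dir a)"
        "vars \<sigma>' ''K'' \<le> 2 * Suc ?p" "vars \<sigma>' ''e'' = vars \<sigma> ''e''" "k' - 180 \<le> l" "d = dir" for \<sigma>' l d
    proof -
      have "collected \<lparr>vars = (vars \<sigma>')(''p'' := Suc ?p, ''j'' := Suc ?j), arrs = arrs \<sigma>'\<rparr>
         (\<Union>a \<in> set (take (Suc ?p) ?flat). orient dir a)"
        by (rule collected_vars[OF that(1)]) auto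
      then show ?thesis using that I' e r True p unfolding build_inv_def by simp
    qed
    show ?thesis
      unfolding build_body_def
      apply (simp add: wp_simps a True lab dir)
      apply (rule wp_push[where F = ?F and l = "2 * ?p"])
        apply (rule collected_vars[OF I'(5)]; simp)
       apply (use I' in simp)
      apply (simp add: wp_simps unchanged_push dir)
      apply (intro conjI impI)
       apply (rule wp_push[where F = "insert (x, ls ! ?j, y) ?F" and l = "Suc (2 * ?p)"])
         apply (rule collected_vars, assumption; simp)
        apply simp
       apply (simp add: wp_simps unchanged_push a)
       apply (rule fin)
          apply (simp add: t orient_def insert_commute)
         apply simp
        apply (simp add: unchanged_push)
        apply simp
       apply simp
      apply (rule fin)
          apply (simp add: t orient_def)
         apply simp
        apply (simp add: unchanged_push)
       apply simp
      apply simp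
      done
  qed
qed

lemma unchangedD:
  assumes "unchanged c \<sigma> \<sigma>'"
  shows "x \<notin> wvars c \<Longrightarrow> vars \<sigma>' x = vars \<sigma> x" and "X \<notin> warrs c \<Longrightarrow> arrs \<sigma>' X = arrs \<sigma> X"
  using assms unfolding unchanged_def by auto

lemma wp_build:
  assumes b: "built \<sigma> rows"
    and k: "60 + 60 * int (length rows) + 200 * int (length (concat (map row rows))) \<le> k"
    and Q: "\<And>\<sigma>' k'. unchanged build \<sigma> \<sigma>' \<Longrightarrow>
      collected \<sigma>' (\<Union>a \<in> set (concat (map row rows)). orient (vars \<sigma> ''dir'') a) \<Longrightarrow>
      vars \<sigma>' ''K'' \<le> 2 * length (concat (map row rows)) \<Longrightarrow>
      k - (60 + 60 * int (length rows) + 200 * int (length (concat (map row rows)))) \<le> k' \<Longrightarrow> Q \<sigma>' k'"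
  shows "wp build Q \<sigma> k"
proof (rule wp_frame)
  let ?flat = "concat (map row rows)" and ?dir = "vars \<sigma> ''dir''"
  let ?R = "\<lambda>\<sigma>' k'. collected \<sigma>' (\<Union>a \<in> set ?flat. orient ?dir a) \<and> vars \<sigma>' ''K'' \<le> 2 * length ?flat \<and>
      k - (60 + 60 * int (length rows) + 200 * int (length ?flat)) \<le> k'"
  let ?s = "\<lparr>vars = (vars \<sigma>)(''e'' := 0, ''j'' := 0, ''p'' := 0, ''K'' := 0, ''d'' := 0), arrs = arrs \<sigma>\<rparr>"
  have loop: "wp (While (Less (Var ''e'') (Var ''m'')) build_body) ?R ?s (k - 10)"
  proof (rule wp_loop[where I = "build_inv ?dir rows (k - 10)"])
    show "build_inv ?dir rows (k - 10) ?s (k - 10)"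
      by (simp add: build_inv_def collected_def gathered_def arcs_def)
  next
    fix \<sigma>' k'
    assume I: "build_inv ?dir rows (k - 10) \<sigma>' k'" and u: "unchanged build_body ?s \<sigma>'"
      and c: "bval (Less (Var ''e'') (Var ''m'')) \<sigma>'"
    have b': "built \<sigma>' rows" and d: "vars \<sigma>' ''dir'' = ?dir"
      using b unfolding built_def by (simp_all add: unchangedD[OF u] build_body_def push_def)
    then have "vars \<sigma>' ''e'' < length rows" using c unfolding built_def by simp
    from wp_build_body[OF b' d I this] show "0 \<le> k' \<and> wp build_body (build_inv ?dir rows (k - 10)) \<sigma>'
        (k' - int (1 + bcost (Less (Var ''e'') (Var ''m''))))"
      using I k unfolding build_inv_def by (simp add: diff_diff_eq)
  next
    fix \<sigma>' k'
    assume I: "build_inv ?dir rows (k - 10) \<sigma>' k'" and u: "unchanged build_body ?s \<sigma>'"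
      and c: "\<not> bval (Less (Var ''e'') (Var ''m'')) \<sigma>'"
    have b': "vars \<sigma>' ''m'' = length rows"
      using b unfolding built_def by (simp add: unchangedD[OF u] build_body_def push_def)
    then have p: "vars \<sigma>' ''p'' = length ?flat" "vars \<sigma>' ''e'' = length rows" using I c unfolding build_inv_def by auto
    then have "take (vars \<sigma>' ''p'') ?flat = ?flat" by simp
    then have "collected \<sigma>' (\<Union>a \<in> set ?flat. orient ?dir a)" using I unfolding build_inv_def by metis
    then show "?R \<sigma>' (k' - int (1 + bcost (Less (Var ''e'') (Var ''m''))))"
      using I k p unfolding build_inv_def by simp
  qed
  show "wp build ?R \<sigma> k"
    unfolding build_def using loop by (simp add: wp_simps)
qed (use Q in blast)

section \<open>Earliest arrival, time by time\<close>

definition search_step :: com where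
  "search_step =
     Cond (Conj (Equal (Read ''ai'' (Var ''k'')) (Var ''now''))
        (Conj (Less (Const 0) (Read ''arr'' (Read ''au'' (Var ''k''))))
          (Equal (Read ''arr'' (Read ''av'' (Var ''k''))) (Const 0))))
       (Store ''arr'' (Read ''av'' (Var ''k'')) (Var ''now'');;
        Store ''prv'' (Read ''av'' (Var ''k'')) (Read ''au'' (Var ''k''));;
        Assign ''ch'' (Const 1))
       Skip;;
     Assign ''k'' (Add (Var ''k'') (Const 1))"

text \<open>Paths are non-strict and may use several arcs at one time, so the arcs of time
  \<open>now\<close> are scanned again until nothing changes. A repetition presupposes a newly
  reached vertex; together with the advances of \<open>now\<close> this gives at most
  \<open>n + tau\<close> rounds.\<close>

definition search_round :: com where
  "search_round =
     Assign ''ch'' (Const 0);; Assign ''k'' (Const 0);;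
     While (Less (Var ''k'') (Var ''K'')) search_step;;
     Cond (Equal (Var ''ch'') (Const 0)) (Assign ''now'' (Add (Var ''now'') (Const 1))) Skip"

definition search :: com where
  "search =
     Store ''arr'' (Var ''s'') (Const 1);; Assign ''now'' (Const 1);;
     While (Less (Var ''now'') (Add (Var ''tau'') (Const 1))) search_round"

lemma arcsI: "k < vars \<sigma> ''K'' \<Longrightarrow> (arrs \<sigma> ''au'' k, arrs \<sigma> ''ai'' k, arrs \<sigma> ''av'' k) \<in> arcs \<sigma>"
  unfolding arcs_def by auto

context net
begin

definition env :: "state \<Rightarrow> bool" where
  "env \<sigma> \<longleftrightarrow> vars \<sigma> ''tau'' = T \<and> vars \<sigma> ''s'' = s \<and> vars \<sigma> ''t'' = t \<and>
     vars \<sigma> ''N'' = n * Suc T + 2 \<and> (\<forall>v < n. arrs \<sigma> ''off'' v = v * Suc T) \<and> arcs \<sigma> = A"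

lemma env_unchanged:
  assumes "env \<sigma>" "unchanged c \<sigma> \<sigma>'"
    and "''tau'' \<notin> wvars c \<and> ''s'' \<notin> wvars c \<and> ''t'' \<notin> wvars c \<and> ''N'' \<notin> wvars c \<and> ''K'' \<notin> wvars c"
    and "''off'' \<notin> warrs c \<and> ''au'' \<notin> warrs c \<and> ''ai'' \<notin> warrs c \<and> ''av'' \<notin> warrs c"
  shows "env \<sigma>'"
  using assms unfolding env_def arcs_def unchanged_def by simp

text \<open>The rank of a vertex will be the number of vertices reached before it. Predecessors thus
  have smaller ranks even when the times coincide, and all ranks stay below \<open>n\<close>, which
  bounds the length of the spine.\<close>

definition earliest :: "(nat \<Rightarrow> nat) \<Rightarrow> (nat \<Rightarrow> nat) \<Rightarrow> (nat \<Rightarrow> nat) \<Rightarrow> nat \<Rightarrow> bool" where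
  "earliest arr prv rk now \<longleftrightarrow> arr s = 1 \<and> 1 \<le> now \<and>
     (\<forall>u i v. (u, i, v) \<in> A \<longrightarrow> i < now \<longrightarrow> 0 < arr u \<longrightarrow> arr u \<le> i \<longrightarrow> 0 < arr v \<and> arr v \<le> i) \<and>
     (\<forall>v. v \<noteq> s \<longrightarrow> 0 < arr v \<longrightarrow> arr v \<le> now \<and> (prv v, arr v, v) \<in> A \<and> 0 < arr (prv v) \<and>
        arr (prv v) \<le> arr v \<and> rk (prv v) < rk v) \<and>
     inj_on rk {v. 0 < arr v} \<and> (\<forall>v. 0 < arr v \<longrightarrow> v < n \<and> rk v < card {v. 0 < arr v})"

lemma earliest_init: "earliest ((\<lambda>_. 0)(s := 1)) prv (\<lambda>_. 0) 1"
proof -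
  have "{v. 0 < ((\<lambda>_. 0)(s := 1 :: nat)) v} = {s}" by auto
  then show ?thesis using s arc unfolding earliest_def by force
qed

lemma earliestD:
  assumes "earliest arr prv rk now"
  shows "arr s = 1" "1 \<le> now"
    "(u, i, v) \<in> A \<Longrightarrow> i < now \<Longrightarrow> 0 < arr u \<Longrightarrow> arr u \<le> i \<Longrightarrow> 0 < arr v \<and> arr v \<le> i"
    "v \<noteq> s \<Longrightarrow> 0 < arr v \<Longrightarrow> arr v \<le> now \<and> (prv v, arr v, v) \<in> A \<and> 0 < arr (prv v) \<and>
        arr (prv v) \<le> arr v \<and> rk (prv v) < rk v"
    "inj_on rk {v. 0 < arr v}" "0 < arr v \<Longrightarrow> v < n \<and> rk v < card {v. 0 < arr v}"
  using assms unfolding earliest_def by blast+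

lemma earliest_le: "earliest arr prv rk now \<Longrightarrow> 0 < arr v \<Longrightarrow> arr v \<le> now"
  using earliestD(1,2) earliestD(4) by metis

lemma earliest_finite: "earliest arr prv rk now \<Longrightarrow> finite {v. 0 < arr v} \<and> card {v. 0 < arr v} \<le> n"
  using earliestD(6) card_mono[of "{..<n}" "{v. 0 < arr v}"] finite_subset[of "{v. 0 < arr v}" "{..<n}"]
  by fastforce

text \<open>The new rank exceeds all ranks in use. The closure condition is not affected: it
  concerns times below \<open>now\<close>, at which \<open>v\<close> does not yet count as
  reached.\<close>

lemma earliest_set:
  assumes e: "earliest arr prv rk now" and a: "(u, now, v) \<in> A" "0 < arr u" "arr v = 0"
  shows "earliest (arr(v := now)) (prv(v := u)) (rk(v := card {v. 0 < arr v})) now"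
proof -
  note E = earliestD[OF e]
  let ?arr = "arr(v := now)" and ?prv = "prv(v := u)" and ?rk = "rk(v := card {v. 0 < arr v})"
  have sv: "v \<noteq> s" "u \<noteq> v" using E(1) a by auto
  have set: "{w. 0 < ?arr w} = insert v {w. 0 < arr w}" using E(2) by auto
  have card: "card {w. 0 < ?arr w} = Suc (card {w. 0 < arr w})"
    unfolding set using a earliest_finite[OF e] by simp
  have vS: "v \<notin> {w. 0 < arr w}" using a by simp
  have "inj_on ?rk {w. 0 < arr w}" using E(5) vS by (subst inj_on_cong[of _ _ rk]) auto
  moreover have "?rk v \<noteq> ?rk w" if "0 < arr w" for w
    using E(6)[OF that] vS that by auto
  then have "?rk v \<notin> ?rk ` {w. 0 < arr w}" by blast
  moreover have "{w. 0 < arr w} - {v} = {w. 0 < arr w}" using vS by blast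
  ultimately have inj: "inj_on ?rk {w. 0 < ?arr w}" unfolding set inj_on_insert by simp
  have 3: "0 < ?arr x \<and> ?arr x \<le> i" if "(w, i, x) \<in> A" "i < now" "0 < ?arr w" "?arr w \<le> i" for w i x
  proof -
    have "w \<noteq> v" using that by auto
    then have "0 < arr x \<and> arr x \<le> i" using E(3)[OF that(1,2)] that by simp
    then show ?thesis using a by auto
  qed
  have 4: "?arr w \<le> now \<and> (?prv w, ?arr w, w) \<in> A \<and> 0 < ?arr (?prv w) \<and>
        ?arr (?prv w) \<le> ?arr w \<and> ?rk (?prv w) < ?rk w" if w: "w \<noteq> s" "0 < ?arr w" for w
  proof (cases "w = v")
    case True
    then show ?thesis using a sv earliest_le[OF e a(2)] E(2) E(6)[OF a(2)] by simp
  next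
    case False
    then have "0 < arr w" using w by simp
    then have "prv w \<noteq> v" using E(4)[OF w(1)] a by auto
    then show ?thesis using E(4)[OF w(1) \<open>0 < arr w\<close>] False by simp
  qed
  have 6: "w < n \<and> ?rk w < card {w. 0 < ?arr w}" if "0 < ?arr w" for w
    unfolding card using E(6)[of w] arc[OF a(1)] that by (auto simp: less_SucI)
  have "?arr s = 1" using E(1) sv by simp
  then show ?thesis unfolding earliest_def using E(2) 3 4 6 inj by blast
qed

lemma earliest_next:
  assumes e: "earliest arr prv rk now" and c: "\<And>u v. (u, now, v) \<in> A \<Longrightarrow> 0 < arr u \<Longrightarrow> 0 < arr v"
  shows "earliest arr prv rk (Suc now)"
proof -
  note E = earliestD[OF e]
  have "0 < arr v \<and> arr v \<le> i" if "(u, i, v) \<in> A" "i < Suc now" "0 < arr u" "arr u \<le> i" for u i v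
  proof (cases "i = now")
    case True
    then have "0 < arr v" using c that by blast
    then show ?thesis using earliest_le[OF e] True by blast
  next
    case False
    then show ?thesis using E(3)[of u i v] that by auto
  qed
  moreover have "arr v \<le> Suc now" if "0 < arr v" for v using earliest_le[OF e that] by simp
  ultimately show ?thesis unfolding earliest_def using E(1,2,4-6) by auto
qed

definition unset :: "(nat \<Rightarrow> nat) \<Rightarrow> nat" where
  "unset arr = card {v. v < n \<and> arr v = 0}"

lemma unset_set:
  assumes "v < n" "arr v = 0" "0 < i"
  shows "unset arr = Suc (unset (arr(v := i)))"
proof -
  have "{v. v < n \<and> arr v = 0} = insert v {w. w < n \<and> (arr(v := i)) w = 0}" using assms by auto
  then show ?thesis unfolding unset_def using assms by (simp add: card_insert_disjoint)
qed

lemma unset_le: "unset arr \<le> n"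
  unfolding unset_def using card_mono[of "{..<n}" "{v. v < n \<and> arr v = 0}"] by auto

text \<open>\<open>W\<close> is the price of a round. Every unreached vertex holds a credit of
  \<open>W\<close>, which is released when it is reached and then pays for the repetition that
  \<open>ch\<close> announces.\<close>

definition scan_inv :: "int \<Rightarrow> int \<Rightarrow> state \<Rightarrow> int \<Rightarrow> bool" where
  "scan_inv B W \<sigma> k \<longleftrightarrow> vars \<sigma> ''k'' \<le> vars \<sigma> ''K'' \<and>
     (\<exists>rk. earliest (arrs \<sigma> ''arr'') (arrs \<sigma> ''prv'') rk (vars \<sigma> ''now'')) \<and>
     (vars \<sigma> ''ch'' = 0 \<longrightarrow> (\<forall>j < vars \<sigma> ''k''. arrs \<sigma> ''ai'' j = vars \<sigma> ''now'' \<longrightarrow>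
        0 < arrs \<sigma> ''arr'' (arrs \<sigma> ''au'' j) \<longrightarrow> 0 < arrs \<sigma> ''arr'' (arrs \<sigma> ''av'' j))) \<and>
     B + 40 * (int (vars \<sigma> ''K'') - int (vars \<sigma> ''k'')) + int (unset (arrs \<sigma> ''arr'')) * W +
       (if vars \<sigma> ''ch'' = 0 then 0 else W) \<le> k"

lemma wp_search_step:
  assumes e: "env \<sigma>" and I: "scan_inv B W \<sigma> k" and k: "vars \<sigma> ''k'' < vars \<sigma> ''K''" and W: "0 \<le> W"
  shows "wp search_step (scan_inv B W) \<sigma> (k - 4)"
proof -
  let ?k = "vars \<sigma> ''k''" and ?arr = "arrs \<sigma> ''arr''" and ?now = "vars \<sigma> ''now''"
  let ?u = "arrs \<sigma> ''au'' ?k" and ?v = "arrs \<sigma> ''av'' ?k" and ?i = "arrs \<sigma> ''ai'' ?k"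
  obtain rk where rk: "earliest ?arr (arrs \<sigma> ''prv'') rk ?now" using I unfolding scan_inv_def by blast
  have a: "(?u, ?i, ?v) \<in> A" using arcsI[OF k] e unfolding env_def by simp
  have now: "0 < ?now" using earliestD(2)[OF rk] by simp
  show ?thesis
  proof (cases "?i = ?now \<and> 0 < ?arr ?u \<and> ?arr ?v = 0")
    case True
    have "\<exists>rk. earliest (?arr(?v := ?now)) ((arrs \<sigma> ''prv'')(?v := ?u)) rk ?now"
      using earliest_set[OF rk] a True by metis
    moreover have "unset ?arr = Suc (unset (?arr(?v := ?now)))"
      using unset_set[of ?v ?arr ?now] arc[OF a] True now by simp
    ultimately show ?thesis using I k True W unfolding search_step_def scan_inv_def
      by (simp add: wp_simps algebra_simps split: if_splits)
  next
    case False
    then show ?thesis using I k unfolding search_step_def scan_inv_def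
      by (auto simp: wp_simps less_Suc_eq)
  qed
qed

lemma wp_search_round:
  assumes e: "env \<sigma>" and r: "earliest (arrs \<sigma> ''arr'') (arrs \<sigma> ''prv'') rk (vars \<sigma> ''now'')"
    and W: "W = 40 * int (vars \<sigma> ''K'') + 60" and B: "0 \<le> B"
    and k: "B + W + int (unset (arrs \<sigma> ''arr'')) * W \<le> k"
  shows "wp search_round (\<lambda>\<sigma>' k'. \<exists>rk. earliest (arrs \<sigma>' ''arr'') (arrs \<sigma>' ''prv'') rk (vars \<sigma>' ''now'') \<and>
      (vars \<sigma>' ''now'' = vars \<sigma> ''now'' \<and> B + W + int (unset (arrs \<sigma>' ''arr'')) * W + 30 \<le> k' \<or>
       vars \<sigma>' ''now'' = Suc (vars \<sigma> ''now'') \<and> B + int (unset (arrs \<sigma>' ''arr'')) * W + 30 \<le> k')) \<sigma> (k - 6)"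
    (is "wp _ ?R _ _")
proof -
  let ?s = "\<lparr>vars = (vars \<sigma>)(''ch'' := 0, ''k'' := 0), arrs = arrs \<sigma>\<rparr>"
  let ?fin = "Cond (Equal (Var ''ch'') (Const 0)) (Assign ''now'' (Add (Var ''now'') (Const 1))) Skip"
  have es: "env ?s" using e unfolding env_def arcs_def by simp
  have "wp (While (Less (Var ''k'') (Var ''K'')) search_step) (wp ?fin ?R) ?s (k - 10)"
  proof (rule wp_loop[where I = "\<lambda>\<sigma>' k'. scan_inv (B + 50) W \<sigma>' k'"])
    show "scan_inv (B + 50) W ?s (k - 10)"
      using r k W unfolding scan_inv_def by auto
  next
    fix \<sigma>' k'
    assume I: "scan_inv (B + 50) W \<sigma>' k'" and u: "unchanged search_step ?s \<sigma>'"
      and c: "bval (Less (Var ''k'') (Var ''K'')) \<sigma>'"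
    have e': "env \<sigma>'" by (rule env_unchanged[OF es u]) (simp_all add: search_step_def)
    have W0: "0 \<le> W" using W by simp
    have "B + 50 + 40 * (int (vars \<sigma>' ''K'') - int (vars \<sigma>' ''k'')) + int (unset (arrs \<sigma>' ''arr'')) * W +
       (if vars \<sigma>' ''ch'' = 0 then 0 else W) \<le> k'"
      using I unfolding scan_inv_def by blast
    moreover have "0 \<le> int (unset (arrs \<sigma>' ''arr'')) * W" "0 \<le> (if vars \<sigma>' ''ch'' = 0 then 0 else W)"
      using W0 by simp_all
    moreover have "vars \<sigma>' ''k'' \<le> vars \<sigma>' ''K''" using I unfolding scan_inv_def by blast
    moreover have "0 \<le> l" if "B + 50 + 40 * (int a - int b) + p + q \<le> l" "0 \<le> p" "0 \<le> q" "b \<le> a"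
      for p q l :: int and a b :: nat
    proof -
      have "0 \<le> 40 * (int a - int b)" using that by simp
      then show ?thesis using that B by linarith
    qed
    ultimately have "0 \<le> k'" by blast
    then show "0 \<le> k' \<and> wp search_step (scan_inv (B + 50) W) \<sigma>' (k' - int (1 + bcost (Less (Var ''k'') (Var ''K''))))"
      using wp_search_step[OF e' I] c W by simp
  next
    fix \<sigma>' k'
    assume I: "scan_inv (B + 50) W \<sigma>' k'" and u: "unchanged search_step ?s \<sigma>'"
      and c: "\<not> bval (Less (Var ''k'') (Var ''K'')) \<sigma>'"
    have e': "env \<sigma>'" by (rule env_unchanged[OF es u]) (simp_all add: search_step_def)
    have now: "vars \<sigma>' ''now'' = vars \<sigma> ''now''" using unchangedD(1)[OF u, of "''now''"] by (simp add: search_step_def)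
    have K: "vars \<sigma>' ''k'' = vars \<sigma>' ''K''" using I c unfolding scan_inv_def by auto
    obtain rk where rk: "earliest (arrs \<sigma>' ''arr'') (arrs \<sigma>' ''prv'') rk (vars \<sigma>' ''now'')"
      using I unfolding scan_inv_def by blast
    have nx: "earliest (arrs \<sigma>' ''arr'') (arrs \<sigma>' ''prv'') rk (Suc (vars \<sigma>' ''now''))" if "vars \<sigma>' ''ch'' = 0"
    proof (rule earliest_next[OF rk])
      fix u v assume "(u, vars \<sigma>' ''now'', v) \<in> A" "0 < arrs \<sigma>' ''arr'' u"
      then obtain j where "j < vars \<sigma>' ''k''" "u = arrs \<sigma>' ''au'' j" "vars \<sigma>' ''now'' = arrs \<sigma>' ''ai'' j" "v = arrs \<sigma>' ''av'' j"
        using e' K unfolding env_def arcs_def by auto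
      then show "0 < arrs \<sigma>' ''arr'' v" using I that \<open>0 < arrs \<sigma>' ''arr'' u\<close> unfolding scan_inv_def by metis
    qed
    show "wp ?fin ?R \<sigma>' (k' - int (1 + bcost (Less (Var ''k'') (Var ''K''))))"
    proof (cases "vars \<sigma>' ''ch'' = 0")
      case True
      then show ?thesis using nx now I K unfolding scan_inv_def by (auto simp: wp_simps)
    next
      case False
      then show ?thesis using rk now I K unfolding scan_inv_def by (auto simp: wp_simps)
    qed
  qed
  then show ?thesis unfolding search_round_def by (simp add: wp_simps)
qed

lemma wp_search:
  assumes e: "env \<sigma>" and a0: "arrs \<sigma> ''arr'' = (\<lambda>_. 0)"
    and W: "W = 40 * int (vars \<sigma> ''K'') + 60" and k: "100 + (int n + int T) * W \<le> k"
    and Q: "\<And>\<sigma>' k' rk. unchanged search \<sigma> \<sigma>' \<Longrightarrow>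
      earliest (arrs \<sigma>' ''arr'') (arrs \<sigma>' ''prv'') rk (Suc T) \<Longrightarrow> k - 100 - (int n + int T) * W \<le> k' \<Longrightarrow> Q \<sigma>' k'"
  shows "wp search Q \<sigma> k"
proof (rule wp_frame)
  let ?R = "\<lambda>\<sigma>' k'. \<exists>rk. earliest (arrs \<sigma>' ''arr'') (arrs \<sigma>' ''prv'') rk (Suc T) \<and> k - 100 - (int n + int T) * W \<le> k'"
  let ?s = "\<lparr>vars = (vars \<sigma>)(''now'' := 1), arrs = (arrs \<sigma>)(''arr'' := (arrs \<sigma> ''arr'')(s := 1))\<rparr>"
  have es: "env ?s" using e unfolding env_def arcs_def by simp
  have W0: "0 \<le> W" using W by simp
  define B where "B = k - 60 - (int n + int T) * W"
  let ?I = "\<lambda>\<sigma>' k'. (\<exists>rk. earliest (arrs \<sigma>' ''arr'') (arrs \<sigma>' ''prv'') rk (vars \<sigma>' ''now'')) \<and>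
     vars \<sigma>' ''now'' \<le> Suc T \<and>
     B + int (unset (arrs \<sigma>' ''arr'')) * W + (int (Suc T) - int (vars \<sigma>' ''now'')) * W \<le> k'"
  have "wp (While (Less (Var ''now'') (Add (Var ''tau'') (Const 1))) search_round) ?R ?s (k - 5)"
  proof (rule wp_loop[where I = ?I])
    have "int (unset ((arrs \<sigma> ''arr'')(s := 1))) * W \<le> int n * W"
      using unset_le W0 by (intro mult_right_mono) auto
    then show "?I ?s (k - 5)"
      using earliest_init[of "arrs \<sigma> ''prv''"] a0 t unfolding B_def by (auto simp: algebra_simps)
  next
    fix \<sigma>' k'
    assume I: "?I \<sigma>' k'" and u: "unchanged search_round ?s \<sigma>'"
      and c: "bval (Less (Var ''now'') (Add (Var ''tau'') (Const 1))) \<sigma>'"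
    have e': "env \<sigma>'" by (rule env_unchanged[OF es u]) (simp_all add: search_round_def search_step_def)
    then have now: "vars \<sigma>' ''now'' \<le> T" using c unfolding env_def by simp
    have K: "vars \<sigma>' ''K'' = vars \<sigma> ''K''"
      using unchangedD(1)[OF u, of "''K''"] by (simp add: search_round_def search_step_def)
    obtain rk where rk: "earliest (arrs \<sigma>' ''arr'') (arrs \<sigma>' ''prv'') rk (vars \<sigma>' ''now'')" using I by blast
    define r where "r = (int T - int (vars \<sigma>' ''now'')) * W"
    have r0: "0 \<le> r" "0 \<le> B" using now W0 k unfolding r_def B_def by auto
    have r: "(int (Suc T) - int (vars \<sigma>' ''now'')) * W = r + W" unfolding r_def by (simp add: algebra_simps)
    then have kk: "(B + r) + W + int (unset (arrs \<sigma>' ''arr'')) * W \<le> k'" using I by simp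
    have "wp search_round ?I \<sigma>' (k' - 6)"
    proof (rule wp_mono[OF wp_search_round[OF e' rk _ _ kk]])
      fix \<sigma>'' k''
      assume "\<exists>rk. earliest (arrs \<sigma>'' ''arr'') (arrs \<sigma>'' ''prv'') rk (vars \<sigma>'' ''now'') \<and>
        (vars \<sigma>'' ''now'' = vars \<sigma>' ''now'' \<and> (B + r) + W + int (unset (arrs \<sigma>'' ''arr'')) * W + 30 \<le> k'' \<or>
         vars \<sigma>'' ''now'' = Suc (vars \<sigma>' ''now'') \<and> (B + r) + int (unset (arrs \<sigma>'' ''arr'')) * W + 30 \<le> k'')"
      then show "?I \<sigma>'' k''" using now r unfolding r_def by auto
    qed (use W K r0 in auto)
    moreover have "0 \<le> int (unset (arrs \<sigma>' ''arr'')) * W" using W0 by simp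
    then have "0 \<le> k'" using kk r0 W0 by linarith
    ultimately show "0 \<le> k' \<and> wp search_round ?I \<sigma>' (k' - int (1 + bcost (Less (Var ''now'') (Add (Var ''tau'') (Const 1)))))"
      by simp
  next
    fix \<sigma>' k'
    assume I: "?I \<sigma>' k'" and u: "unchanged search_round ?s \<sigma>'"
      and c: "\<not> bval (Less (Var ''now'') (Add (Var ''tau'') (Const 1))) \<sigma>'"
    have e': "env \<sigma>'" by (rule env_unchanged[OF es u]) (simp_all add: search_round_def search_step_def)
    then have now: "vars \<sigma>' ''now'' = Suc T" using c I unfolding env_def by simp
    have "0 \<le> int (unset (arrs \<sigma>' ''arr'')) * W" using W0 by simp
    moreover have "B + int (unset (arrs \<sigma>' ''arr'')) * W \<le> k'" using I now by simp
    ultimately have "B \<le> k'" by linarith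
    then show "?R \<sigma>' (k' - int (1 + bcost (Less (Var ''now'') (Add (Var ''tau'') (Const 1)))))"
      using I now unfolding B_def by simp
  qed
  then show "wp search ?R \<sigma> k"
    using e unfolding search_def env_def by (simp add: wp_simps)
qed (use Q in blast)

end

section \<open>The spine\<close>

text \<open>Cutting off at \<open>T\<close> keeps a row from running into the next one of the flat
  array. The value 0 there reads as unlabelled.\<close>

definition grid :: "nat \<Rightarrow> (nat \<Rightarrow> nat) \<Rightarrow> nat \<Rightarrow> nat \<Rightarrow> nat" where
  "grid T X v i = (if i \<le> T then X (v * Suc T + i) else 0)"

lemma cell_eq:
  assumes "i \<le> T" "j \<le> T" "v * Suc T + i = w * Suc T + j"
  shows "v = w \<and> i = j"
proof -
  have "(v * Suc T + i) div Suc T = v" "(w * Suc T + j) div Suc T = w"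
    using assms(1,2) by (simp_all only: div_mult_self3 div_less less_Suc_eq_le add_0_right)
  then have "v = w" using assms(3) by metis
  then show ?thesis using assms(3) by simp
qed

lemma grid_upd:
  assumes "i \<le> T"
  shows "grid T (X(v * Suc T + i := x)) = (\<lambda>w j. if w = v \<and> j = i then x else grid T X w j)"
proof (intro ext)
  fix w j
  show "grid T (X(v * Suc T + i := x)) w j = (if w = v \<and> j = i then x else grid T X w j)"
    using cell_eq[of j T i w v] assms unfolding grid_def by auto
qed

definition fill :: "name \<Rightarrow> name \<Rightarrow> com" where
  "fill y z =
     Assign ''i'' (Const 0);;
     While (Less (Var ''i'') (Add (Var ''tau'') (Const 1)))
       (Store_cell ''mk'' (Var y) (Var ''i'') (Var z);; Assign ''i'' (Add (Var ''i'') (Const 1)))"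

lemma wp_Seq_fun: "wp (Seq c d) Q = wp c (wp d Q)"
  by (intro ext) (simp add: wp_Seq)

section \<open>Building the spine from \<open>t\<close> backwards\<close>

definition spine_step :: com where
  "spine_step =
     Assign ''c'' (Sub (Var ''c'') (Const 1));;
     Store ''xv'' (Var ''c'') (Var ''v'');; Store ''xi'' (Var ''c'') (Var ''i'');;
     Store_cell ''mk'' (Var ''v'') (Var ''i'') (Var ''c'');;
     Cond (Less (Read ''arr'' (Var ''v'')) (Var ''i''))
       (Store_cell ''par'' (Var ''v'') (Var ''i'') (Var ''v'');; Assign ''i'' (Sub (Var ''i'') (Const 1)))
       (Store_cell ''par'' (Var ''v'') (Var ''i'') (Read ''prv'' (Var ''v''));;
        Assign ''v'' (Read ''prv'' (Var ''v'')))"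

text \<open>Predecessors are known, successors are not. Positions are therefore handed out downwards
  from \<open>N\<close>, and \<open>L\<close> is known only at the end. Setting \<open>xi\<close> at
  \<open>N\<close> to 0 makes \<open>(t, 0)\<close> a harmless address for the pointer that is
  written when \<open>best = N\<close>.\<close>

definition spine_com :: com where
  "spine_com =
     fill ''t'' ''N'';; Assign ''c'' (Var ''N'');;
     Assign ''v'' (Read ''prv'' (Var ''t''));; Assign ''i'' (Read ''arr'' (Var ''t''));;
     Store ''xv'' (Var ''N'') (Var ''t'');; Store ''xi'' (Var ''N'') (Const 0);;
     While (Neg (Equal (Var ''v'') (Var ''s''))) spine_step;;
     Assign ''c'' (Sub (Var ''c'') (Const 1));; Store ''xv'' (Var ''c'') (Var ''s'');;
     fill ''s'' ''c''"

context net
begin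

lemma wp_fill:
  assumes e: "env \<sigma>" and y: "y \<noteq> ''i''" "z \<noteq> ''i''" "vars \<sigma> y = v" "v < n"
    and k: "50 + 30 * int T \<le> k"
    and Q: "\<And>\<sigma>' k'. unchanged (fill y z) \<sigma> \<sigma>' \<Longrightarrow>
      grid T (arrs \<sigma>' ''mk'') = (\<lambda>w j. if w = v \<and> j \<le> T then vars \<sigma> z else grid T (arrs \<sigma> ''mk'') w j) \<Longrightarrow>
      k - (50 + 30 * int T) \<le> k' \<Longrightarrow> Q \<sigma>' k'"
  shows "wp (fill y z) Q \<sigma> k"
proof (rule wp_frame)
  let ?R = "\<lambda>\<sigma>' k'. grid T (arrs \<sigma>' ''mk'') = (\<lambda>w j. if w = v \<and> j \<le> T then vars \<sigma> z else grid T (arrs \<sigma> ''mk'') w j) \<and>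
      k - (50 + 30 * int T) \<le> k'"
  let ?s = "\<lparr>vars = (vars \<sigma>)(''i'' := 0), arrs = arrs \<sigma>\<rparr>"
  let ?c = "Store_cell ''mk'' (Var y) (Var ''i'') (Var z);; Assign ''i'' (Add (Var ''i'') (Const 1))"
  let ?I = "\<lambda>\<sigma>' k'. vars \<sigma>' ''i'' \<le> Suc T \<and>
     grid T (arrs \<sigma>' ''mk'') = (\<lambda>w j. if w = v \<and> j < vars \<sigma>' ''i'' then vars \<sigma> z else grid T (arrs \<sigma> ''mk'') w j) \<and>
     k - 2 - 25 * int (vars \<sigma>' ''i'') \<le> k'"
  have es: "env ?s" using e unfolding env_def arcs_def by simp
  have "wp (While (Less (Var ''i'') (Add (Var ''tau'') (Const 1))) ?c) ?R ?s (k - 2)"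
  proof (rule wp_loop[where I = ?I])
    fix \<sigma>' k'
    assume I: "?I \<sigma>' k'" and u: "unchanged ?c ?s \<sigma>'"
      and c: "bval (Less (Var ''i'') (Add (Var ''tau'') (Const 1))) \<sigma>'"
    have e': "env \<sigma>'" by (rule env_unchanged[OF es u]) simp_all
    then have i: "vars \<sigma>' ''i'' \<le> T" and off: "arrs \<sigma>' ''off'' v = v * Suc T"
      using c y unfolding env_def by auto
    have yz: "vars \<sigma>' y = v" "vars \<sigma>' z = vars \<sigma> z" using unchangedD(1)[OF u] y by simp_all
    have "grid T ((arrs \<sigma>' ''mk'')(v * Suc T + vars \<sigma>' ''i'' := vars \<sigma> z)) =
       (\<lambda>w j. if w = v \<and> j < Suc (vars \<sigma>' ''i'') then vars \<sigma> z else grid T (arrs \<sigma> ''mk'') w j)"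
      unfolding grid_upd[OF i] using I by (auto simp: fun_eq_iff less_Suc_eq)
    then show "0 \<le> k' \<and> wp ?c ?I \<sigma>' (k' - int (1 + bcost (Less (Var ''i'') (Add (Var ''tau'') (Const 1)))))"
      using I i k by (simp add: wp_simps off yz del: mult_Suc_right)
  next
    fix \<sigma>' k'
    assume I: "?I \<sigma>' k'" and u: "unchanged ?c ?s \<sigma>'"
      and c: "\<not> bval (Less (Var ''i'') (Add (Var ''tau'') (Const 1))) \<sigma>'"
    have e': "env \<sigma>'" by (rule env_unchanged[OF es u]) simp_all
    then have i: "vars \<sigma>' ''i'' = Suc T" using c I unfolding env_def by auto
    then show "?R \<sigma>' (k' - int (1 + bcost (Less (Var ''i'') (Add (Var ''tau'') (Const 1)))))"
      using I by (auto simp: less_Suc_eq_le)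
  qed (simp)
  then show "wp (fill y z) ?R \<sigma> k" unfolding fill_def by (simp add: wp_simps)
qed (use Q in blast)

text \<open>\<open>rk v * Suc T + i\<close> encodes the lexicographic order of rank and time. It
  decreases with each step back, so the cells of the spine are distinct, and the lower bound on
  \<open>c\<close> in terms of it guarantees that the positions do not run out before
  \<open>s\<close> is reached.\<close>

definition chain ::
  "(nat \<Rightarrow> nat) \<Rightarrow> (nat \<Rightarrow> nat) \<Rightarrow> nat \<Rightarrow> nat \<Rightarrow> nat \<Rightarrow> nat \<Rightarrow> (nat \<Rightarrow> nat) \<Rightarrow> (nat \<Rightarrow> nat) \<Rightarrow>
   (nat \<Rightarrow> nat \<Rightarrow> nat) \<Rightarrow> (nat \<Rightarrow> nat \<Rightarrow> nat) \<Rightarrow> bool" where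
  "chain arr rk N c v i xv xi lab par \<longleftrightarrow>
     0 < arr v \<and> arr v \<le> i \<and> i \<le> T \<and> rk v < rk t \<and> rk v * Suc T + i + 2 < c \<and> c \<le> N \<and> xv N = t \<and> xi N = 0 \<and>
     (c = N \<longrightarrow> (v, i, t) \<in> A) \<and> (c < N \<longrightarrow> (xv (N - 1), xi (N - 1), t) \<in> A) \<and>
     (c < N \<longrightarrow> xv c = v \<and> xi c = Suc i \<or>
       (v, i, xv c) \<in> A \<and> xi c = i \<and> xi c = arr (xv c) \<and> rk v < rk (xv c)) \<and>
     (c < N \<longrightarrow> par (xv c) (xi c) = v) \<and>
     (\<forall>d. c \<le> d \<longrightarrow> d < N \<longrightarrow> xv d < n \<and> xv d \<noteq> s \<and> xv d \<noteq> t \<and> 0 < arr (xv d) \<and> arr (xv d) \<le> xi d \<and> xi d \<le> T \<and>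
        lab (xv d) (xi d) = d \<and> rk v * Suc T + i < rk (xv d) * Suc T + xi d) \<and>
     (\<forall>d. c \<le> d \<longrightarrow> Suc d < N \<longrightarrow> par (xv (Suc d)) (xi (Suc d)) = xv d \<and>
        (xv (Suc d) = xv d \<and> xi (Suc d) = Suc (xi d) \<or>
        (xv d, xi d, xv (Suc d)) \<in> A \<and> xi (Suc d) = xi d \<and> xi (Suc d) = arr (xv (Suc d)) \<and>
          rk (xv d) < rk (xv (Suc d)))) \<and>
     (\<forall>j \<le> T. lab t j = N) \<and>
     (\<forall>w j. 0 < lab w j \<longrightarrow> w = t \<or> (\<exists>d. c \<le> d \<and> d < N \<and> xv d = w \<and> xi d = j))"

lemma chain_step:
  assumes e: "earliest arr prv rk now" and c: "chain arr rk N (Suc c) v i xv xi lab par" and v: "v \<noteq> s"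
    and u: "u = (if arr v < i then v else prv v)" "i' = (if arr v < i then i - 1 else i)"
  shows "chain arr rk N c u i' (xv(c := v)) (xi(c := i)) (\<lambda>w j. if w = v \<and> j = i then c else lab w j)
    (\<lambda>w j. if w = v \<and> j = i then u else par w j)"
proof -
  note E = earliestD[OF e]
  have c1: "0 < arr v" "arr v \<le> i" "i \<le> T" "rk v < rk t" "rk v * Suc T + i + 2 < Suc c" "Suc c \<le> N" "xv N = t" "xi N = 0"
    and c2: "Suc c = N \<Longrightarrow> (v, i, t) \<in> A" "Suc c < N \<Longrightarrow> (xv (N - 1), xi (N - 1), t) \<in> A"
    and c3: "Suc c < N \<Longrightarrow> xv (Suc c) = v \<and> xi (Suc c) = Suc i \<or>
       (v, i, xv (Suc c)) \<in> A \<and> xi (Suc c) = i \<and> xi (Suc c) = arr (xv (Suc c)) \<and> rk v < rk (xv (Suc c))"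
    and c4: "Suc c < N \<Longrightarrow> par (xv (Suc c)) (xi (Suc c)) = v"
    and c5: "\<And>d. Suc c \<le> d \<Longrightarrow> d < N \<Longrightarrow> xv d < n \<and> xv d \<noteq> s \<and> xv d \<noteq> t \<and> 0 < arr (xv d) \<and> arr (xv d) \<le> xi d \<and> xi d \<le> T \<and>
        lab (xv d) (xi d) = d \<and> rk v * Suc T + i < rk (xv d) * Suc T + xi d"
    and c6: "\<And>d. Suc c \<le> d \<Longrightarrow> Suc d < N \<Longrightarrow> par (xv (Suc d)) (xi (Suc d)) = xv d \<and>
        (xv (Suc d) = xv d \<and> xi (Suc d) = Suc (xi d) \<or>
        (xv d, xi d, xv (Suc d)) \<in> A \<and> xi (Suc d) = xi d \<and> xi (Suc d) = arr (xv (Suc d)) \<and>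
          rk (xv d) < rk (xv (Suc d)))"
    and c7: "\<And>j. j \<le> T \<Longrightarrow> lab t j = N"
    and c8: "\<And>w j. 0 < lab w j \<Longrightarrow> w = t \<or> (\<exists>d. Suc c \<le> d \<and> d < N \<and> xv d = w \<and> xi d = j)"
    using c unfolding chain_def by blast+
  let ?xv = "xv(c := v)" and ?xi = "xi(c := i)"
  let ?lab = "\<lambda>w j. if w = v \<and> j = i then c else lab w j" and ?par = "\<lambda>w j. if w = v \<and> j = i then u else par w j"
  have vt: "v \<noteq> t" using c1 by auto
  have vn: "v < n" using E(6) c1 by blast
  note E4 = E(4)[OF v c1(1)]
  have key: "u \<noteq> v \<longrightarrow> rk u < rk v" "rk u * Suc T + i' < rk v * Suc T + i" "0 < arr u" "arr u \<le> i'" "i' \<le> T"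
  proof -
    show "u \<noteq> v \<longrightarrow> rk u < rk v" using E4 u by simp
    show "0 < arr u" "arr u \<le> i'" "i' \<le> T" using E4 c1 u by (auto split: if_splits)
    show "rk u * Suc T + i' < rk v * Suc T + i"
    proof (cases "arr v < i")
      case True
      then show ?thesis using u by simp
    next
      case False
      then have "Suc (rk u) \<le> rk v" "i' = i" using E4 u by auto
      then have "Suc (rk u) * Suc T \<le> rk v * Suc T" using mult_le_mono1 by blast
      then show ?thesis using \<open>i' = i\<close> by simp
    qed
  qed
  have new: "\<not> (xv d = v \<and> xi d = i)" if "Suc c \<le> d" "d < N" for d using c5[OF that] by auto
  have N: "N \<noteq> c" "c < N" using c1 by auto
  have 3: "?xv c = u \<and> ?xi c = Suc i' \<or>
       (u, i', ?xv c) \<in> A \<and> ?xi c = i' \<and> ?xi c = arr (?xv c) \<and> rk u < rk (?xv c)"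
  proof (cases "arr v < i")
    case True
    then show ?thesis using u by simp
  next
    case False
    then have "arr v = i" using c1 by simp
    then show ?thesis using E4 u False by simp
  qed
  have 2: "(?xv (N - 1), ?xi (N - 1), t) \<in> A"
    using c2 N by (cases "Suc c = N") auto
  have 5: "?xv d < n \<and> ?xv d \<noteq> s \<and> ?xv d \<noteq> t \<and> 0 < arr (?xv d) \<and> arr (?xv d) \<le> ?xi d \<and> ?xi d \<le> T \<and>
        ?lab (?xv d) (?xi d) = d \<and> rk u * Suc T + i' < rk (?xv d) * Suc T + ?xi d" if d: "c \<le> d" "d < N" for d
  proof (cases "d = c")
    case True
    then show ?thesis using c1 v vt vn key by simp
  next
    case False
    then have "Suc c \<le> d" using d by simp
    then show ?thesis using c5[of d] new[of d] key(2) d False by auto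
  qed
  have 6: "?par (?xv (Suc d)) (?xi (Suc d)) = ?xv d \<and>
        (?xv (Suc d) = ?xv d \<and> ?xi (Suc d) = Suc (?xi d) \<or>
        (?xv d, ?xi d, ?xv (Suc d)) \<in> A \<and> ?xi (Suc d) = ?xi d \<and> ?xi (Suc d) = arr (?xv (Suc d)) \<and>
          rk (?xv d) < rk (?xv (Suc d)))" if d: "c \<le> d" "Suc d < N" for d
  proof (cases "d = c")
    case True
    then show ?thesis using c3 c4 new[of "Suc c"] d by auto
  next
    case False
    then show ?thesis using c6[of d] new[of "Suc d"] d by auto
  qed
  have 8: "w = t \<or> (\<exists>d. c \<le> d \<and> d < N \<and> ?xv d = w \<and> ?xi d = j)" if "0 < ?lab w j" for w j
  proof (cases "w = v \<and> j = i")
    case True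
    then show ?thesis using N by (intro disjI2 exI[of _ c]) simp
  next
    case False
    then have "0 < lab w j" using that by auto
    then have "w = t \<or> (\<exists>d. Suc c \<le> d \<and> d < N \<and> xv d = w \<and> xi d = j)" by (rule c8)
    then show ?thesis
    proof
      assume "\<exists>d. Suc c \<le> d \<and> d < N \<and> xv d = w \<and> xi d = j"
      then obtain d where "Suc c \<le> d" "d < N" "xv d = w" "xi d = j" by blast
      then show ?thesis by (intro disjI2 exI[of _ d]) simp
    qed simp
  qed
  have "rk u < rk t" using key(1) c1 by (cases "u = v") auto
  moreover have "rk u * Suc T + i' + 2 < c" using key(2) c1 by linarith
  ultimately show ?thesis
    unfolding chain_def using key c1 N 2 3 5 6 8 c7 vt by (intro conjI) (simp; fail | blast)+
qed

text \<open>This is where the choice of \<open>N\<close> matters: the rank of the last inner vertex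
  is at most \<open>n - 1\<close> and the time at most \<open>T\<close>, so the whole spine and
  \<open>s\<close> fit below \<open>N\<close>.\<close>

lemma chain_init:
  assumes e: "earliest arr prv rk (Suc T)" and at: "0 < arr t" and N: "N = n * Suc T + 2" "xv N = t" "xi N = 0"
    and lab: "lab = (\<lambda>w j. if w = t \<and> j \<le> T then N else 0)"
  shows "chain arr rk N N (prv t) (arr t) xv xi lab par"
proof -
  note E = earliestD[OF e]
  note E4 = E(4)[OF st[symmetric] at]
  have i: "arr t \<le> T" using arc[of "prv t" "arr t" t] E4 by simp
  have "rk (prv t) < n" using E(6)[of "prv t"] E4 earliest_finite[OF e] by simp
  then have "Suc (rk (prv t)) * Suc T \<le> n * Suc T" by (intro mult_le_mono1) simp
  then have "rk (prv t) * Suc T + arr t + 2 < N" using N i by simp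
  then show ?thesis unfolding chain_def lab using E4 i N by auto
qed

definition laid :: "nat \<Rightarrow> nat \<Rightarrow> (nat \<Rightarrow> nat) \<Rightarrow> (nat \<Rightarrow> nat) \<Rightarrow>
    (nat \<Rightarrow> nat \<Rightarrow> nat) \<Rightarrow> (nat \<Rightarrow> nat \<Rightarrow> nat) \<Rightarrow> bool" where
  "laid L N xv xi lab par \<longleftrightarrow>
     (\<forall>j \<le> T. lab s j = L) \<and> (\<forall>j \<le> T. lab t j = N) \<and> (\<forall>c. L < c \<longrightarrow> c < N \<longrightarrow> lab (xv c) (xi c) = c) \<and>
     (\<forall>v i. 0 < lab v i \<longrightarrow> i \<le> T \<and> (v = s \<or> v = t \<or> (\<exists>c. L < c \<and> c < N \<and> xv c = v \<and> xi c = i))) \<and>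
     (\<forall>c. L \<le> c \<longrightarrow> Suc c < N \<longrightarrow> par (xv (Suc c)) (xi (Suc c)) = xv c)"

lemma chain_end:
  assumes e: "earliest arr prv rk (Suc T)" and c: "chain arr rk N (Suc L) s i xv xi lab par"
    and z: "\<And>w j. T < j \<Longrightarrow> lab w j = 0"
  shows "spine n T s t A D arr rk L N (xv(L := s)) xi"
    and "laid L N (xv(L := s)) xi (\<lambda>w j. if w = s \<and> j \<le> T then L else lab w j) par"
proof -
  note E = earliestD[OF e]
  have c1: "0 < arr s" "arr s \<le> i" "i \<le> T" "rk s * Suc T + i + 2 < Suc L" "Suc L \<le> N" "xv N = t"
    and c2: "Suc L = N \<Longrightarrow> (s, i, t) \<in> A" "Suc L < N \<Longrightarrow> (xv (N - 1), xi (N - 1), t) \<in> A"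
    and c3: "Suc L < N \<Longrightarrow> xv (Suc L) = s \<and> xi (Suc L) = Suc i \<or>
       (s, i, xv (Suc L)) \<in> A \<and> xi (Suc L) = i \<and> xi (Suc L) = arr (xv (Suc L)) \<and> rk s < rk (xv (Suc L))"
    and c4: "Suc L < N \<Longrightarrow> par (xv (Suc L)) (xi (Suc L)) = s"
    and c5: "\<And>d. Suc L \<le> d \<Longrightarrow> d < N \<Longrightarrow> xv d < n \<and> xv d \<noteq> s \<and> xv d \<noteq> t \<and> 0 < arr (xv d) \<and> arr (xv d) \<le> xi d \<and> xi d \<le> T \<and>
        lab (xv d) (xi d) = d \<and> rk s * Suc T + i < rk (xv d) * Suc T + xi d"
    and c6: "\<And>d. Suc L \<le> d \<Longrightarrow> Suc d < N \<Longrightarrow> par (xv (Suc d)) (xi (Suc d)) = xv d \<and>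
        (xv (Suc d) = xv d \<and> xi (Suc d) = Suc (xi d) \<or>
        (xv d, xi d, xv (Suc d)) \<in> A \<and> xi (Suc d) = xi d \<and> xi (Suc d) = arr (xv (Suc d)) \<and>
          rk (xv d) < rk (xv (Suc d)))"
    and c7: "\<And>j. j \<le> T \<Longrightarrow> lab t j = N"
    and c8: "\<And>w j. 0 < lab w j \<Longrightarrow> w = t \<or> (\<exists>d. Suc L \<le> d \<and> d < N \<and> xv d = w \<and> xi d = j)"
    using c unfolding chain_def by blast+
  \<comment> \<open>Without an inner position the spine would be an arc of \<open>A\<close> from
    \<open>s\<close> to \<open>t\<close>.\<close>
  have LN: "Suc L < N" using c1(5) c2(1) no_direct[of i] by (cases "Suc L = N") auto
  have x0: "(s, i, xv (Suc L)) \<in> A \<and> xi (Suc L) = i \<and> xi (Suc L) = arr (xv (Suc L))"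
    using c3[OF LN] c5[of "Suc L"] LN by auto
  let ?xv = "xv(L := s)"
  show "spine n T s t A D arr rk L N ?xv xi"
  proof
    show "arr s = 1" "0 < L" "Suc L < N" "?xv L = s" using E(1) c1 LN by auto
    show "?xv N = t" using c1 LN by simp
    show "0 < arr v \<and> arr v \<le> i" if "(u, i, v) \<in> A" "0 < arr u" "arr u \<le> i" for u i v
      using E(3)[of u i v] that arc[of u i v] by simp
    show "u = v" if "0 < arr u" "0 < arr v" "rk u = rk v" for u v
      using inj_onD[OF E(5)] that by simp
    show "?xv c < n \<and> ?xv c \<noteq> s \<and> ?xv c \<noteq> t \<and> 0 < arr (?xv c) \<and> arr (?xv c) \<le> xi c \<and> xi c \<le> T"
      if "L < c" "c < N" for c using c5[of c] that by simp
    show "?xv (Suc c) = ?xv c \<and> xi (Suc c) = Suc (xi c) \<or>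
      (?xv c, xi c, ?xv (Suc c)) \<in> A \<and> xi (Suc c) = xi c \<and> xi (Suc c) = arr (?xv (Suc c)) \<and>
        rk (?xv c) < rk (?xv (Suc c))" if "L < c" "Suc c < N" for c using c6[of c] that by simp
    show "(s, xi (Suc L), ?xv (Suc L)) \<in> A" "xi (Suc L) = arr (?xv (Suc L))" using x0 by simp_all
    show "(?xv (N - 1), xi (N - 1), t) \<in> A" using c2(2)[OF LN] LN by auto
  qed
  have 3: "(if ?xv c = s \<and> xi c \<le> T then L else lab (?xv c) (xi c)) = c" if "L < c" "c < N" for c
    using c5[of c] that by simp
  have 4: "j \<le> T \<and> (w = s \<or> w = t \<or> (\<exists>c. L < c \<and> c < N \<and> ?xv c = w \<and> xi c = j))"
    if "0 < (if w = s \<and> j \<le> T then L else lab w j)" for w j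
  proof (cases "w = s \<and> j \<le> T")
    case False
    then have "0 < lab w j" using that by auto
    moreover from this have "j \<le> T" using z[of j w] by (cases "j \<le> T") auto
    moreover have "w = t \<or> (\<exists>d. L < d \<and> d < N \<and> ?xv d = w \<and> xi d = j)"
    proof (cases "w = t")
      case False
      then obtain d where "Suc L \<le> d" "d < N" "xv d = w" "xi d = j" using c8[OF \<open>0 < lab w j\<close>] by blast
      then have "L < d \<and> d < N \<and> ?xv d = w \<and> xi d = j" by simp
      then show ?thesis by blast
    qed simp
    ultimately show ?thesis by blast
  qed simp
  have 5: "par (?xv (Suc c)) (xi (Suc c)) = ?xv c" if "L \<le> c" "Suc c < N" for c
    using c4[OF LN] c6[of c] that by (cases "c = L") auto
  have 2: "(if t = s \<and> j \<le> T then L else lab t j) = N" if "j \<le> T" for j using c7[OF that] st by simp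
  have 1: "(if s = s \<and> j \<le> T then L else lab s j) = L" if "j \<le> T" for j using that by simp
  show "laid L N ?xv xi (\<lambda>w j. if w = s \<and> j \<le> T then L else lab w j) par"
    unfolding laid_def using 1 2 3 4 5 by blast
qed

definition state_chain :: "(nat \<Rightarrow> nat) \<Rightarrow> state \<Rightarrow> nat \<Rightarrow> bool" where
  "state_chain rk \<sigma> c \<longleftrightarrow> chain (arrs \<sigma> ''arr'') rk (n * Suc T + 2) c (vars \<sigma> ''v'') (vars \<sigma> ''i'')
     (arrs \<sigma> ''xv'') (arrs \<sigma> ''xi'') (grid T (arrs \<sigma> ''mk'')) (grid T (arrs \<sigma> ''par''))"

lemma wp_spine_step:
  assumes e: "env \<sigma>" and r: "earliest (arrs \<sigma> ''arr'') (arrs \<sigma> ''prv'') rk (Suc T)"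
    and c: "state_chain rk \<sigma> (vars \<sigma> ''c'')" and v: "vars \<sigma> ''v'' \<noteq> s"
    and Q: "\<And>\<sigma>' k'. unchanged spine_step \<sigma> \<sigma>' \<Longrightarrow> state_chain rk \<sigma>' (vars \<sigma>' ''c'') \<Longrightarrow>
      vars \<sigma> ''c'' = Suc (vars \<sigma>' ''c'') \<Longrightarrow> k - 60 \<le> k' \<Longrightarrow> Q \<sigma>' k'"
  shows "wp spine_step Q \<sigma> k"
proof (rule wp_frame)
  let ?R = "\<lambda>\<sigma>' k'. state_chain rk \<sigma>' (vars \<sigma>' ''c'') \<and> vars \<sigma> ''c'' = Suc (vars \<sigma>' ''c'') \<and> k - 60 \<le> k'"
  let ?v = "vars \<sigma> ''v''" and ?i = "vars \<sigma> ''i''" and ?arr = "arrs \<sigma> ''arr''"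
  obtain c' where c': "vars \<sigma> ''c'' = Suc c'"
    using c unfolding state_chain_def chain_def by (cases "vars \<sigma> ''c''") auto
  have i: "?i \<le> T" and vn: "?v < n"
    using c earliestD(6)[OF r, of ?v] unfolding state_chain_def chain_def by auto
  then have off: "arrs \<sigma> ''off'' ?v = ?v * Suc T" using e unfolding env_def by simp
  note st = chain_step[OF r c[unfolded state_chain_def c'] v refl refl, folded grid_upd[OF i]]
  show "wp spine_step ?R \<sigma> k"
    using st c' unfolding spine_step_def state_chain_def
    by (cases "?arr ?v < ?i") (simp_all add: wp_simps off del: mult_Suc_right)
qed (use Q in blast)

lemma unchanged_fill:
  assumes "unchanged (fill y z) \<sigma> \<sigma>'"
  shows "x \<noteq> ''i'' \<Longrightarrow> vars \<sigma>' x = vars \<sigma> x" "X \<noteq> ''mk'' \<Longrightarrow> arrs \<sigma>' X = arrs \<sigma> X"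
  using assms by (auto simp: unchanged_def fill_def)

lemma env_cong:
  assumes "env \<sigma>"
    and "vars \<sigma>' ''tau'' = vars \<sigma> ''tau'' \<and> vars \<sigma>' ''s'' = vars \<sigma> ''s'' \<and> vars \<sigma>' ''t'' = vars \<sigma> ''t'' \<and>
      vars \<sigma>' ''N'' = vars \<sigma> ''N'' \<and> vars \<sigma>' ''K'' = vars \<sigma> ''K''"
    and "arrs \<sigma>' ''off'' = arrs \<sigma> ''off'' \<and> arrs \<sigma>' ''au'' = arrs \<sigma> ''au'' \<and>
      arrs \<sigma>' ''ai'' = arrs \<sigma> ''ai'' \<and> arrs \<sigma>' ''av'' = arrs \<sigma> ''av''"
  shows "env \<sigma>'"
  using assms unfolding env_def arcs_def by simp

lemma wp_spine_loop:
  assumes e: "env \<sigma>" and r: "earliest (arrs \<sigma> ''arr'') (arrs \<sigma> ''prv'') rk (Suc T)"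
    and c: "state_chain rk \<sigma> (vars \<sigma> ''c'')" and k: "80 * int (vars \<sigma> ''c'') \<le> k"
    and Q: "\<And>\<sigma>' k'. unchanged spine_step \<sigma> \<sigma>' \<Longrightarrow> state_chain rk \<sigma>' (vars \<sigma>' ''c'') \<Longrightarrow>
      vars \<sigma>' ''v'' = s \<Longrightarrow> k - 80 * int (vars \<sigma> ''c'') \<le> k' \<Longrightarrow> Q \<sigma>' k'"
  shows "wp (While (Neg (Equal (Var ''v'') (Var ''s''))) spine_step) Q \<sigma> k"
proof -
  let ?I = "\<lambda>\<sigma>' k'. state_chain rk \<sigma>' (vars \<sigma>' ''c'') \<and> k - 80 * int (vars \<sigma> ''c'') + 80 * int (vars \<sigma>' ''c'') \<le> k'"
  have sim: "env \<sigma>' \<and> earliest (arrs \<sigma>' ''arr'') (arrs \<sigma>' ''prv'') rk (Suc T)" if u: "unchanged spine_step \<sigma> \<sigma>'" for \<sigma>'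
    using r env_unchanged[OF e u] unchangedD(2)[OF u, of "''arr''"] unchangedD(2)[OF u, of "''prv''"]
    by (simp add: spine_step_def)
  show ?thesis
  proof (rule wp_loop[where I = ?I])
    fix \<sigma>' k'
    assume I: "?I \<sigma>' k'" and u: "unchanged spine_step \<sigma> \<sigma>'" and b: "bval (Neg (Equal (Var ''v'') (Var ''s''))) \<sigma>'"
    have v: "vars \<sigma>' ''v'' \<noteq> s" using b sim[OF u] unfolding env_def by simp
    have "wp spine_step ?I \<sigma>' (k' - 5)"
      by (rule wp_spine_step[where rk = rk]) (use sim[OF u] v I in auto)
    then show "0 \<le> k' \<and> wp spine_step ?I \<sigma>' (k' - int (1 + bcost (Neg (Equal (Var ''v'') (Var ''s'')))))"
      using I k by simp
  next
    fix \<sigma>' k'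
    assume I: "?I \<sigma>' k'" and u: "unchanged spine_step \<sigma> \<sigma>'" and b: "\<not> bval (Neg (Equal (Var ''v'') (Var ''s''))) \<sigma>'"
    have v: "vars \<sigma>' ''v'' = s" using b sim[OF u] unfolding env_def by simp
    have "0 < vars \<sigma>' ''c''" using I unfolding state_chain_def chain_def by simp
    then show "Q \<sigma>' (k' - int (1 + bcost (Neg (Equal (Var ''v'') (Var ''s'')))))"
      using I v by (intro Q u) auto
  qed (use c in simp)
qed

lemma wp_spine:
  assumes e: "env \<sigma>" and r: "earliest (arrs \<sigma> ''arr'') (arrs \<sigma> ''prv'') rk (Suc T)"
    and at: "0 < arrs \<sigma> ''arr'' t" and z: "arrs \<sigma> ''mk'' = (\<lambda>_. 0)"
    and k: "200 + 60 * int T + 80 * int (n * Suc T + 2) \<le> k"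
    and Q: "\<And>\<sigma>' k' L. unchanged spine_com \<sigma> \<sigma>' \<Longrightarrow> vars \<sigma>' ''c'' = L \<Longrightarrow>
      spine n T s t A D (arrs \<sigma> ''arr'') rk L (n * Suc T + 2) (arrs \<sigma>' ''xv'') (arrs \<sigma>' ''xi'') \<Longrightarrow>
      laid L (n * Suc T + 2) (arrs \<sigma>' ''xv'') (arrs \<sigma>' ''xi'') (grid T (arrs \<sigma>' ''mk'')) (grid T (arrs \<sigma>' ''par'')) \<Longrightarrow>
      arrs \<sigma>' ''xi'' (n * Suc T + 2) = 0 \<Longrightarrow>
      k - (200 + 60 * int T + 80 * int (n * Suc T + 2)) \<le> k' \<Longrightarrow> Q \<sigma>' k'"
  shows "wp spine_com Q \<sigma> k"
proof (rule wp_frame)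
  let ?N = "n * Suc T + 2"
  let ?R = "\<lambda>\<sigma>' k'. spine n T s t A D (arrs \<sigma> ''arr'') rk (vars \<sigma>' ''c'') ?N (arrs \<sigma>' ''xv'') (arrs \<sigma>' ''xi'') \<and>
      laid (vars \<sigma>' ''c'') ?N (arrs \<sigma>' ''xv'') (arrs \<sigma>' ''xi'') (grid T (arrs \<sigma>' ''mk'')) (grid T (arrs \<sigma>' ''par'')) \<and>
      arrs \<sigma>' ''xi'' ?N = 0 \<and> k - (200 + 60 * int T + 80 * int ?N) \<le> k'"
  let ?end = "Assign ''c'' (Sub (Var ''c'') (Const 1));; Store ''xv'' (Var ''c'') (Var ''s'');; fill ''s'' ''c''"
  let ?loop = "While (Neg (Equal (Var ''v'') (Var ''s''))) spine_step"
  have N: "vars \<sigma> ''N'' = ?N" using e unfolding env_def by simp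
  have "50 + 30 * int T \<le> 200 + 60 * int T + 80 * int x" for x by simp
  then have k0: "50 + 30 * int T \<le> k" using k by (rule order_trans)
  show "wp spine_com ?R \<sigma> k"
    unfolding spine_com_def wp_Seq
  proof (rule wp_fill[OF e, where v = t])
    show "vars \<sigma> ''t'' = t" using e unfolding env_def by simp
    fix \<sigma>1 k1
    assume u1: "unchanged (fill ''t'' ''N'') \<sigma> \<sigma>1"
      and g1: "grid T (arrs \<sigma>1 ''mk'') = (\<lambda>w j. if w = t \<and> j \<le> T then vars \<sigma> ''N'' else grid T (arrs \<sigma> ''mk'') w j)"
      and k1: "k - (50 + 30 * int T) \<le> k1"
    have e1: "env \<sigma>1" by (rule env_cong[OF e]) (simp_all add: unchanged_fill[OF u1])
    let ?s2 = "\<lparr>vars = (vars \<sigma>1)(''c'' := ?N, ''v'' := arrs \<sigma> ''prv'' t, ''i'' := arrs \<sigma> ''arr'' t),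
      arrs = (arrs \<sigma>1)(''xv'' := (arrs \<sigma>1 ''xv'')(?N := t), ''xi'' := (arrs \<sigma>1 ''xi'')(?N := 0))\<rparr>"
    have e2: "env ?s2" by (rule env_cong[OF e1]) simp_all
    have g: "grid T (arrs \<sigma>1 ''mk'') = (\<lambda>w j. if w = t \<and> j \<le> T then ?N else 0)"
      using g1 z N by (auto simp: grid_def fun_eq_iff)
    have c2: "state_chain rk ?s2 ?N"
      using chain_init[OF r at refl _ _ g] unfolding state_chain_def by (simp add: unchanged_fill[OF u1])
    have "wp ?loop (wp ?end ?R) ?s2 (k1 - 14)"
    proof (rule wp_spine_loop[OF e2])
      show "earliest (arrs ?s2 ''arr'') (arrs ?s2 ''prv'') rk (Suc T)"
        using r by (simp add: unchanged_fill[OF u1])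
      show "state_chain rk ?s2 (vars ?s2 ''c'')" using c2 by simp
      show "80 * int (vars ?s2 ''c'') \<le> k1 - 14" using k k1 by simp
      fix \<sigma>3 k3
      assume u3: "unchanged spine_step ?s2 \<sigma>3" and c3: "state_chain rk \<sigma>3 (vars \<sigma>3 ''c'')"
        and v3: "vars \<sigma>3 ''v'' = s" and k3: "k1 - 14 - 80 * int (vars ?s2 ''c'') \<le> k3"
      have e3: "env \<sigma>3" by (rule env_unchanged[OF e2 u3]) (simp_all add: spine_step_def)
      have a3: "arrs \<sigma>3 ''arr'' = arrs \<sigma> ''arr''"
        using unchangedD(2)[OF u3, of "''arr''"] by (simp add: spine_step_def unchanged_fill[OF u1])
      obtain L where L: "vars \<sigma>3 ''c'' = Suc L"
        using c3 unfolding state_chain_def chain_def by (cases "vars \<sigma>3 ''c''") auto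
      let ?s4 = "\<lparr>vars = (vars \<sigma>3)(''c'' := L), arrs = (arrs \<sigma>3)(''xv'' := (arrs \<sigma>3 ''xv'')(L := s))\<rparr>"
      have e4: "env ?s4" by (rule env_cong[OF e3]) simp_all
      have z3: "grid T (arrs \<sigma>3 ''mk'') w j = 0" if "T < j" for w j using that by (simp add: grid_def)
      note ch = c3[unfolded state_chain_def L v3 a3]
      have xiN: "arrs \<sigma>3 ''xi'' ?N = 0" using c3 unfolding state_chain_def chain_def by simp
      have "wp (fill ''s'' ''c'') ?R ?s4 (k3 - 7)"
      proof (rule wp_fill[OF e4, where v = s])
        fix \<sigma>5 k5
        assume u5: "unchanged (fill ''s'' ''c'') ?s4 \<sigma>5"
          and g5: "grid T (arrs \<sigma>5 ''mk'') = (\<lambda>w j. if w = s \<and> j \<le> T then vars ?s4 ''c'' else grid T (arrs ?s4 ''mk'') w j)"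
          and k5: "k3 - 7 - (50 + 30 * int T) \<le> k5"
        have "grid T (arrs \<sigma>5 ''mk'') = (\<lambda>w j. if w = s \<and> j \<le> T then L else grid T (arrs \<sigma>3 ''mk'') w j)"
          unfolding g5 by (auto simp: fun_eq_iff)
        then show "?R \<sigma>5 k5"
          using chain_end[OF r ch z3] k1 k3 k5 xiN by (simp add: unchanged_fill[OF u5])
      qed (use e3 s k k1 k3 in \<open>auto simp: env_def\<close>)
      moreover have "vars \<sigma>3 ''s'' = s" using e3 unfolding env_def by simp
      ultimately show "wp ?end ?R \<sigma>3 k3" using L by (simp add: wp_simps)
    qed
    moreover have "vars \<sigma>1 ''N'' = ?N" "vars \<sigma>1 ''t'' = t" using e1 unfolding env_def by simp_all
    ultimately show "wp (Assign ''c'' (Var ''N'')) (wp (Assign ''v'' (Read ''prv'' (Var ''t'')))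
      (wp (Assign ''i'' (Read ''arr'' (Var ''t''))) (wp (Store ''xv'' (Var ''N'') (Var ''t''))
      (wp (Store ''xi'' (Var ''N'') (Const 0)) (wp ?loop (wp (Assign ''c'' (Sub (Var ''c'') (Const 1)))
      (wp (Store ''xv'' (Var ''c'') (Var ''s'')) (wp (fill ''s'' ''c'') ?R)))))))) \<sigma>1 k1"
      unfolding wp_Seq_fun by (simp add: wp_simps unchanged_fill[OF u1])
  qed (use t k0 in auto)
qed (use Q in blast)

end

section \<open>The sweep\<close>

definition spread_step :: com where
  "spread_step =
     Store_cell ''mk'' (Var ''v'') (Var ''i'') (Var ''a'');;
     Store_cell ''par'' (Var ''v'') (Var ''i'') (Var ''v'');;
     Assign ''i'' (Add (Var ''i'') (Const 1))"

definition spread :: com where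
  "spread =
     Assign ''i'' (Add (Var ''i'') (Const 1));;
     While (Conj (Less (Var ''i'') (Add (Var ''tau'') (Const 1))) (Equal (cell ''mk'' (Var ''v'') (Var ''i'')) (Const 0)))
       spread_step"

text \<open>Only tails with label exactly \<open>a\<close> are considered; the arcs leaving smaller
  labels were settled in earlier phases, as \<open>moved\<close> records.\<close>

definition sweep_step :: com where
  "sweep_step =
     Assign ''u'' (Read ''au'' (Var ''k''));; Assign ''i'' (Read ''ai'' (Var ''k''));;
     Assign ''v'' (Read ''av'' (Var ''k''));;
     Cond (Conj (Equal (cell ''mk'' (Var ''u'') (Var ''i'')) (Var ''a''))
         (Neg (Equal (Var ''v'') (Read ''xv'' (Var ''a'')))))
       (Cond (Equal (cell ''mk'' (Var ''v'') (Var ''i'')) (Const 0))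
         (Store_cell ''mk'' (Var ''v'') (Var ''i'') (Var ''a'');;
          Store_cell ''par'' (Var ''v'') (Var ''i'') (Var ''u'');;
          Assign ''ch'' (Const 1);; spread)
         (Cond (Less (Var ''best'') (cell ''mk'' (Var ''v'') (Var ''i'')))
           (Assign ''best'' (cell ''mk'' (Var ''v'') (Var ''i''));;
            Assign ''bv'' (Var ''u'');; Assign ''bi'' (Var ''i''))
           Skip))
       Skip;;
     Assign ''k'' (Add (Var ''k'') (Const 1))"

text \<open>At \<open>beta\<close> either no detour leads beyond, and the cut is found, or the
  pointer of the return point is redirected. In the second case and between two such points, waiting
  at the new position is propagated before anything else.\<close>

definition advance :: com where
  "advance =
     Assign ''a'' (Add (Var ''a'') (Const 1));;
     Cond (Less (Var ''a'') (Var ''N''))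
       (Cond (Conj (Equal (Var ''a'') (Var ''beta'')) (Equal (Var ''best'') (Var ''beta'')))
         (Assign ''fail'' (Const 1))
         (Cond (Equal (Var ''a'') (Var ''beta''))
            (Store_cell ''par'' (Read ''xv'' (Var ''best'')) (Read ''xi'' (Var ''best'')) (Var ''bv'');;
             Assign ''beta'' (Var ''best''))
            Skip;;
          Assign ''v'' (Read ''xv'' (Var ''a''));; Assign ''i'' (Read ''xi'' (Var ''a''));; spread))
       Skip"

definition sweep_round :: com where
  "sweep_round =
     Assign ''ch'' (Const 0);; Assign ''k'' (Const 0);;
     While (Less (Var ''k'') (Var ''K'')) sweep_step;;
     Cond (Equal (Var ''ch'') (Const 0)) advance Skip"

definition sweep :: com where
  "sweep =
     Assign ''a'' (Var ''c'');; Assign ''beta'' (Add (Var ''c'') (Const 1));;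
     Cond (Equal (Var ''d'') (Const 0))
       (Assign ''best'' (Add (Var ''c'') (Const 1)))
       (Assign ''best'' (Var ''N'');; Assign ''bv'' (Var ''s'');; Assign ''bi'' (Var ''d1''));;
     Assign ''fail'' (Const 0);;
     While (Conj (Less (Var ''a'') (Var ''N'')) (Equal (Var ''fail'') (Const 0))) sweep_round"

lemma unchanged_spread:
  assumes "unchanged spread \<sigma> \<sigma>'"
  shows "x \<noteq> ''i'' \<Longrightarrow> vars \<sigma>' x = vars \<sigma> x" "X \<noteq> ''mk'' \<Longrightarrow> X \<noteq> ''par'' \<Longrightarrow> arrs \<sigma>' X = arrs \<sigma> X"
  using assms by (auto simp: unchanged_def spread_def spread_step_def)

context spine
begin

section \<open>Unlabelled cells as a potential\<close>

definition free :: "(nat \<Rightarrow> nat \<Rightarrow> nat) \<Rightarrow> nat" where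
  "free lab = card {(v, i). v < n \<and> i \<le> T \<and> lab v i = 0}"

lemma finite_free: "finite {(v, i). v < n \<and> i \<le> T \<and> lab v i = 0}"
  by (rule finite_subset[of _ "{..<n} \<times> {..T}"]) auto

lemma free_le: "free lab \<le> n * Suc T"
proof -
  have "free lab \<le> card ({..<n} \<times> {..T})"
    unfolding free_def by (rule card_mono) auto
  then show ?thesis by simp
qed

lemma free_upd:
  assumes "v < n" "i \<le> T" "lab v i = 0" "0 < a"
  shows "free lab = Suc (free (\<lambda>w j. if w = v \<and> j = i then a else lab w j))"
proof -
  let ?S = "{(w, j). w < n \<and> j \<le> T \<and> (if w = v \<and> j = i then a else lab w j) = 0}"
  have "{(w, j). w < n \<and> j \<le> T \<and> lab w j = 0} = insert (v, i) ?S"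
    using assms by (auto split: if_splits)
  moreover have "(v, i) \<notin> ?S" using assms by simp
  ultimately show ?thesis unfolding free_def using finite_free[of "\<lambda>w j. if w = v \<and> j = i then a else lab w j"]
    by simp
qed

text \<open>The state of a run in the middle of the loop of \<open>spread\<close>; at the exit it
  coincides with \<open>mark\<close>.\<close>

definition part :: "(nat \<Rightarrow> nat \<Rightarrow> nat) \<Rightarrow> nat \<Rightarrow> nat \<Rightarrow> nat \<Rightarrow> nat \<Rightarrow> nat \<Rightarrow> nat \<Rightarrow> nat" where
  "part X v i0 i a = (\<lambda>w j. if w = v \<and> i0 \<le> j \<and> j < i then a else X w j)"

lemma part_Suc: "i0 \<le> i \<Longrightarrow> (\<lambda>w j. if w = v \<and> j = i then a else part X v i0 i a w j) = part X v i0 (Suc i) a"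
  unfolding part_def by (auto simp: fun_eq_iff less_Suc_eq)

lemma fresh_part:
  assumes "i0 \<le> i" "i \<le> Suc T" "\<And>j. i0 \<le> j \<Longrightarrow> j < i \<Longrightarrow> lab v j = 0" "T < i \<or> lab v i \<noteq> 0"
  shows "fresh lab v i0 j \<longleftrightarrow> i0 \<le> j \<and> j < i"
proof
  assume f: "fresh lab v i0 j"
  show "i0 \<le> j \<and> j < i"
  proof (rule ccontr)
    assume "\<not> (i0 \<le> j \<and> j < i)"
    then have "i \<le> j" using f by (auto simp: fresh_def)
    then show False using f assms by (auto simp: fresh_def)
  qed
qed (use assms in \<open>auto simp: fresh_def\<close>)

definition ready :: "state \<Rightarrow> bool" where
  "ready \<sigma> \<longleftrightarrow> env \<sigma> \<and> vars \<sigma> ''N'' = N \<and> arrs \<sigma> ''xv'' = xv \<and> arrs \<sigma> ''xi'' = xi"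

lemma ready_cong:
  assumes "ready \<sigma>"
    and "vars \<sigma>' ''tau'' = vars \<sigma> ''tau'' \<and> vars \<sigma>' ''s'' = vars \<sigma> ''s'' \<and> vars \<sigma>' ''t'' = vars \<sigma> ''t'' \<and>
      vars \<sigma>' ''N'' = vars \<sigma> ''N'' \<and> vars \<sigma>' ''K'' = vars \<sigma> ''K''"
    and "arrs \<sigma>' ''off'' = arrs \<sigma> ''off'' \<and> arrs \<sigma>' ''au'' = arrs \<sigma> ''au'' \<and>
      arrs \<sigma>' ''ai'' = arrs \<sigma> ''ai'' \<and> arrs \<sigma>' ''av'' = arrs \<sigma> ''av'' \<and>
      arrs \<sigma>' ''xv'' = arrs \<sigma> ''xv'' \<and> arrs \<sigma>' ''xi'' = arrs \<sigma> ''xi''"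
  shows "ready \<sigma>'"
  using assms env_cong[of \<sigma> \<sigma>'] unfolding ready_def by simp

text \<open>The loop is paid by the cells that it labels, through the drop of \<open>free\<close>. A
  single run may be long, but a cell is labelled only once in the whole sweep.\<close>

lemma wp_spread:
  assumes e: "ready \<sigma>" and v: "vars \<sigma> ''v'' = v" "v < n" and i: "vars \<sigma> ''i'' = i" "i \<le> T"
    and a: "vars \<sigma> ''a'' = a" "0 < a"
    and lab: "grid T (arrs \<sigma> ''mk'') = lab" and par: "grid T (arrs \<sigma> ''par'') = par"
    and k: "30 + 60 * int (free lab) \<le> k"
    and Q: "\<And>\<sigma>' k'. unchanged spread \<sigma> \<sigma>' \<Longrightarrow> grid T (arrs \<sigma>' ''mk'') = mark lab v (Suc i) a \<Longrightarrow>
      grid T (arrs \<sigma>' ''par'') = mark_par par lab v (Suc i) v \<Longrightarrow>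
      k - 30 - 60 * int (free lab) + 60 * int (free (grid T (arrs \<sigma>' ''mk''))) \<le> k' \<Longrightarrow>
      free (grid T (arrs \<sigma>' ''mk'')) \<le> free lab \<Longrightarrow> Q \<sigma>' k'"
  shows "wp spread Q \<sigma> k"
proof (rule wp_frame)
  let ?R = "\<lambda>\<sigma>' k'. grid T (arrs \<sigma>' ''mk'') = mark lab v (Suc i) a \<and>
      grid T (arrs \<sigma>' ''par'') = mark_par par lab v (Suc i) v \<and>
      k - 30 - 60 * int (free lab) + 60 * int (free (grid T (arrs \<sigma>' ''mk''))) \<le> k' \<and>
      free (grid T (arrs \<sigma>' ''mk'')) \<le> free lab"
  let ?s = "\<lparr>vars = (vars \<sigma>)(''i'' := Suc i), arrs = arrs \<sigma>\<rparr>"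
  let ?b = "Conj (Less (Var ''i'') (Add (Var ''tau'') (Const 1))) (Equal (cell ''mk'' (Var ''v'') (Var ''i'')) (Const 0))"
  let ?I = "\<lambda>\<sigma>' k'. Suc i \<le> vars \<sigma>' ''i'' \<and> vars \<sigma>' ''i'' \<le> Suc T \<and>
     (\<forall>j. Suc i \<le> j \<longrightarrow> j < vars \<sigma>' ''i'' \<longrightarrow> lab v j = 0) \<and>
     grid T (arrs \<sigma>' ''mk'') = part lab v (Suc i) (vars \<sigma>' ''i'') a \<and>
     grid T (arrs \<sigma>' ''par'') = part par v (Suc i) (vars \<sigma>' ''i'') v \<and>
     k - 10 - 60 * int (free lab) + 60 * int (free (grid T (arrs \<sigma>' ''mk''))) \<le> k' \<and>
     free (grid T (arrs \<sigma>' ''mk'')) \<le> free lab"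
  have same: "part X v (Suc i) (Suc i) x = X" for X x unfolding part_def by (auto simp: fun_eq_iff)
  have frame: "env \<sigma>' \<and> vars \<sigma>' ''v'' = v \<and> vars \<sigma>' ''a'' = a \<and> arrs \<sigma>' ''off'' v = v * Suc T"
    if u: "unchanged spread_step ?s \<sigma>'" for \<sigma>'
  proof -
    have "env ?s" by (rule env_cong[of \<sigma>]) (use e in \<open>simp_all add: ready_def\<close>)
    then have "env \<sigma>'" by (rule env_unchanged[OF _ u]) (simp_all add: spread_step_def)
    moreover have "vars \<sigma>' ''v'' = v" "vars \<sigma>' ''a'' = a"
      using unchangedD(1)[OF u, of "''v''"] unchangedD(1)[OF u, of "''a''"] v a by (simp_all add: spread_step_def)
    ultimately show ?thesis using v unfolding env_def by blast
  qed
  have "wp (While ?b spread_step) ?R ?s (k - 4)"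
  proof (rule wp_loop[where I = ?I])
    show "?I ?s (k - 4)" using lab par i same by simp
  next
    fix \<sigma>' k'
    assume I: "?I \<sigma>' k'" and u: "unchanged spread_step ?s \<sigma>'" and b: "bval ?b \<sigma>'"
    let ?i = "vars \<sigma>' ''i''"
    note f = frame[OF u]
    have iT: "?i \<le> T" using b f unfolding env_def by simp
    have "grid T (arrs \<sigma>' ''mk'') v ?i = 0" using b f iT unfolding grid_def by simp
    then have z: "lab v ?i = 0" using I by (simp add: part_def)
    have gm: "grid T (arrs \<sigma>' ''mk'') = part lab v (Suc i) ?i a"
      "grid T (arrs \<sigma>' ''par'') = part par v (Suc i) ?i v" and le: "Suc i \<le> ?i" using I by blast+
    have g: "grid T ((arrs \<sigma>' ''mk'')(v * Suc T + ?i := a)) = part lab v (Suc i) (Suc ?i) a"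
      "grid T ((arrs \<sigma>' ''par'')(v * Suc T + ?i := v)) = part par v (Suc i) (Suc ?i) v"
      unfolding grid_upd[OF iT] gm by (rule part_Suc[OF le])+
    have fr: "free (part lab v (Suc i) ?i a) = Suc (free (part lab v (Suc i) (Suc ?i) a))"
      using free_upd[OF v(2) iT _ a(2), of "part lab v (Suc i) ?i a"] part_Suc[of "Suc i" ?i v a lab] z I
      by (simp add: part_def)
    have "\<forall>j. Suc i \<le> j \<longrightarrow> j < Suc ?i \<longrightarrow> lab v j = 0" using I z by (auto simp: less_Suc_eq)
    moreover have "k - 10 - 60 * int (free lab) + 60 * int (free (part lab v (Suc i) ?i a)) \<le> k'"
      "free (part lab v (Suc i) ?i a) \<le> free lab" using I unfolding gm(1) by blast+
    ultimately show "0 \<le> k' \<and> wp spread_step ?I \<sigma>' (k' - int (1 + bcost ?b))"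
      using le k f g fr iT unfolding spread_step_def by (simp add: wp_simps del: mult_Suc_right)
  next
    fix \<sigma>' k'
    assume I: "?I \<sigma>' k'" and u: "unchanged spread_step ?s \<sigma>'" and b: "\<not> bval ?b \<sigma>'"
    let ?i = "vars \<sigma>' ''i''"
    note f = frame[OF u]
    have "T < ?i \<or> grid T (arrs \<sigma>' ''mk'') v ?i \<noteq> 0" using b f unfolding grid_def env_def by auto
    then have "T < ?i \<or> lab v ?i \<noteq> 0" using I by (auto simp: part_def)
    then have fp: "fresh lab v (Suc i) j \<longleftrightarrow> Suc i \<le> j \<and> j < ?i" for j
      by (intro fresh_part) (use I in auto)
    have "part lab v (Suc i) ?i a = mark lab v (Suc i) a" "part par v (Suc i) ?i v = mark_par par lab v (Suc i) v"
      unfolding part_def mark_def mark_par_def fp by (auto simp: fun_eq_iff)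
    then show "?R \<sigma>' (k' - int (1 + bcost ?b))" using I by (elim conjE) simp
  qed
  then show "wp spread ?R \<sigma> k" unfolding spread_def using i by (simp add: wp_simps)
qed (use Q in blast)

text \<open>The head of an arc is labelled with a pointer to the tail and the remaining run by
  waiting; together they are a single \<open>mark\<close> that begins one time step earlier.\<close>

lemma mark_step:
  assumes "lab v i = 0" "i \<le> T"
  shows "mark (\<lambda>w j. if w = v \<and> j = i then a else lab w j) v (Suc i) a = mark lab v i a"
    and "mark_par (\<lambda>w j. if w = v \<and> j = i then u else par w j) (\<lambda>w j. if w = v \<and> j = i then a else lab w j) v (Suc i) v
      = mark_par par lab v i u"
proof -
  have f: "fresh lab v i j \<longleftrightarrow> j = i \<or> fresh (\<lambda>w j. if w = v \<and> j = i then a else lab w j) v (Suc i) j" for j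
  proof
    assume f: "fresh lab v i j"
    show "j = i \<or> fresh (\<lambda>w j. if w = v \<and> j = i then a else lab w j) v (Suc i) j"
      using f unfolding fresh_def by (cases "j = i") simp_all
  next
    assume d: "j = i \<or> fresh (\<lambda>w j. if w = v \<and> j = i then a else lab w j) v (Suc i) j"
    have "lab v j' = 0" if "i \<le> j'" "j' \<le> j" for j'
    proof (cases "j' = i")
      case False
      then have "fresh (\<lambda>w j. if w = v \<and> j = i then a else lab w j) v (Suc i) j" "Suc i \<le> j'"
        using d that by auto
      then show ?thesis using that False unfolding fresh_def by fastforce
    qed (use assms in simp)
    then show "fresh lab v i j" using d assms unfolding fresh_def by auto
  qed
  have "\<not> fresh (\<lambda>w j. if w = v \<and> j = i then a else lab w j) v (Suc i) i" unfolding fresh_def by simp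
  then show "mark (\<lambda>w j. if w = v \<and> j = i then a else lab w j) v (Suc i) a = mark lab v i a"
    and "mark_par (\<lambda>w j. if w = v \<and> j = i then u else par w j) (\<lambda>w j. if w = v \<and> j = i then a else lab w j) v (Suc i) v
      = mark_par par lab v i u"
    unfolding mark_def mark_par_def f by (auto simp: fun_eq_iff)
qed

definition state_inv :: "(nat \<Rightarrow> bool) \<Rightarrow> state \<Rightarrow> bool" where
  "state_inv col \<sigma> \<longleftrightarrow> inv (grid T (arrs \<sigma> ''mk'')) (grid T (arrs \<sigma> ''par'')) col
     (vars \<sigma> ''a'') (vars \<sigma> ''beta'') (vars \<sigma> ''best'') (vars \<sigma> ''bv'') (vars \<sigma> ''bi'')"

text \<open>
  A newly labelled temporal vertex pays for the repetition of the round that it causes and for one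
  step of propagation.
\<close>

definition sweep_inv :: "(nat \<Rightarrow> bool) \<Rightarrow> int \<Rightarrow> int \<Rightarrow> state \<Rightarrow> int \<Rightarrow> bool" where
  "sweep_inv col B W \<sigma> k \<longleftrightarrow> vars \<sigma> ''k'' \<le> vars \<sigma> ''K'' \<and> vars \<sigma> ''a'' < N \<and> state_inv col \<sigma> \<and>
     (vars \<sigma> ''ch'' = 0 \<longrightarrow> (\<forall>j < vars \<sigma> ''k''.
        grid T (arrs \<sigma> ''mk'') (arrs \<sigma> ''au'' j) (arrs \<sigma> ''ai'' j) = vars \<sigma> ''a'' \<longrightarrow>
        arrs \<sigma> ''av'' j \<noteq> xv (vars \<sigma> ''a'') \<longrightarrow>
        0 < grid T (arrs \<sigma> ''mk'') (arrs \<sigma> ''av'' j) (arrs \<sigma> ''ai'' j) \<and>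
        grid T (arrs \<sigma> ''mk'') (arrs \<sigma> ''av'' j) (arrs \<sigma> ''ai'' j) \<le> vars \<sigma> ''best'')) \<and>
     B + 200 * (int (vars \<sigma> ''K'') - int (vars \<sigma> ''k'')) + int (free (grid T (arrs \<sigma> ''mk''))) * (W + 60) +
       (if vars \<sigma> ''ch'' = 0 then 0 else W) \<le> k"

text \<open>\<open>f\<close>, \<open>f1\<close> and \<open>f2\<close> count the unlabelled cells
  before the step, after labelling the head of the arc, and after the run. The head releases the
  \<open>W\<close> for another round. The 200 units reserved for the arc cover the step itself, and
  the surplus \<open>W\<close> of every further cell of the run is given away.\<close>

lemma credit_mark:
  fixes B W K :: int
  assumes "B + 200 * K + int f * (W + 60) + c \<le> k" "f = Suc f1" "f2 \<le> f1" "0 \<le> W" "0 \<le> c"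
    "k - x - 30 - 60 * int f1 + 60 * int f2 \<le> k'" "x \<le> 150"
  shows "B + 200 * (K - 1) + int f2 * (W + 60) + W \<le> k' - 10"
proof -
  have f: "int f * (W + 60) = W + 60 + int f1 * (W + 60)" using assms(2) by (simp add: algebra_simps)
  have "0 \<le> (int f1 - int f2) * W" using assms(3,4) by simp
  then have "int f2 * W + 60 * int f2 \<le> int f1 * (W + 60) - 60 * int f1 + 60 * int f2"
    by (simp add: algebra_simps)
  then have "int f2 * (W + 60) \<le> int f1 * (W + 60) - 60 * int f1 + 60 * int f2"
    by (simp add: algebra_simps)
  moreover have "B + 200 * K + (W + 60 + int f1 * (W + 60)) + c \<le> k" using assms(1) unfolding f .
  moreover have "B + 200 * (K - 1) + q + W \<le> k' - 10"
    if "q \<le> p - 60 * a + 60 * b" "B + 200 * K + (W + 60 + p) + c \<le> k" "k - x - 30 - 60 * a + 60 * b \<le> k'"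
    for p q a b :: int
    using that assms(5,7) unfolding right_diff_distrib by linarith
  ultimately show ?thesis using assms(6) by blast
qed

lemma wp_sweep_step:
  assumes e: "ready \<sigma>" and I: "sweep_inv col B W \<sigma> k" and k: "vars \<sigma> ''k'' < vars \<sigma> ''K''" and W: "0 \<le> W" "0 \<le> B"
  shows "wp sweep_step (sweep_inv col B W) \<sigma> (k - 4)"
proof -
  let ?k = "vars \<sigma> ''k''" and ?a = "vars \<sigma> ''a''" and ?best = "vars \<sigma> ''best''"
  let ?u = "arrs \<sigma> ''au'' ?k" and ?v = "arrs \<sigma> ''av'' ?k" and ?i = "arrs \<sigma> ''ai'' ?k"
  define lab where "lab = grid T (arrs \<sigma> ''mk'')"
  define par where "par = grid T (arrs \<sigma> ''par'')"
  have tau: "vars \<sigma> ''tau'' = T" and xv: "arrs \<sigma> ''xv'' = xv" and off: "\<And>v. v < n \<Longrightarrow> arrs \<sigma> ''off'' v = v * Suc T"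
    and A: "arcs \<sigma> = A" using e unfolding ready_def env_def by auto
  have a: "(?u, ?i, ?v) \<in> A" using arcsI[OF k] A by simp
  then have i: "?u < n" "?v < n" "?i \<le> T" using arc by blast+
  have mk: "arrs \<sigma> ''mk'' (?u * Suc T + ?i) = lab ?u ?i" "arrs \<sigma> ''mk'' (?v * Suc T + ?i) = lab ?v ?i"
    using i by (simp_all add: lab_def grid_def)
  have N: "?a < N" and inv: "inv lab par col ?a (vars \<sigma> ''beta'') ?best (vars \<sigma> ''bv'') (vars \<sigma> ''bi'')"
    using I unfolding sweep_inv_def state_inv_def lab_def par_def by auto
  have a0: "0 < ?a" using inv L unfolding inv_def core_def by auto
  have cost: "B + 200 * (int (vars \<sigma> ''K'') - int ?k) + int (free lab) * (W + 60) + (if vars \<sigma> ''ch'' = 0 then 0 else W) \<le> k"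
    using I unfolding sweep_inv_def lab_def by blast
  consider (mark) "lab ?u ?i = ?a" "?v \<noteq> xv ?a" "lab ?v ?i = 0"
    | (event) "lab ?u ?i = ?a" "?v \<noteq> xv ?a" "lab ?v ?i \<noteq> 0" "?best < lab ?v ?i"
    | (old) "lab ?u ?i = ?a" "?v \<noteq> xv ?a" "lab ?v ?i \<noteq> 0" "\<not> ?best < lab ?v ?i"
    | (none) "\<not> (lab ?u ?i = ?a \<and> ?v \<noteq> xv ?a)"
    by blast
  then show ?thesis
  proof cases
    case mark
    let ?lab1 = "\<lambda>w j. if w = ?v \<and> j = ?i then ?a else lab w j"
    let ?par1 = "\<lambda>w j. if w = ?v \<and> j = ?i then ?u else par w j"
    have g1: "grid T ((arrs \<sigma> ''mk'')(?v * Suc T + ?i := ?a)) = ?lab1"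
      "grid T ((arrs \<sigma> ''par'')(?v * Suc T + ?i := ?u)) = ?par1"
      unfolding grid_upd[OF i(3)] lab_def par_def by simp_all
    note fr = free_upd[where lab = lab and a = ?a, OF i(2,3) mark(3) a0]
    note inv' = inv_mark[OF inv N a mark]
    have big: "30 + 60 * int (free ?lab1) \<le> k - x" if "x \<le> 150" for x
    proof -
      have "0 \<le> int (free ?lab1) * W" "0 \<le> (if vars \<sigma> ''ch'' = 0 then 0 else W)" using W by simp_all
      moreover have "int (free lab) * (W + 60) = int (free ?lab1) * W + 60 * int (free ?lab1) + W + 60"
        using fr by (simp add: algebra_simps)
      moreover have "200 \<le> 200 * (int (vars \<sigma> ''K'') - int ?k)" using k by simp
      moreover have "30 + f \<le> k - x"
        if "0 \<le> p" "0 \<le> c" "q = p + f + W + 60" "200 \<le> d" "B + d + q + c \<le> k" for p q c d f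
        using that W \<open>x \<le> 150\<close> by linarith
      ultimately show ?thesis using cost by blast
    qed
    have fin: "sweep_inv col B W \<lparr>vars = (vars \<sigma>')(''k'' := Suc ?k), arrs = arrs \<sigma>'\<rparr> (k' - 4)"
      if "vars \<sigma>' ''K'' = vars \<sigma> ''K''" "vars \<sigma>' ''a'' = ?a" "vars \<sigma>' ''beta'' = vars \<sigma> ''beta''"
        "vars \<sigma>' ''best'' = ?best" "vars \<sigma>' ''bv'' = vars \<sigma> ''bv''" "vars \<sigma>' ''bi'' = vars \<sigma> ''bi''" "vars \<sigma>' ''ch'' \<noteq> 0"
        "grid T (arrs \<sigma>' ''mk'') = mark ?lab1 ?v (Suc ?i) ?a"
        "grid T (arrs \<sigma>' ''par'') = mark_par ?par1 ?lab1 ?v (Suc ?i) ?v"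
        "k - x - 30 - 60 * int (free ?lab1) + 60 * int (free (grid T (arrs \<sigma>' ''mk''))) \<le> k'"
        "free (grid T (arrs \<sigma>' ''mk'')) \<le> free ?lab1" "x \<le> 150" for \<sigma>' k' x
    proof -
      have "B + 200 * ((int (vars \<sigma> ''K'') - int ?k) - 1) + int (free (grid T (arrs \<sigma>' ''mk''))) * (W + 60) + W \<le> k' - 10"
        by (rule credit_mark[OF cost fr that(11) W(1) _ that(10,12)]) (use W in simp)
      moreover have "state_inv col \<lparr>vars = (vars \<sigma>')(''k'' := Suc ?k), arrs = arrs \<sigma>'\<rparr>"
        using inv' that(1-9) mark_step[of lab ?v ?i, OF mark(3) i(3)] unfolding state_inv_def by simp
      ultimately show ?thesis using that N k unfolding sweep_inv_def by (simp add: algebra_simps)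
    qed
    let ?s = "\<lparr>vars = (vars \<sigma>)(''u'' := ?u, ''i'' := ?i, ''v'' := ?v, ''ch'' := Suc 0),
      arrs = (arrs \<sigma>)(''mk'' := (arrs \<sigma> ''mk'')(?v * Suc T + ?i := ?a), ''par'' := (arrs \<sigma> ''par'')(?v * Suc T + ?i := ?u))\<rparr>"
    have "wp spread (wp (Assign ''k'' (Add (Var ''k'') (Const (Suc 0)))) (sweep_inv col B W)) ?s (k - x)"
      if x: "x \<le> 150" for x
    proof (rule wp_spread)
      show "ready ?s" by (rule ready_cong[OF e]; simp)
      show "30 + 60 * int (free ?lab1) \<le> k - x" by (rule big[OF x])
      fix \<sigma>' k'
      assume u: "unchanged spread ?s \<sigma>'" and g: "grid T (arrs \<sigma>' ''mk'') = mark ?lab1 ?v (Suc ?i) ?a"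
        "grid T (arrs \<sigma>' ''par'') = mark_par ?par1 ?lab1 ?v (Suc ?i) ?v"
        "k - x - 30 - 60 * int (free ?lab1) + 60 * int (free (grid T (arrs \<sigma>' ''mk''))) \<le> k'"
        "free (grid T (arrs \<sigma>' ''mk'')) \<le> free ?lab1"
      have "sweep_inv col B W \<lparr>vars = (vars \<sigma>')(''k'' := Suc ?k), arrs = arrs \<sigma>'\<rparr> (k' - 4)"
        by (rule fin[OF _ _ _ _ _ _ _ g x]) (simp_all add: unchanged_spread[OF u])
      then show "wp (Assign ''k'' (Add (Var ''k'') (Const (Suc 0)))) (sweep_inv col B W) \<sigma>' k'"
        by (simp add: wp_simps unchanged_spread[OF u])
    qed (simp_all add: i a0 g1 del: mult_Suc_right)
    then show ?thesis
      unfolding sweep_step_def wp_Seq_fun by (simp add: wp_simps off i mk xv mark del: mult_Suc_right)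
  next
    case event
    have "state_inv col \<lparr>vars = (vars \<sigma>)(''u'' := ?u, ''i'' := ?i, ''v'' := ?v, ''best'' := lab ?v ?i, ''bv'' := ?u, ''bi'' := ?i, ''k'' := Suc ?k), arrs = arrs \<sigma>\<rparr>"
      using inv_event[OF inv N a event(1,2,4)] unfolding state_inv_def lab_def par_def by simp
    then show ?thesis using cost k N I event
      unfolding sweep_step_def sweep_inv_def
      by (auto simp: wp_simps off i mk xv lab_def[symmetric] less_Suc_eq simp del: mult_Suc_right)
  next
    case old
    have "state_inv col \<lparr>vars = (vars \<sigma>)(''u'' := ?u, ''i'' := ?i, ''v'' := ?v, ''k'' := Suc ?k), arrs = arrs \<sigma>\<rparr>"
      using inv unfolding state_inv_def lab_def par_def by simp
    then show ?thesis using cost k N I old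
      unfolding sweep_step_def sweep_inv_def
      by (auto simp: wp_simps off i mk xv lab_def[symmetric] less_Suc_eq simp del: mult_Suc_right)
  next
    case none
    have "state_inv col \<lparr>vars = (vars \<sigma>)(''u'' := ?u, ''i'' := ?i, ''v'' := ?v, ''k'' := Suc ?k), arrs = arrs \<sigma>\<rparr>"
      using inv unfolding state_inv_def lab_def par_def by simp
    then show ?thesis using cost k N I none
      unfolding sweep_step_def sweep_inv_def
      by (auto simp: wp_simps off i mk xv lab_def[symmetric] less_Suc_eq simp del: mult_Suc_right)
  qed
qed

end

section \<open>The end of a round, of a phase and of the sweep\<close>

context spine
begin

definition stuck :: bool where
  "stuck \<longleftrightarrow> (\<exists>x i. x \<noteq> s \<and> x \<noteq> t \<and> (\<forall>P. npath P \<longrightarrow> (x, i) \<in> temporal_verts P))"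

text \<open>There is no phase \<open>N\<close>. When the sweep has run past the last position, the
  invariant of phase \<open>N - 1\<close> is kept for reading off the two paths.\<close>

definition sound :: "state \<Rightarrow> bool" where
  "sound \<sigma> \<longleftrightarrow>
     vars \<sigma> ''fail'' = 0 \<and> (vars \<sigma> ''a'' < N \<and> (\<exists>col. state_inv col \<sigma>) \<or>
       vars \<sigma> ''a'' = N \<and> (\<exists>col. inv (grid T (arrs \<sigma> ''mk'')) (grid T (arrs \<sigma> ''par'')) col (N - 1)
         (vars \<sigma> ''beta'') (vars \<sigma> ''best'') (vars \<sigma> ''bv'') (vars \<sigma> ''bi''))) \<or>
     vars \<sigma> ''fail'' = 1 \<and> stuck"

lemma wp_advance:
  assumes e: "ready \<sigma>" and xiN: "xi N \<le> T" and I: "state_inv col \<sigma>" and a: "vars \<sigma> ''a'' = a" "a < N"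
    and f: "vars \<sigma> ''fail'' = 0" and m: "moved (grid T (arrs \<sigma> ''mk'')) (vars \<sigma> ''best'') (Suc a)"
    and k: "150 + 60 * int (free (grid T (arrs \<sigma> ''mk''))) \<le> k"
  shows "wp advance (\<lambda>\<sigma>' k'. sound \<sigma>' \<and> vars \<sigma>' ''a'' = Suc a \<and>
    k - 150 - 60 * int (free (grid T (arrs \<sigma> ''mk''))) + 60 * int (free (grid T (arrs \<sigma>' ''mk''))) \<le> k' \<and>
    free (grid T (arrs \<sigma>' ''mk'')) \<le> free (grid T (arrs \<sigma> ''mk''))) \<sigma> k" (is "wp _ ?R _ _")
proof -
  define lab where "lab = grid T (arrs \<sigma> ''mk'')"
  define par where "par = grid T (arrs \<sigma> ''par'')"
  let ?beta = "vars \<sigma> ''beta''" and ?best = "vars \<sigma> ''best''" and ?bv = "vars \<sigma> ''bv''" and ?bi = "vars \<sigma> ''bi''"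
  have inv: "inv lab par col a ?beta ?best ?bv ?bi" using I a unfolding state_inv_def lab_def par_def by simp
  then have b: "a < ?beta" "?beta \<le> ?best" "?best \<le> N" "L \<le> a" unfolding inv_def core_def by auto
  note m = m[folded lab_def] and k = k[folded lab_def]
  have N: "vars \<sigma> ''N'' = N" and xv: "arrs \<sigma> ''xv'' = xv" "arrs \<sigma> ''xi'' = xi"
    and off: "\<And>v. v < n \<Longrightarrow> arrs \<sigma> ''off'' v = v * Suc T" using e unfolding ready_def env_def by auto
  have sp: "wp spread ?R \<tau> (k - x)"
    if x: "x \<le> 100" and r: "ready \<tau>" and v: "vars \<tau> ''v'' = xv (Suc a)" "vars \<tau> ''i'' = xi (Suc a)" "vars \<tau> ''a'' = Suc a"
      "vars \<tau> ''fail'' = 0" and g: "grid T (arrs \<tau> ''mk'') = lab" "grid T (arrs \<tau> ''par'') = par2"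
      and R: "arrived lab par2 col2 (Suc a) (vars \<tau> ''beta'') (vars \<tau> ''best'') (vars \<tau> ''bv'') (vars \<tau> ''bi'')"
    for \<tau> x par2 col2
  proof (rule wp_spread[OF r v(1) _ v(2) _ v(3) _ g])
    have a': "L < Suc a" "Suc a < N" using R unfolding arrived_def by auto
    show "xv (Suc a) < n" "xi (Suc a) \<le> T" "0 < Suc a" using X1[OF a'] by auto
    show "30 + 60 * int (free lab) \<le> k - x" using k x by simp
    fix \<sigma>' k'
    assume u: "unchanged spread \<tau> \<sigma>'"
      and g': "grid T (arrs \<sigma>' ''mk'') = mark lab (xv (Suc a)) (Suc (xi (Suc a))) (Suc a)"
        "grid T (arrs \<sigma>' ''par'') = mark_par par2 lab (xv (Suc a)) (Suc (xi (Suc a))) (xv (Suc a))"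
      and c: "k - x - 30 - 60 * int (free lab) + 60 * int (free (grid T (arrs \<sigma>' ''mk''))) \<le> k'"
        "free (grid T (arrs \<sigma>' ''mk'')) \<le> free lab"
    have "state_inv col2 \<sigma>'"
      using inv_start[OF R] v unfolding state_inv_def g' by (simp add: unchanged_spread[OF u])
    then have "sound \<sigma>'" using v a' unfolding sound_def by (auto simp: unchanged_spread[OF u])
    then show "?R \<sigma>' k'" using c x v unfolding lab_def[symmetric] by (simp add: unchanged_spread[OF u])
  qed
  consider (last) "Suc a = N" | (fail) "Suc a < N" "Suc a = ?beta" "?best = ?beta"
    | (jump) "Suc a < N" "Suc a = ?beta" "?beta < ?best" | (along) "Suc a < N" "Suc a \<noteq> ?beta"
    using a b by linarith
  then show ?thesis
  proof cases
    case last
    then have "sound \<lparr>vars = (vars \<sigma>)(''a'' := Suc a), arrs = arrs \<sigma>\<rparr>"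
      using inv f unfolding sound_def lab_def par_def by auto
    then show ?thesis using last a N unfolding advance_def by (simp add: wp_simps)
  next
    case fail
    have "stuck"
      unfolding stuck_def
      using inv_cut[OF inv m fail(2)] fail X1[of ?beta] b by (metis le_imp_less_Suc)
    then have "sound \<lparr>vars = (vars \<sigma>)(''a'' := Suc a, ''fail'' := Suc 0), arrs = arrs \<sigma>\<rparr>"
      unfolding sound_def by simp
    then show ?thesis using fail a N unfolding advance_def by (simp add: wp_simps)
  next
    case jump
    \<comment> \<open>For \<open>best = N\<close> this is a dummy cell in the row of
      \<open>t\<close>, for which \<open>xiN\<close> guarantees a valid address.\<close>
    let ?x = "xv ?best" and ?y = "xi ?best"
    have xy: "?x < n" "?y \<le> T" using X1[of ?best] xN xiN t b jump by (cases "?best = N"; simp)+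
    let ?par2 = "\<lambda>v i. if v = ?x \<and> i = ?y then ?bv else par v i"
    have g: "grid T ((arrs \<sigma> ''par'')(?x * Suc T + ?y := ?bv)) = ?par2"
      unfolding grid_upd[OF xy(2)] par_def by simp
    have R: "arrived lab ?par2 (col(?beta := \<not> col a)) (Suc a) ?best ?best ?bv ?bi"
      using arrived_at_jump[OF inv m jump refl] unfolding jump(2) .
    have "wp spread ?R \<lparr>vars = (vars \<sigma>)(''a'' := ?beta, ''beta'' := ?best, ''v'' := xv ?beta, ''i'' := xi ?beta),
        arrs = (arrs \<sigma>)(''par'' := (arrs \<sigma> ''par'')(?x * Suc T + ?y := ?bv))\<rparr> (k - x)" if "x \<le> 100" for x
      by (rule sp[OF that, of _ ?par2 "col(?beta := \<not> col a)"])
         (use R f lab_def jump(2) g in \<open>simp_all add: ready_cong[OF e] del: mult_Suc_right\<close>)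
    then show ?thesis using jump a N xy off xv unfolding advance_def
      by (simp add: wp_simps del: mult_Suc_right)
  next
    case along
    have R: "arrived lab par (col(Suc a := col a)) (Suc a) ?beta ?best ?bv ?bi"
      using arrived_along_spine[OF inv m along] .
    have "wp spread ?R \<lparr>vars = (vars \<sigma>)(''a'' := Suc a, ''v'' := xv (Suc a), ''i'' := xi (Suc a)),
        arrs = arrs \<sigma>\<rparr> (k - x)" if "x \<le> 100" for x
      by (rule sp[OF that, of _ par "col(Suc a := col a)"])
         (use R f in \<open>simp_all add: ready_cong[OF e] lab_def par_def\<close>)
    then show ?thesis using along a N xv unfolding advance_def
      by (simp add: wp_simps)
  qed
qed

lemma ready_sweep_step:
  assumes "ready \<sigma>" "unchanged sweep_step \<sigma> \<sigma>'"
  shows "ready \<sigma>' \<and> vars \<sigma>' ''a'' = vars \<sigma> ''a'' \<and> vars \<sigma>' ''fail'' = vars \<sigma> ''fail''"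
proof -
  have u: "vars \<sigma>' x = vars \<sigma> x" if "x \<notin> {''u'', ''i'', ''v'', ''ch'', ''best'', ''bv'', ''bi'', ''k''}" for x
    by (rule unchangedD(1)[OF assms(2)]) (use that in \<open>simp add: sweep_step_def spread_def spread_step_def\<close>)
  have u': "arrs \<sigma>' X = arrs \<sigma> X" if "X \<noteq> ''mk''" "X \<noteq> ''par''" for X
    by (rule unchangedD(2)[OF assms(2)]) (use that in \<open>simp add: sweep_step_def spread_def spread_step_def\<close>)
  show ?thesis using ready_cong[OF assms(1), of \<sigma>'] u u' by simp
qed

text \<open>If \<open>ch\<close> is still 0 after the scan, no label has changed meanwhile, so the
  observations made at one arc after the other hold simultaneously. \<open>best\<close> may have
  grown, but this only weakens them. They say that phase \<open>a\<close> is complete.\<close>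

lemma wp_sweep_round:
  assumes e: "ready \<sigma>" and xiN: "xi N \<le> T" and I: "state_inv col \<sigma>" and a: "vars \<sigma> ''a'' = a" "a < N"
    and f: "vars \<sigma> ''fail'' = 0" and W: "W = 200 * int (vars \<sigma> ''K'') + 300" and B: "0 \<le> B"
    and k: "B + W + int (free (grid T (arrs \<sigma> ''mk''))) * (W + 60) \<le> k"
  shows "wp sweep_round (\<lambda>\<sigma>' k'. sound \<sigma>' \<and>
    (vars \<sigma>' ''a'' = a \<and> B + W + int (free (grid T (arrs \<sigma>' ''mk''))) * (W + 60) \<le> k' \<or>
     vars \<sigma>' ''a'' = Suc a \<and> B + int (free (grid T (arrs \<sigma>' ''mk''))) * (W + 60) \<le> k')) \<sigma> (k - 8)"
    (is "wp _ ?R _ _")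
proof -
  let ?s = "\<lparr>vars = (vars \<sigma>)(''ch'' := 0, ''k'' := 0), arrs = arrs \<sigma>\<rparr>"
  let ?fin = "Cond (Equal (Var ''ch'') (Const 0)) advance Skip"
  have W0: "0 \<le> W" using W by simp
  have es: "ready ?s" by (rule ready_cong[OF e]; simp)
  have "wp (While (Less (Var ''k'') (Var ''K'')) sweep_step) (wp ?fin ?R) ?s (k - 12)"
  proof (rule wp_loop[where I = "sweep_inv col (B + 200) W"])
    show "sweep_inv col (B + 200) W ?s (k - 12)"
      using I k W a unfolding sweep_inv_def state_inv_def by simp
  next
    fix \<sigma>' k'
    assume I: "sweep_inv col (B + 200) W \<sigma>' k'" and u: "unchanged sweep_step ?s \<sigma>'"
      and c: "bval (Less (Var ''k'') (Var ''K'')) \<sigma>'"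
    have e': "ready \<sigma>'" using ready_sweep_step[OF es u] by blast
    have "(B + 200) + 200 * (int (vars \<sigma>' ''K'') - int (vars \<sigma>' ''k'')) + int (free (grid T (arrs \<sigma>' ''mk''))) * (W + 60) +
       (if vars \<sigma>' ''ch'' = 0 then 0 else W) \<le> k'"
      using I unfolding sweep_inv_def by blast
    moreover have "0 \<le> int (free (grid T (arrs \<sigma>' ''mk''))) * (W + 60)" "0 \<le> (if vars \<sigma>' ''ch'' = 0 then 0 else W)"
      "0 \<le> 200 * (int (vars \<sigma>' ''K'') - int (vars \<sigma>' ''k''))" using W0 c by simp_all
    moreover have "0 \<le> l" if "(B + 200) + x + y + z \<le> l" "0 \<le> x" "0 \<le> y" "0 \<le> z" for x y z l
      using that B by linarith
    ultimately have "0 \<le> k'" by blast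
    then show "0 \<le> k' \<and> wp sweep_step (sweep_inv col (B + 200) W) \<sigma>' (k' - int (1 + bcost (Less (Var ''k'') (Var ''K''))))"
      using wp_sweep_step[OF e' I _ W0] c B by simp
  next
    fix \<sigma>' k'
    assume I: "sweep_inv col (B + 200) W \<sigma>' k'" and u: "unchanged sweep_step ?s \<sigma>'"
      and c: "\<not> bval (Less (Var ''k'') (Var ''K'')) \<sigma>'"
    have e': "ready \<sigma>'" and a': "vars \<sigma>' ''a'' = a" and f': "vars \<sigma>' ''fail'' = 0"
      using ready_sweep_step[OF es u] a f by auto
    let ?lab = "grid T (arrs \<sigma>' ''mk'')"
    have inv: "state_inv col \<sigma>'" and K: "vars \<sigma>' ''k'' = vars \<sigma>' ''K''"
      using I c unfolding sweep_inv_def by auto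
    have cost: "B + 200 + int (free ?lab) * (W + 60) + (if vars \<sigma>' ''ch'' = 0 then 0 else W) \<le> k'"
      using I K unfolding sweep_inv_def by simp
    show "wp ?fin ?R \<sigma>' (k' - int (1 + bcost (Less (Var ''k'') (Var ''K''))))"
    proof (cases "vars \<sigma>' ''ch'' = 0")
      case False
      have "sound \<sigma>'" using inv a a' f' unfolding sound_def by auto
      then show ?thesis using False a' cost by (simp add: wp_simps)
    next
      case True
      have m: "moved ?lab (vars \<sigma>' ''best'') (Suc a)"
      proof (rule moved_Suc)
        show "inv ?lab (grid T (arrs \<sigma>' ''par'')) col a (vars \<sigma>' ''beta'') (vars \<sigma>' ''best'') (vars \<sigma>' ''bv'') (vars \<sigma>' ''bi'')"
          using inv a' unfolding state_inv_def by simp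
        fix u i v assume h: "(u, i, v) \<in> A" "?lab u i = a" "v \<noteq> xv a"
        then obtain j where "j < vars \<sigma>' ''k''" "u = arrs \<sigma>' ''au'' j" "i = arrs \<sigma>' ''ai'' j" "v = arrs \<sigma>' ''av'' j"
          using e' K unfolding ready_def env_def arcs_def by auto
        then show "0 < ?lab v i \<and> ?lab v i \<le> vars \<sigma>' ''best''"
          using I True h a' unfolding sweep_inv_def by simp
      qed
      define x where "x = k' - 8"
      have f0: "int (free ?lab) * (W + 60) = int (free ?lab) * W + 60 * int (free ?lab)" by (simp add: algebra_simps)
      have fW: "0 \<le> int (free ?lab) * W" using W0 by simp
      have "B + 192 + int (free ?lab) * W + 60 * int (free ?lab) \<le> x" using cost True f0 unfolding x_def by simp
      moreover have "150 + f \<le> x" if "B + 192 + p + f \<le> x" "0 \<le> p" for p f using that B by linarith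
      ultimately have "150 + 60 * int (free ?lab) \<le> x" using fW by blast
      have "wp advance ?R \<sigma>' x"
      proof (rule wp_mono[OF wp_advance[OF e' xiN inv a' a(2) f' m]])
        show "150 + 60 * int (free ?lab) \<le> x" by fact
        fix \<sigma>'' :: state and k'' :: int
        let ?f = "free (grid T (arrs \<sigma>'' ''mk''))"
        assume h: "sound \<sigma>'' \<and> vars \<sigma>'' ''a'' = Suc a \<and>
          x - 150 - 60 * int (free ?lab) + 60 * int ?f \<le> k'' \<and> ?f \<le> free ?lab"
        have "int ?f * W \<le> int (free ?lab) * W" using h W0 by (intro mult_right_mono) auto
        moreover have "int ?f * (W + 60) = int ?f * W + 60 * int ?f" by (simp add: algebra_simps)
        moreover have "B + r \<le> k''" if "p \<le> q" "r = p + b" "B + 192 + q + c \<le> x" "x - 150 - c + b \<le> k''" for p q r b c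
          using that by linarith
        ultimately have "B + int ?f * (W + 60) \<le> k''"
          using h \<open>B + 192 + int (free ?lab) * W + 60 * int (free ?lab) \<le> x\<close> by blast
        then show "?R \<sigma>'' k''" using h by blast
      qed
      then show ?thesis using True unfolding x_def by (simp add: wp_simps)
    qed
  qed
  then show ?thesis unfolding sweep_round_def wp_Seq_fun by (simp add: wp_simps)
qed

lemma ready_sweep_round:
  assumes "ready \<sigma>" "unchanged sweep_round \<sigma> \<sigma>'"
  shows "ready \<sigma>'"
proof -
  have u: "vars \<sigma>' x = vars \<sigma> x"
    if "x \<notin> {''u'', ''i'', ''v'', ''ch'', ''best'', ''bv'', ''bi'', ''k'', ''a'', ''beta'', ''fail''}" for x
    by (rule unchangedD(1)[OF assms(2)])
       (use that in \<open>simp add: sweep_round_def advance_def sweep_step_def spread_def spread_step_def\<close>)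
  have u': "arrs \<sigma>' X = arrs \<sigma> X" if "X \<noteq> ''mk''" "X \<noteq> ''par''" for X
    by (rule unchangedD(2)[OF assms(2)])
       (use that in \<open>simp add: sweep_round_def advance_def sweep_step_def spread_def spread_step_def\<close>)
  show ?thesis using ready_cong[OF assms(1), of \<sigma>'] u u' by simp
qed

text \<open>A round that does not advance has labelled at least one cell. The rounds are thus paid
  by the unlabelled cells together with the remaining positions.\<close>

lemma wp_sweep_loop:
  assumes e: "ready \<sigma>" and xiN: "xi N \<le> T" and I: "sound \<sigma>" and a: "vars \<sigma> ''a'' \<le> N"
    and W: "W = 200 * int (vars \<sigma> ''K'') + 300" and B: "0 \<le> B"
    and k: "B + 20 + int (free (grid T (arrs \<sigma> ''mk''))) * (W + 60) + (int N - int (vars \<sigma> ''a'')) * W \<le> k"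
    and Q: "\<And>\<sigma>' k'. unchanged sweep_round \<sigma> \<sigma>' \<Longrightarrow> sound \<sigma>' \<Longrightarrow> vars \<sigma>' ''a'' = N \<or> vars \<sigma>' ''fail'' \<noteq> 0 \<Longrightarrow>
      B \<le> k' \<Longrightarrow> Q \<sigma>' k'"
  shows "wp (While (Conj (Less (Var ''a'') (Var ''N'')) (Equal (Var ''fail'') (Const 0))) sweep_round) Q \<sigma> k"
proof -
  let ?b = "Conj (Less (Var ''a'') (Var ''N'')) (Equal (Var ''fail'') (Const 0))"
  have W0: "0 \<le> W" using W by simp
  let ?I = "\<lambda>\<sigma>' k'. sound \<sigma>' \<and> vars \<sigma>' ''a'' \<le> N \<and>
    B + 20 + int (free (grid T (arrs \<sigma>' ''mk''))) * (W + 60) + (int N - int (vars \<sigma>' ''a'')) * W \<le> k'"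
  show ?thesis
  proof (rule wp_loop[where I = ?I])
    fix \<sigma>' k'
    assume I: "?I \<sigma>' k'" and u: "unchanged sweep_round \<sigma> \<sigma>'" and b: "bval ?b \<sigma>'"
    have e': "ready \<sigma>'" using ready_sweep_round[OF e u] .
    have K: "vars \<sigma>' ''K'' = vars \<sigma> ''K''"
      by (rule unchangedD(1)[OF u]) (simp add: sweep_round_def advance_def sweep_step_def spread_def spread_step_def)
    have aN: "vars \<sigma>' ''a'' < N" and f: "vars \<sigma>' ''fail'' = 0" using b e' unfolding ready_def by auto
    then obtain col where inv: "state_inv col \<sigma>'" using I unfolding sound_def by auto
    define r where "r = (int N - int (vars \<sigma>' ''a'') - 1) * W"
    have r0: "0 \<le> r" using aN W0 unfolding r_def by simp
    have rW: "(int N - int (vars \<sigma>' ''a'')) * W = r + W" unfolding r_def by (simp add: algebra_simps)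
    have kk: "(B + 20 + r) + W + int (free (grid T (arrs \<sigma>' ''mk''))) * (W + 60) \<le> k'"
      using I unfolding rW by simp
    have "0 \<le> int (free (grid T (arrs \<sigma>' ''mk''))) * (W + 60)" using W0 by simp
    moreover have "0 \<le> k'" if "(B + 20 + r) + W + x \<le> k'" "0 \<le> x" for x using that r0 B W0 by linarith
    ultimately have k0: "0 \<le> k'" using kk by blast
    have "wp sweep_round ?I \<sigma>' (k' - 8)"
    proof (rule wp_mono[OF wp_sweep_round[OF e' xiN inv refl aN f _ _ kk]])
      show "W = 200 * int (vars \<sigma>' ''K'') + 300" using W K by simp
      show "0 \<le> B + 20 + r" using B r0 by simp
      fix \<sigma>'' :: state and k'' :: int
      let ?f = "int (free (grid T (arrs \<sigma>'' ''mk''))) * (W + 60)"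
      assume h: "sound \<sigma>'' \<and> (vars \<sigma>'' ''a'' = vars \<sigma>' ''a'' \<and> B + 20 + r + W + ?f \<le> k'' \<or>
          vars \<sigma>'' ''a'' = Suc (vars \<sigma>' ''a'') \<and> B + 20 + r + ?f \<le> k'')"
      moreover have "(int N - int (Suc (vars \<sigma>' ''a''))) * W = r" unfolding r_def by (simp add: algebra_simps)
      ultimately show "?I \<sigma>'' k''" using aN rW by auto
    qed
    then show "0 \<le> k' \<and> wp sweep_round ?I \<sigma>' (k' - int (1 + bcost ?b))" using k0 by simp
  next
    fix \<sigma>' k'
    assume I: "?I \<sigma>' k'" and u: "unchanged sweep_round \<sigma> \<sigma>'" and b: "\<not> bval ?b \<sigma>'"
    have e': "ready \<sigma>'" using ready_sweep_round[OF e u] .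
    have "vars \<sigma>' ''a'' = N \<or> vars \<sigma>' ''fail'' \<noteq> 0" using b e' I unfolding ready_def by auto
    moreover have "0 \<le> int (free (grid T (arrs \<sigma>' ''mk''))) * (W + 60)" "0 \<le> (int N - int (vars \<sigma>' ''a'')) * W"
      using W0 I by simp_all
    moreover have "B \<le> k' - 8" if "B + 20 + x + y \<le> k'" "0 \<le> x" "0 \<le> y" for x y using that by linarith
    ultimately show "Q \<sigma>' (k' - int (1 + bcost ?b))" using I by (intro Q[OF u]) auto
  qed (use I a k in blast)
qed

lemma laid_inv:
  assumes l: "laid L N xv xi lab par" and best: "best = Suc L \<and> D = {} \<or> best = N \<and> bv = s \<and> bi \<in> D"
  shows "inv lab par col L (Suc L) best bv bi"
proof -
  have l1: "\<And>j. j \<le> T \<Longrightarrow> lab s j = L" "\<And>j. j \<le> T \<Longrightarrow> lab t j = N" "\<And>c. L < c \<Longrightarrow> c < N \<Longrightarrow> lab (xv c) (xi c) = c"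
    and l2: "\<And>v i. 0 < lab v i \<Longrightarrow> i \<le> T \<and> (v = s \<or> v = t \<or> (\<exists>c. L < c \<and> c < N \<and> xv c = v \<and> xi c = i))"
    and l3: "\<And>c. L \<le> c \<Longrightarrow> Suc c < N \<Longrightarrow> par (xv (Suc c)) (xi (Suc c)) = xv c"
    using l unfolding laid_def by blast+
  have only: "v = s \<or> v = t \<or> on_spine lab v i \<and> v < n \<and> 0 < arr v \<and> arr v \<le> i" if p: "0 < lab v i" for v i
  proof (cases "v = s \<or> v = t")
    case False
    then obtain c where "L < c" "c < N" "xv c = v" "xi c = i" using l2[OF p] by blast
    then show ?thesis using l1(3)[of c] X1[of c] unfolding on_spine_def by auto
  qed blast
  have "labelled lab L"
    unfolding labelled_def
  proof (intro conjI allI impI)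
    fix v i assume "T < i"
    then show "lab v i = 0" using l2[of v i] by (cases "lab v i = 0") auto
  qed (use l1 only in blast)+
  then show ?thesis using inv_init[OF _ _ l3 best] only by blast
qed

lemma wp_sweep:
  assumes e: "ready \<sigma>" and xiN: "xi N \<le> T" and c: "vars \<sigma> ''c'' = L"
    and l: "laid L N xv xi (grid T (arrs \<sigma> ''mk'')) (grid T (arrs \<sigma> ''par''))"
    and d: "vars \<sigma> ''d'' = 0 \<and> D = {} \<or> vars \<sigma> ''d'' \<noteq> 0 \<and> vars \<sigma> ''d1'' \<in> D"
    and W: "W = 200 * int (vars \<sigma> ''K'') + 300"
    and k: "100 + int (n * Suc T) * (W + 60) + int N * W \<le> k"
    and Q: "\<And>\<sigma>' k'. unchanged sweep \<sigma> \<sigma>' \<Longrightarrow>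
      vars \<sigma>' ''fail'' = 0 \<and> (\<exists>vs ts Z vs' ts' Z'.
          tr (grid T (arrs \<sigma>' ''par'')) (vars \<sigma>' ''bv'') (vars \<sigma>' ''bi'') vs ts Z \<and>
          (vars \<sigma>' ''bv'', vars \<sigma>' ''bi'', t) \<in> AF \<and> t \<notin> set vs \<and>
          tr (grid T (arrs \<sigma>' ''par'')) (xv (N - 1)) (xi (N - 1)) vs' ts' Z' \<and>
          (xv (N - 1), xi (N - 1), t) \<in> AF \<and> t \<notin> set vs' \<and> Z \<inter> Z' = {} \<and> Z' \<noteq> {}) \<or>
      vars \<sigma>' ''fail'' = 1 \<and> stuck \<Longrightarrow>
      k - 100 - int (n * Suc T) * (W + 60) - int N * W \<le> k' \<Longrightarrow> Q \<sigma>' k'"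
  shows "wp sweep Q \<sigma> k"
proof (rule wp_frame)
  let ?post = "\<lambda>\<sigma>'. vars \<sigma>' ''fail'' = 0 \<and> (\<exists>vs ts Z vs' ts' Z'.
          tr (grid T (arrs \<sigma>' ''par'')) (vars \<sigma>' ''bv'') (vars \<sigma>' ''bi'') vs ts Z \<and>
          (vars \<sigma>' ''bv'', vars \<sigma>' ''bi'', t) \<in> AF \<and> t \<notin> set vs \<and>
          tr (grid T (arrs \<sigma>' ''par'')) (xv (N - 1)) (xi (N - 1)) vs' ts' Z' \<and>
          (xv (N - 1), xi (N - 1), t) \<in> AF \<and> t \<notin> set vs' \<and> Z \<inter> Z' = {} \<and> Z' \<noteq> {}) \<or>
      vars \<sigma>' ''fail'' = 1 \<and> stuck"
  let ?R = "\<lambda>\<sigma>' k'. ?post \<sigma>' \<and> k - 100 - int (n * Suc T) * (W + 60) - int N * W \<le> k'"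
  let ?loop = "While (Conj (Less (Var ''a'') (Var ''N'')) (Equal (Var ''fail'') (Const 0))) sweep_round"
  have W0: "0 \<le> W" using W by simp
  have N: "vars \<sigma> ''N'' = N" "vars \<sigma> ''s'' = s" using e unfolding ready_def env_def by auto
  define B where "B = k - 100 - int (n * Suc T) * (W + 60) - int N * W"
  have loop: "wp ?loop ?R \<tau> (k - x)"
    if x: "x \<le> 50" and r: "ready \<tau>" and v: "vars \<tau> ''a'' = L" "vars \<tau> ''beta'' = Suc L" "vars \<tau> ''fail'' = 0" "vars \<tau> ''K'' = vars \<sigma> ''K''"
      and g: "grid T (arrs \<tau> ''mk'') = grid T (arrs \<sigma> ''mk'')" "grid T (arrs \<tau> ''par'') = grid T (arrs \<sigma> ''par'')"
      and b: "vars \<tau> ''best'' = Suc L \<and> D = {} \<or> vars \<tau> ''best'' = N \<and> vars \<tau> ''bv'' = s \<and> vars \<tau> ''bi'' \<in> D"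
    for \<tau> x
  proof (rule wp_sweep_loop[OF r xiN, where W = W and B = B])
    have "state_inv (\<lambda>_. True) \<tau>"
      using laid_inv[OF l b] v g unfolding state_inv_def by simp
    then show "sound \<tau>" using v L unfolding sound_def by auto
    show "vars \<tau> ''a'' \<le> N" using v L by simp
    show "W = 200 * int (vars \<tau> ''K'') + 300" using W v by simp
    show "0 \<le> B" using k unfolding B_def by simp
    have "int (free (grid T (arrs \<tau> ''mk''))) \<le> int (n * Suc T)" using free_le by (rule iffD2[OF of_nat_le_iff])
    then have "int (free (grid T (arrs \<tau> ''mk''))) * (W + 60) \<le> int (n * Suc T) * (W + 60)"
      by (rule mult_right_mono) (use W0 in simp)
    moreover have "(int N - int (vars \<tau> ''a'')) * W \<le> int N * W" using W0 by (intro mult_right_mono) auto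
    moreover have "k - 100 - p - q + 20 + p' + q' \<le> k - x" if "p' \<le> p" "q' \<le> q" for p q p' q' using that x by linarith
    ultimately show "B + 20 + int (free (grid T (arrs \<tau> ''mk''))) * (W + 60) + (int N - int (vars \<tau> ''a'')) * W \<le> k - x"
      unfolding B_def by blast
    fix \<sigma>' k'
    assume so: "sound \<sigma>'" "vars \<sigma>' ''a'' = N \<or> vars \<sigma>' ''fail'' \<noteq> 0" and k': "B \<le> k'"
    have "Suc (N - 1) = N" using L by simp
    have "?post \<sigma>'"
    proof (cases "vars \<sigma>' ''fail'' = 0")
      case True
      then obtain col where "inv (grid T (arrs \<sigma>' ''mk'')) (grid T (arrs \<sigma>' ''par'')) col (N - 1)
         (vars \<sigma>' ''beta'') (vars \<sigma>' ''best'') (vars \<sigma>' ''bv'') (vars \<sigma>' ''bi'')"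
        using so unfolding sound_def by auto
      from inv_final[OF this \<open>Suc (N - 1) = N\<close>] True show ?thesis by blast
    next
      case False
      then have "vars \<sigma>' ''fail'' = 1 \<and> stuck" using so(1) unfolding sound_def by simp
      then show ?thesis by (rule disjI2)
    qed
    then show "?R \<sigma>' k'" using k' unfolding B_def by blast
  qed
  have "wp ?loop ?R \<lparr>vars = (vars \<sigma>)(''a'' := L, ''beta'' := Suc L, ''best'' := Suc L, ''fail'' := 0), arrs = arrs \<sigma>\<rparr> (k - x)"
    if "x \<le> 50" "vars \<sigma> ''d'' = 0" for x
    by (rule loop[OF that(1)]) (use d that in \<open>simp_all add: ready_cong[OF e]\<close>)
  moreover have "wp ?loop ?R \<lparr>vars = (vars \<sigma>)(''a'' := L, ''beta'' := Suc L, ''best'' := N, ''bv'' := s, ''bi'' := vars \<sigma> ''d1'', ''fail'' := 0), arrs = arrs \<sigma>\<rparr> (k - x)"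
    if "x \<le> 50" "vars \<sigma> ''d'' \<noteq> 0" for x
    by (rule loop[OF that(1)]) (use d that in \<open>simp_all add: ready_cong[OF e]\<close>)
  ultimately show "wp sweep ?R \<sigma> k"
    using c N unfolding sweep_def wp_Seq_fun by (cases "vars \<sigma> ''d'' = 0") (simp_all add: wp_simps del: mult_Suc_right)
qed (use Q in blast)

end

section \<open>Tracing back the paths\<close>

definition trace_step :: com where
  "trace_step =
     Assign ''u'' (cell ''par'' (Var ''v'') (Var ''i''));;
     Cond (Equal (Var ''u'') (Var ''v''))
       (Assign ''i'' (Sub (Var ''i'') (Const 1)))
       (Assign ''k'' (Sub (Var ''k'') (Const 1));; Store ''tt'' (Var ''k'') (Var ''i'');;
        Store ''tv'' (Var ''k'') (Var ''u'');; Assign ''v'' (Var ''u''))"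

definition copy_step :: "name \<Rightarrow> name \<Rightarrow> com" where
  "copy_step X Y =
     Store X (Var ''j'') (Read ''tv'' (Var ''k''));; Store Y (Var ''j'') (Read ''tt'' (Var ''k''));;
     Assign ''j'' (Add (Var ''j'') (Const 1));; Assign ''k'' (Add (Var ''k'') (Const 1))"

text \<open>Following pointers yields the path from its end, with unknown length. It is therefore
  written into scratch arrays downwards from \<open>N\<close> and copied to the front of the output
  arrays afterwards.\<close>

definition emit :: "name \<Rightarrow> name \<Rightarrow> name \<Rightarrow> name \<Rightarrow> name \<Rightarrow> com" where
  "emit y z X Y l =
     Assign ''v'' (Var y);; Assign ''i'' (Var z);;
     Store ''tv'' (Var ''N'') (Var ''t'');; Assign ''k'' (Sub (Var ''N'') (Const 1));;
     Store ''tt'' (Var ''k'') (Var ''i'');; Store ''tv'' (Var ''k'') (Var ''v'');;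
     While (Neg (Equal (Var ''v'') (Var ''s''))) trace_step;;
     Assign l (Sub (Var ''N'') (Var ''k''));; Assign ''j'' (Const 0);;
     While (Less (Var ''k'') (Add (Var ''N'') (Const 1))) (copy_step X Y)"

context net
begin

text \<open>\<open>vs\<close> and \<open>ts\<close> are what is still to be traced. The last vertex
  of \<open>vs\<close> is already stored at index \<open>k\<close>, hence the list of stored
  vertices starts at \<open>Suc k\<close>.\<close>

definition traced_to :: "(nat \<Rightarrow> nat \<Rightarrow> nat) \<Rightarrow> nat list \<Rightarrow> nat list \<Rightarrow> nat \<Rightarrow> state \<Rightarrow> nat list \<Rightarrow> nat list \<Rightarrow> bool" where
  "traced_to par ws us N \<sigma> vs ts \<longleftrightarrow>
     (\<exists>Z. tr par (vars \<sigma> ''v'') (vars \<sigma> ''i'') vs ts Z) \<and> vars \<sigma> ''i'' \<le> T \<and>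
     ws = vs @ map (arrs \<sigma> ''tv'') [Suc (vars \<sigma> ''k'')..<Suc N] \<and>
     us = ts @ map (arrs \<sigma> ''tt'') [vars \<sigma> ''k''..<N] \<and>
     arrs \<sigma> ''tv'' (vars \<sigma> ''k'') = vars \<sigma> ''v'' \<and>
     vars \<sigma> ''k'' + length ws = N + length vs \<and> vars \<sigma> ''k'' < N"

lemma wp_trace_step:
  assumes e: "env \<sigma>" and g: "grid T (arrs \<sigma> ''par'') = par" and v: "vars \<sigma> ''v'' \<noteq> s" and ws: "length ws \<le> N"
    and I: "traced_to par ws us N \<sigma> vs ts" "B + 60 * int (vars \<sigma> ''i'' + length vs) \<le> k"
  shows "wp trace_step (\<lambda>\<sigma>' k'. \<exists>vs ts. traced_to par ws us N \<sigma>' vs ts \<and>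
    B + 60 * int (vars \<sigma>' ''i'' + length vs) \<le> k') \<sigma> (k - 5)"
proof -
  let ?v = "vars \<sigma> ''v''" and ?i = "vars \<sigma> ''i''" and ?k = "vars \<sigma> ''k''"
  let ?R = "\<lambda>\<sigma>' k'. \<exists>vs ts. traced_to par ws us N \<sigma>' vs ts \<and> B + 60 * int (vars \<sigma>' ''i'' + length vs) \<le> k'"
  obtain Z where tr: "tr par ?v ?i vs ts Z" using I unfolding traced_to_def by blast
  have i: "?i \<le> T" using I unfolding traced_to_def by blast
  have "set vs \<subseteq> {..<n}" using tr_list[OF tr] by blast
  moreover have "?v \<in> set vs" using tr_last[OF tr] last_in_set[of vs] by simp
  ultimately have "?v < n" by blast
  then have off: "arrs \<sigma> ''off'' ?v = ?v * Suc T" using e unfolding env_def by simp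
  have rd: "arrs \<sigma> ''par'' (?v * Suc T + ?i) = par ?v ?i" using g i unfolding grid_def by auto
  from tr show ?thesis
  proof (cases rule: tr.cases)
    case start
    then show ?thesis using v by simp
  next
    case (wait i' Z')
    have "traced_to par ws us N \<lparr>vars = (vars \<sigma>)(''u'' := ?v, ''i'' := i'), arrs = arrs \<sigma>\<rparr> vs ts"
      using I wait(3) i \<open>?i = Suc i'\<close> unfolding traced_to_def by auto
    moreover have "par ?v ?i = ?v" using wait by simp
    ultimately show ?thesis using I(2) wait(1) off rd unfolding trace_step_def
      by (auto simp: wp_simps simp del: mult_Suc_right intro!: exI)
  next
    case (move u vs' ts' Z')
    have uv: "u \<noteq> ?v" using arc move by blast
    have k: "?k \<noteq> 0" using I ws unfolding traced_to_def by (auto simp: move)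
    then obtain k' where k': "?k = Suc k'" by (cases ?k) auto
    have tv: "arrs \<sigma> ''tv'' (Suc k') = ?v" and kN: "Suc k' < N" and len: "?k + length ws = N + length vs"
      and w: "ws = vs @ map (arrs \<sigma> ''tv'') [Suc ?k..<Suc N]" "us = ts @ map (arrs \<sigma> ''tt'') [?k..<N]"
      using I k' unfolding traced_to_def by auto
    have u1: "[Suc k'..<Suc N] = Suc k' # [Suc (Suc k')..<Suc N]" "[k'..<N] = k' # [Suc k'..<N]"
      using kN by (simp_all only: upt_conv_Cons less_SucI Suc_lessD)
    have m: "map (X(k' := x)) [Suc k'..<y] = map X [Suc k'..<y]" "map (X(k' := x)) [Suc (Suc k')..<y] = map X [Suc (Suc k')..<y]"
      for X :: "nat \<Rightarrow> nat" and x y by (rule map_cong; simp)+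
    have "traced_to par ws us N \<lparr>vars = (vars \<sigma>)(''u'' := u, ''k'' := k', ''v'' := u),
        arrs = (arrs \<sigma>)(''tt'' := (arrs \<sigma> ''tt'')(k' := ?i), ''tv'' := (arrs \<sigma> ''tv'')(k' := u))\<rparr> vs' ts'"
      unfolding traced_to_def
    proof (intro conjI)
      let ?s = "\<lparr>vars = (vars \<sigma>)(''u'' := u, ''k'' := k', ''v'' := u),
        arrs = (arrs \<sigma>)(''tt'' := (arrs \<sigma> ''tt'')(k' := ?i), ''tv'' := (arrs \<sigma> ''tv'')(k' := u))\<rparr>"
      show "ws = vs' @ map (arrs ?s ''tv'') [Suc (vars ?s ''k'')..<Suc N]"
        using w(1) move tv k' by (simp add: u1 m del: upt_Suc)
      show "us = ts' @ map (arrs ?s ''tt'') [vars ?s ''k''..<N]"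
        using w(2) move k' by (simp add: u1 m del: upt_Suc)
    qed (use move i len kN k' in auto)
    moreover have "par ?v ?i = u" using move by simp
    ultimately show ?thesis using I(2) move(1) off rd uv k' unfolding trace_step_def
      by (auto simp: wp_simps simp del: mult_Suc_right intro!: exI)
  qed
qed

text \<open>Waiting does not apply at \<open>s\<close>, and a move never enters \<open>s\<close>
  since every trace contains it already.\<close>

lemma traced_to_start:
  assumes "tr par s i vs ts Z"
  shows "vs = [s] \<and> ts = []"
  using assms
proof (cases rule: tr.cases)
  case (move u vs' ts' Z')
  then show ?thesis using tr_hd by blast
qed auto

text \<open>The sum of the time and the number of remaining vertices pays for the loop: waiting
  backwards lowers the former, an arc the latter.\<close>

lemma wp_trace:
  assumes e: "env \<sigma>" and g: "grid T (arrs \<sigma> ''par'') = par" and ws: "length ws \<le> N"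
    and I: "traced_to par ws us N \<sigma> vs ts" and k: "20 + 60 * int (vars \<sigma> ''i'' + length vs) \<le> k"
    and Q: "\<And>\<sigma>' k'. unchanged trace_step \<sigma> \<sigma>' \<Longrightarrow>
      ws = map (arrs \<sigma>' ''tv'') [vars \<sigma>' ''k''..<Suc N] \<Longrightarrow> us = map (arrs \<sigma>' ''tt'') [vars \<sigma>' ''k''..<N] \<Longrightarrow>
      vars \<sigma>' ''k'' + length ws = Suc N \<Longrightarrow> vars \<sigma>' ''k'' < N \<Longrightarrow>
      k - 20 - 60 * int (vars \<sigma> ''i'' + length vs) \<le> k' \<Longrightarrow> Q \<sigma>' k'"
  shows "wp (While (Neg (Equal (Var ''v'') (Var ''s''))) trace_step) Q \<sigma> k"
proof -
  let ?b = "Neg (Equal (Var ''v'') (Var ''s''))"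
  define B where "B = k - 60 * int (vars \<sigma> ''i'' + length vs)"
  have sim: "env \<sigma>' \<and> grid T (arrs \<sigma>' ''par'') = par" if u: "unchanged trace_step \<sigma> \<sigma>'" for \<sigma>'
    using g env_unchanged[OF e u] unchangedD(2)[OF u, of "''par''"] by (simp add: trace_step_def)
  show ?thesis
  proof (rule wp_loop[where I = "\<lambda>\<sigma>' k'. \<exists>vs ts. traced_to par ws us N \<sigma>' vs ts \<and>
      B + 60 * int (vars \<sigma>' ''i'' + length vs) \<le> k'"])
    show "\<exists>vs ts. traced_to par ws us N \<sigma> vs ts \<and> B + 60 * int (vars \<sigma> ''i'' + length vs) \<le> k"
      using I unfolding B_def by auto
  next
    fix \<sigma>' k'
    assume "\<exists>vs ts. traced_to par ws us N \<sigma>' vs ts \<and> B + 60 * int (vars \<sigma>' ''i'' + length vs) \<le> k'"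
      and u: "unchanged trace_step \<sigma> \<sigma>'" and b: "bval ?b \<sigma>'"
    then obtain vs' ts' where I': "traced_to par ws us N \<sigma>' vs' ts'" "B + 60 * int (vars \<sigma>' ''i'' + length vs') \<le> k'"
      by blast
    have v: "vars \<sigma>' ''v'' \<noteq> s" using b sim[OF u] unfolding env_def by simp
    have "0 \<le> k'" using I'(2) k unfolding B_def by simp
    then show "0 \<le> k' \<and> wp trace_step (\<lambda>\<sigma>' k'. \<exists>vs ts. traced_to par ws us N \<sigma>' vs ts \<and>
      B + 60 * int (vars \<sigma>' ''i'' + length vs) \<le> k') \<sigma>' (k' - int (1 + bcost ?b))"
      using wp_trace_step[OF _ _ v ws I'] sim[OF u] by simp
  next
    fix \<sigma>' k'
    assume "\<exists>vs ts. traced_to par ws us N \<sigma>' vs ts \<and> B + 60 * int (vars \<sigma>' ''i'' + length vs) \<le> k'"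
      and u: "unchanged trace_step \<sigma> \<sigma>'" and b: "\<not> bval ?b \<sigma>'"
    then obtain vs' ts' where I': "traced_to par ws us N \<sigma>' vs' ts'" "B + 60 * int (vars \<sigma>' ''i'' + length vs') \<le> k'"
      by blast
    have v: "vars \<sigma>' ''v'' = s" using b sim[OF u] unfolding env_def by simp
    then have vt: "vs' = [s]" "ts' = []" using I' traced_to_start unfolding traced_to_def by blast+
    have kN: "vars \<sigma>' ''k'' < N" "vars \<sigma>' ''k'' + length ws = Suc N"
      using I'(1) vt unfolding traced_to_def by auto
    have u1: "[vars \<sigma>' ''k''..<Suc N] = vars \<sigma>' ''k'' # [Suc (vars \<sigma>' ''k'')..<Suc N]"
      using kN(1) by (simp only: upt_conv_Cons less_SucI)
    have "ws = map (arrs \<sigma>' ''tv'') [vars \<sigma>' ''k''..<Suc N]" "us = map (arrs \<sigma>' ''tt'') [vars \<sigma>' ''k''..<N]"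
      unfolding u1 using I'(1) vt v unfolding traced_to_def by simp_all
    moreover have "k - 20 - 60 * int (vars \<sigma> ''i'' + length vs) \<le> k' - int (1 + bcost ?b)"
      using I'(2) unfolding B_def by simp
    ultimately show "Q \<sigma>' (k' - int (1 + bcost ?b))" using Q[OF u] kN by blast
  qed
qed

end

lemma wp_copy:
  assumes N: "vars \<sigma> ''N'' = N" and j: "vars \<sigma> ''j'' = 0" and k1: "vars \<sigma> ''k'' = k1" "k1 \<le> N"
    and X: "X \<noteq> Y" "X \<notin> {''tv'', ''tt''}" "Y \<notin> {''tv'', ''tt''}"
    and k: "20 + 30 * int (Suc N - k1) \<le> k"
    and Q: "\<And>\<sigma>' k'. unchanged (copy_step X Y) \<sigma> \<sigma>' \<Longrightarrow>
      \<forall>j < Suc N - k1. arrs \<sigma>' X j = arrs \<sigma> ''tv'' (k1 + j) \<and> arrs \<sigma>' Y j = arrs \<sigma> ''tt'' (k1 + j) \<Longrightarrow>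
      k - 20 - 30 * int (Suc N - k1) \<le> k' \<Longrightarrow> Q \<sigma>' k'"
  shows "wp (While (Less (Var ''k'') (Add (Var ''N'') (Const 1))) (copy_step X Y)) Q \<sigma> k"
proof -
  let ?b = "Less (Var ''k'') (Add (Var ''N'') (Const 1))"
  let ?I = "\<lambda>\<sigma>' k'. vars \<sigma>' ''k'' = k1 + vars \<sigma>' ''j'' \<and> vars \<sigma>' ''k'' \<le> Suc N \<and>
     (\<forall>j < vars \<sigma>' ''j''. arrs \<sigma>' X j = arrs \<sigma> ''tv'' (k1 + j) \<and> arrs \<sigma>' Y j = arrs \<sigma> ''tt'' (k1 + j)) \<and>
     k - 30 * int (vars \<sigma>' ''j'') \<le> k'"
  have fr: "vars \<sigma>' ''N'' = N \<and> arrs \<sigma>' ''tv'' = arrs \<sigma> ''tv'' \<and> arrs \<sigma>' ''tt'' = arrs \<sigma> ''tt''"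
    if u: "unchanged (copy_step X Y) \<sigma> \<sigma>'" for \<sigma>'
    using unchangedD(1)[OF u, of "''N''"] unchangedD(2)[OF u, of "''tv''"] unchangedD(2)[OF u, of "''tt''"] N X
    by (auto simp: copy_step_def)
  show ?thesis
  proof (rule wp_loop[where I = ?I])
    show "?I \<sigma> k" using j k1 by simp
  next
    fix \<sigma>' k'
    assume I: "?I \<sigma>' k'" and u: "unchanged (copy_step X Y) \<sigma> \<sigma>'" and b: "bval ?b \<sigma>'"
    have le: "vars \<sigma>' ''k'' \<le> N" using b fr[OF u] by simp
    have "int (vars \<sigma>' ''j'') \<le> int (Suc N - k1)" using I by linarith
    then show "0 \<le> k' \<and> wp (copy_step X Y) ?I \<sigma>' (k' - int (1 + bcost ?b))"
      using I fr[OF u] X k le unfolding copy_step_def by (auto simp: wp_simps less_Suc_eq)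
  next
    fix \<sigma>' k'
    assume I: "?I \<sigma>' k'" and u: "unchanged (copy_step X Y) \<sigma> \<sigma>'" and b: "\<not> bval ?b \<sigma>'"
    have "\<not> vars \<sigma>' ''k'' < Suc N" using b fr[OF u] by simp
    then have jj: "vars \<sigma>' ''j'' = Suc N - k1" using I by linarith
    then show "Q \<sigma>' (k' - int (1 + bcost ?b))" using I by (intro Q[OF u]) auto
  qed
qed

context net
begin

lemma wp_emit:
  assumes e: "env \<sigma>" and tr: "tr (grid T (arrs \<sigma> ''par'')) (vars \<sigma> y) (vars \<sigma> z) vs ts Z" and i: "vars \<sigma> z \<le> T"
    and nm: "z \<noteq> ''v''" "l \<noteq> ''k''" "l \<noteq> ''N''" "l \<noteq> ''j''"
      "X \<noteq> Y" "X \<notin> {''tv'', ''tt''}" "Y \<notin> {''tv'', ''tt''}"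
    and k: "200 + 60 * int T + 100 * int n \<le> k"
    and Q: "\<And>\<sigma>' k'. unchanged (emit y z X Y l) \<sigma> \<sigma>' \<Longrightarrow>
      stored (vs @ [t]) (arrs \<sigma>' X) \<Longrightarrow> stored (ts @ [vars \<sigma> z]) (arrs \<sigma>' Y) \<Longrightarrow> vars \<sigma>' l = Suc (length ts) \<Longrightarrow>
      k - (200 + 60 * int T + 100 * int n) \<le> k' \<Longrightarrow> Q \<sigma>' k'"
  shows "wp (emit y z X Y l) Q \<sigma> k"
proof (rule wp_frame)
  let ?N = "n * Suc T + 2"
  let ?R = "\<lambda>\<sigma>' k'. stored (vs @ [t]) (arrs \<sigma>' X) \<and> stored (ts @ [vars \<sigma> z]) (arrs \<sigma>' Y) \<and>
      vars \<sigma>' l = Suc (length ts) \<and> k - (200 + 60 * int T + 100 * int n) \<le> k'"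
  let ?v = "vars \<sigma> y" and ?i = "vars \<sigma> z" and ?par = "grid T (arrs \<sigma> ''par'')"
  let ?copy = "While (Less (Var ''k'') (Add (Var ''N'') (Const 1))) (copy_step X Y)"
  have N: "vars \<sigma> ''N'' = ?N" "vars \<sigma> ''t'' = t" using e unfolding env_def by auto
  have len: "length vs = Suc (length ts)" and "distinct vs" "set vs \<subseteq> {..<n}" using tr_list[OF tr] by blast+
  then have vn: "length vs \<le> n" using card_mono[of "{..<n}" "set vs"] distinct_card[of vs] by simp
  let ?s = "\<lparr>vars = (vars \<sigma>)(''v'' := ?v, ''i'' := ?i, ''k'' := Suc (n * Suc T)),
    arrs = (arrs \<sigma>)(''tt'' := (arrs \<sigma> ''tt'')(Suc (n * Suc T) := ?i),
      ''tv'' := (arrs \<sigma> ''tv'')(?N := t, Suc (n * Suc T) := ?v))\<rparr>"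
  have es: "env ?s" by (rule env_cong[OF e]; simp)
  have T1: "traced_to ?par (vs @ [t]) (ts @ [?i]) ?N ?s vs ts"
    using tr i unfolding traced_to_def by auto
  have lN: "length (vs @ [t]) \<le> ?N" using vn by simp
  have loop: "wp (While (Neg (Equal (Var ''v'') (Var ''s''))) trace_step)
      (wp (Assign l (Sub (Var ''N'') (Var ''k''))) (wp (Assign ''j'' (Const 0)) (wp ?copy ?R))) ?s (k - x)" if x: "x \<le> 50" for x
  proof (rule wp_trace[OF es _ lN T1])
    show "grid T (arrs ?s ''par'') = ?par" by simp
    have c: "int (vars ?s ''i'' + length vs) \<le> int T + int n" using i vn by simp
    then show "20 + 60 * int (vars ?s ''i'' + length vs) \<le> k - x" using k x by simp
    fix \<sigma>' k'
    assume u: "unchanged trace_step ?s \<sigma>'" and ws: "vs @ [t] = map (arrs \<sigma>' ''tv'') [vars \<sigma>' ''k''..<Suc ?N]"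
      and us: "ts @ [?i] = map (arrs \<sigma>' ''tt'') [vars \<sigma>' ''k''..<?N]"
      and kN: "vars \<sigma>' ''k'' + length (vs @ [t]) = Suc ?N" "vars \<sigma>' ''k'' < ?N"
      and k': "k - x - 20 - 60 * int (vars ?s ''i'' + length vs) \<le> k'"
    have N': "vars \<sigma>' ''N'' = ?N" using unchangedD(1)[OF u, of "''N''"] N by (simp add: trace_step_def)
    let ?k1 = "vars \<sigma>' ''k''"
    let ?s' = "\<lparr>vars = (vars \<sigma>')(l := ?N - ?k1, ''j'' := 0), arrs = arrs \<sigma>'\<rparr>"
    have d: "Suc ?N - ?k1 = Suc (length vs)" "?N - ?k1 = Suc (length ts)" using kN len by simp_all
    have "wp ?copy ?R ?s' (k' - 6)"
    proof (rule wp_copy[where N = ?N and ?k1.0 = ?k1])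
      show "20 + 30 * int (Suc ?N - ?k1) \<le> k' - 6" unfolding d using k k' c x vn by simp
      fix \<sigma>'' k''
      assume u': "unchanged (copy_step X Y) ?s' \<sigma>''"
        and cp: "\<forall>j < Suc ?N - ?k1. arrs \<sigma>'' X j = arrs ?s' ''tv'' (?k1 + j) \<and> arrs \<sigma>'' Y j = arrs ?s' ''tt'' (?k1 + j)"
        and k'': "k' - 6 - 20 - 30 * int (Suc ?N - ?k1) \<le> k''"
      have "stored (vs @ [t]) (arrs \<sigma>'' X)"
        unfolding ws stored_def using cp by (simp del: upt_Suc)
      moreover have "stored (ts @ [?i]) (arrs \<sigma>'' Y)"
        unfolding us stored_def using cp by (simp del: upt_Suc)
      moreover have "vars \<sigma>'' l = Suc (length ts)"
        using unchangedD(1)[OF u', of l] nm d by (simp add: copy_step_def)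
      moreover have "k - (200 + 60 * int T + 100 * int n) \<le> k''"
        using k'' k' c x vn unfolding d by simp
      ultimately show "?R \<sigma>'' k''" by blast
    qed (use N' nm kN in auto)
    then show "wp (Assign l (Sub (Var ''N'') (Var ''k''))) (wp (Assign ''j'' (Const 0)) (wp ?copy ?R)) \<sigma>' k'"
      using N' by (simp add: wp_simps)
  qed
  show "wp (emit y z X Y l) ?R \<sigma> k"
    unfolding emit_def wp_Seq_fun using loop nm N by (simp add: wp_simps)
qed (use Q in blast)

end

section \<open>The algorithm\<close>

text \<open>\<open>found\<close> is 0 at the start, as is everything that is not input, so the
  branches without a solution have nothing to assign.\<close>

definition solve :: com where
  "solve =
     Cond (Equal (Var ''d'') (Const 2))
       (Assign ''bv'' (Var ''s'');; Assign ''bi'' (Var ''d1'');;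
        Assign ''cv'' (Var ''s'');; Assign ''ci'' (Var ''d2'');; Assign ''found'' (Const 1))
       (search;;
        Cond (Less (Const 0) (Read ''arr'' (Var ''t'')))
          (spine_com;; sweep;;
           Cond (Equal (Var ''fail'') (Const 0))
             (Assign ''cv'' (Read ''xv'' (Sub (Var ''N'') (Const 1)));;
              Assign ''ci'' (Read ''xi'' (Sub (Var ''N'') (Const 1)));; Assign ''found'' (Const 1))
             Skip)
          Skip)"

definition algorithm :: com where
  "algorithm =
     Cond (Conj (Less (Const 0) (Var ''m'')) (Conj (Less (Const 0) (Var ''tau'')) (Neg (Equal (Var ''s'') (Var ''t'')))))
       (offsets;; Assign ''N'' (Add (Var ''x'') (Const 2));; build;; solve;;
        Cond (Equal (Var ''found'') (Const 1))
          (emit ''bv'' ''bi'' ''pv'' ''pt'' ''plen'';; emit ''cv'' ''ci'' ''qv'' ''qt'' ''qlen'')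
          Skip)
       Skip"

context net
begin

text \<open>As the vertices of a path are distinct, an arc out of \<open>s\<close> can only be its
  first one and an arc into \<open>t\<close> only its last one; a direct arc is then the whole
  path.\<close>

lemma npath_arcs:
  assumes "npath (vs, ts)"
  shows "(\<exists>i \<in> D. vs = [s, t] \<and> ts = [i]) \<or> (\<forall>h < length ts. (vs ! h, ts ! h, vs ! Suc h) \<in> A)"
proof -
  have len: "length vs = Suc (length ts)" and ends: "hd vs = s" "last vs = t" and dis: "distinct vs"
    and arcs: "\<And>h. h < length ts \<Longrightarrow> (vs ! h, ts ! h, vs ! Suc h) \<in> AF"
    using assms unfolding npath_def by auto
  have vs: "vs \<noteq> []" "vs ! 0 = s" "vs ! length ts = t"
    using len ends hd_conv_nth[of vs] last_conv_nth[of vs] by (cases "vs = []"; simp)+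
  show ?thesis
  proof (cases "\<forall>h < length ts. (vs ! h, ts ! h, vs ! Suc h) \<in> A")
    case False
    then obtain h where h: "h < length ts" "(vs ! h, ts ! h, vs ! Suc h) \<notin> A" by blast
    then have hD: "vs ! h = s" "vs ! Suc h = t" "ts ! h \<in> D" using arcs[OF h(1)] unfolding AF_def by auto
    have "h = 0" using nth_eq_iff_index_eq[OF dis, of h 0] hD vs h len by simp
    moreover have "Suc h = length ts" using nth_eq_iff_index_eq[OF dis, of "Suc h" "length ts"] hD vs h len by simp
    ultimately have l: "length ts = 1" "length vs = 2" using len by simp_all
    then have "ts = [ts ! 0]" "vs = [vs ! 0, vs ! 1]" by (auto simp: length_Suc_conv numeral_2_eq_2)
    then show ?thesis using hD vs \<open>h = 0\<close> l by auto
  qed simp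
qed

lemma npath_reach:
  assumes e: "earliest arr prv rk (Suc T)" and P: "npath (vs, ts)"
    and A: "\<forall>h < length ts. (vs ! h, ts ! h, vs ! Suc h) \<in> A"
  shows "0 < arr t"
proof -
  have len: "length vs = Suc (length ts)" and ends: "hd vs = s" "last vs = t" and so: "sorted ts"
    using P unfolding npath_def by auto
  have vs: "vs ! 0 = s" "vs ! length ts = t"
    using len ends hd_conv_nth[of vs] last_conv_nth[of vs] by (cases "vs = []"; simp)+
  have "0 < arr (vs ! h) \<and> (h < length ts \<longrightarrow> arr (vs ! h) \<le> ts ! h)" if "h \<le> length ts" for h
    using that
  proof (induction h)
    case 0
    show ?case
    proof (cases "0 < length ts")
      case True
      then show ?thesis using earliestD(1)[OF e] vs arc A by fastforce
    qed (use earliestD(1)[OF e] vs in simp)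
  next
    case (Suc h)
    then have a: "(vs ! h, ts ! h, vs ! Suc h) \<in> A" using A by simp
    then have "ts ! h < Suc T" using arc by fastforce
    then have r: "0 < arr (vs ! Suc h) \<and> arr (vs ! Suc h) \<le> ts ! h"
      using earliestD(3)[OF e a] Suc by simp
    have "ts ! h \<le> ts ! Suc h" if "Suc h < length ts" using so that by (simp add: sorted_nth_mono)
    then show ?case using r by auto
  qed
  from this[of "length ts"] show ?thesis using vs by simp
qed

definition solvable :: bool where
  "solvable \<longleftrightarrow> (\<exists>P Q. npath P \<and> npath Q \<and> P \<noteq> Q \<and> temporal_verts P \<inter> temporal_verts Q \<subseteq> {s, t} \<times> {1..T})"

text \<open>One-step paths have empty \<open>Z\<close>, so disjointness alone would not tell such a
  path from itself; hence the final inequality.\<close>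

definition solution :: "(nat \<Rightarrow> nat \<Rightarrow> nat) \<Rightarrow> nat \<Rightarrow> nat \<Rightarrow> nat \<Rightarrow> nat \<Rightarrow> bool" where
  "solution par bv bi cv ci \<longleftrightarrow> (\<exists>vs ts Z vs' ts' Z'. tr par bv bi vs ts Z \<and> (bv, bi, t) \<in> AF \<and> t \<notin> set vs \<and>
     tr par cv ci vs' ts' Z' \<and> (cv, ci, t) \<in> AF \<and> t \<notin> set vs' \<and> Z \<inter> Z' = {} \<and>
     (vs, ts, bi) \<noteq> (vs', ts', ci))"

text \<open>A nonempty \<open>Z'\<close> means that the second trace has a vertex after
  \<open>s\<close>. If both paths were the same, the cell in which they enter this vertex would lie
  in \<open>Z\<close> and in \<open>Z'\<close>.\<close>

lemma solution_intro:
  assumes "tr par bv bi vs ts Z" "(bv, bi, t) \<in> AF" "t \<notin> set vs"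
     "tr par cv ci vs' ts' Z'" "(cv, ci, t) \<in> AF" "t \<notin> set vs'" "Z \<inter> Z' = {}" "Z' \<noteq> {}"
  shows "solution par bv bi cv ci"
proof -
  have "(vs, ts, bi) \<noteq> (vs', ts', ci)"
  proof
    assume eq: "(vs, ts, bi) = (vs', ts', ci)"
    obtain x j where xj: "(x, j) \<in> Z'" using assms(8) by fastforce
    have l: "length vs' = Suc (length ts')" "sorted ts'" "\<forall>x \<in> set ts'. x \<le> ci" using tr_list[OF assms(4)] by auto
    have "length vs' \<noteq> 1"
    proof
      assume "length vs' = 1"
      then obtain y where "vs' = [y]" by (cases vs') auto
      moreover have "x \<in> set vs'" "x \<noteq> s" using tr_Z[OF assms(4)] xj by auto
      ultimately show False using tr_hd[OF assms(4)] by simp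
    qed
    then have h: "0 < length ts'" using l by (cases ts') auto
    have "sorted (ts' @ [ci])" using l by (simp add: sorted_append)
    then have "(ts' @ [ci]) ! 0 \<le> (ts' @ [ci]) ! 1" using h by (intro sorted_nth_mono) auto
    then have le: "ts' ! 0 \<le> (ts' @ [ci]) ! 1" using h by (simp add: nth_append)
    have "(vs' ! 1, ts' ! 0) \<in> Z'" using tr_stays[OF assms(4), of 1 "ts' ! 0"] h l le by simp
    moreover have "(vs' ! 1, ts' ! 0) \<in> Z" using tr_stays[OF assms(1), of 1 "ts' ! 0"] h l le eq by simp
    ultimately show False using assms(7) by blast
  qed
  then show ?thesis unfolding solution_def using assms by blast
qed

text \<open>If \<open>t\<close> cannot be reached by the arcs of \<open>A\<close>, each path is a
  direct arc, and at most one time is available for it.\<close>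

lemma not_solvable:
  assumes "D \<subseteq> {d}" and e: "earliest arr prv rk (Suc T)" and "arr t = 0"
  shows "\<not> solvable"
proof
  assume "solvable"
  then obtain P Q where PQ: "npath P" "npath Q" "P \<noteq> Q" unfolding solvable_def by blast
  have "R = ([s, t], [d])" if "npath R" for R
  proof -
    obtain vs ts where R: "R = (vs, ts)" by (cases R)
    have "\<not> (\<forall>h < length ts. (vs ! h, ts ! h, vs ! Suc h) \<in> A)"
      using npath_reach[OF e that[unfolded R]] assms(3) by auto
    then show ?thesis using npath_arcs[OF that[unfolded R]] assms(1) R by auto
  qed
  then show False using PQ by blast
qed

definition solve_cost :: "int \<Rightarrow> int" where
  "solve_cost K = 500 + (int n + int T) * (40 * K + 60) + (60 * int T + 80 * int (n * Suc T + 2)) +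
     int (n * Suc T) * (200 * K + 360) + int (n * Suc T + 2) * (200 * K + 300)"

lemma wp_solve:
  assumes e: "env \<sigma>" and z: "arrs \<sigma> ''arr'' = (\<lambda>_. 0)" "arrs \<sigma> ''mk'' = (\<lambda>_. 0)" "vars \<sigma> ''found'' = 0"
    and d: "vars \<sigma> ''d'' = 0 \<and> D = {} \<or> vars \<sigma> ''d'' = 1 \<and> D = {vars \<sigma> ''d1''} \<or>
        vars \<sigma> ''d'' = 2 \<and> vars \<sigma> ''d1'' \<in> D \<and> vars \<sigma> ''d2'' \<in> D \<and> vars \<sigma> ''d1'' \<noteq> vars \<sigma> ''d2''"
    and k: "solve_cost (int (vars \<sigma> ''K'')) \<le> k"
    and Q: "\<And>\<sigma>' k'. unchanged solve \<sigma> \<sigma>' \<Longrightarrow>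
      vars \<sigma>' ''found'' = 1 \<and> solution (grid T (arrs \<sigma>' ''par'')) (vars \<sigma>' ''bv'') (vars \<sigma>' ''bi'') (vars \<sigma>' ''cv'') (vars \<sigma>' ''ci'') \<or>
      vars \<sigma>' ''found'' = 0 \<and> \<not> solvable \<Longrightarrow>
      k - solve_cost (int (vars \<sigma> ''K'')) \<le> k' \<Longrightarrow> Q \<sigma>' k'"
  shows "wp solve Q \<sigma> k"
proof (rule wp_frame)
  let ?post = "\<lambda>\<sigma>'. vars \<sigma>' ''found'' = 1 \<and> solution (grid T (arrs \<sigma>' ''par'')) (vars \<sigma>' ''bv'') (vars \<sigma>' ''bi'') (vars \<sigma>' ''cv'') (vars \<sigma>' ''ci'') \<or>
      vars \<sigma>' ''found'' = 0 \<and> \<not> solvable"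
  let ?K = "int (vars \<sigma> ''K'')"
  let ?R = "\<lambda>\<sigma>' k'. ?post \<sigma>' \<and> k - solve_cost ?K \<le> k'"
  let ?N = "n * Suc T + 2"
  define W1 where "W1 = 40 * ?K + 60"
  define W2 where "W2 = 200 * ?K + 300"
  define c1 where "c1 = (int n + int T) * W1"
  define c2 where "c2 = 60 * int T + 80 * int ?N"
  define c3 where "c3 = int (n * Suc T) * (W2 + 60)"
  define c4 where "c4 = int ?N * W2"
  have cost: "solve_cost ?K = 500 + c1 + c2 + c3 + c4"
    unfolding solve_cost_def c1_def c2_def c3_def c4_def W1_def W2_def by simp
  have pos: "0 \<le> c1" "0 \<le> c2" "0 \<le> c3" "0 \<le> c4"
    unfolding c1_def c2_def c3_def c4_def W1_def W2_def by simp_all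
  note k = k[unfolded cost]
  have vt: "vars \<sigma> ''s'' = s" "vars \<sigma> ''t'' = t" "vars \<sigma> ''N'' = ?N" using e unfolding env_def by auto
  show "wp solve ?R \<sigma> k"
  proof (cases "vars \<sigma> ''d'' = 2")
    case True
    then have dd: "vars \<sigma> ''d1'' \<in> D" "vars \<sigma> ''d2'' \<in> D" "vars \<sigma> ''d1'' \<noteq> vars \<sigma> ''d2''" using d by auto
    have "solution par s (vars \<sigma> ''d1'') s (vars \<sigma> ''d2'')" for par
      unfolding solution_def
      by (rule exI[of _ "[s]"], rule exI[of _ "[]"], rule exI[of _ "{}"], rule exI[of _ "[s]"], rule exI[of _ "[]"], rule exI[of _ "{}"])
        (use dd st in \<open>auto simp: AF_def intro: tr.start\<close>)
    then show ?thesis using True vt pos unfolding solve_def cost by (simp add: wp_simps)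
  next
    case False
    then have D1: "D \<subseteq> {vars \<sigma> ''d1''}" and d': "vars \<sigma> ''d'' = 0 \<and> D = {} \<or> vars \<sigma> ''d'' \<noteq> 0 \<and> vars \<sigma> ''d1'' \<in> D"
      using d by auto
    let ?c3 = "Cond (Equal (Var ''fail'') (Const 0))
             (Assign ''cv'' (Read ''xv'' (Sub (Var ''N'') (Const 1)));;
              Assign ''ci'' (Read ''xi'' (Sub (Var ''N'') (Const 1)));; Assign ''found'' (Const 1))
             Skip"
    let ?c2 = "Cond (Less (Const 0) (Read ''arr'' (Var ''t''))) (spine_com;; sweep;; ?c3) Skip"
    have "wp search (wp ?c2 ?R) \<sigma> (k - 4)"
    proof (rule wp_search[OF e z(1) W1_def])
      show "100 + (int n + int T) * W1 \<le> k - 4" using k pos unfolding c1_def[symmetric] by linarith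
      fix \<sigma>1 k1 rk
      assume u1: "unchanged search \<sigma> \<sigma>1" and r1: "earliest (arrs \<sigma>1 ''arr'') (arrs \<sigma>1 ''prv'') rk (Suc T)"
        and "k - 4 - 100 - (int n + int T) * W1 \<le> k1"
      then have k1: "k - 104 - c1 \<le> k1" unfolding c1_def by simp
      have v1: "vars \<sigma>1 x = vars \<sigma> x" if "x \<notin> {''now'', ''ch'', ''k''}" for x
        by (rule unchangedD(1)[OF u1]) (use that in \<open>simp add: search_def search_round_def search_step_def\<close>)
      have w1: "arrs \<sigma>1 x = arrs \<sigma> x" if "x \<notin> {''arr'', ''prv''}" for x
        by (rule unchangedD(2)[OF u1]) (use that in \<open>simp add: search_def search_round_def search_step_def\<close>)
      have e1: "env \<sigma>1" by (rule env_cong[OF e]) (simp_all add: v1 w1)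
      have t1: "vars \<sigma>1 ''t'' = t" using e1 unfolding env_def by simp
      show "wp ?c2 ?R \<sigma>1 k1"
      proof (cases "0 < arrs \<sigma>1 ''arr'' t")
        case False
        then have "\<not> solvable" using not_solvable[OF D1 r1] by simp
        then show ?thesis using False t1 z(3) k1 pos unfolding cost by (simp add: wp_simps v1)
      next
        case True
        have "wp spine_com (wp sweep (wp ?c3 ?R)) \<sigma>1 (k1 - 5)"
        proof (rule wp_spine[OF e1 r1 True])
          show "arrs \<sigma>1 ''mk'' = (\<lambda>_. 0)" using z w1 by simp
          have "200 + c2 \<le> k1 - 5" using k k1 pos by linarith
          then show "200 + 60 * int T + 80 * int ?N \<le> k1 - 5" unfolding c2_def by simp
          fix \<sigma>2 k2 L
          assume u2: "unchanged spine_com \<sigma>1 \<sigma>2" and L: "vars \<sigma>2 ''c'' = L"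
            and S: "spine n T s t A D (arrs \<sigma>1 ''arr'') rk L ?N (arrs \<sigma>2 ''xv'') (arrs \<sigma>2 ''xi'')"
            and laid: "laid L ?N (arrs \<sigma>2 ''xv'') (arrs \<sigma>2 ''xi'') (grid T (arrs \<sigma>2 ''mk'')) (grid T (arrs \<sigma>2 ''par''))"
            and xiN: "arrs \<sigma>2 ''xi'' ?N = 0"
            and "k1 - 5 - (200 + 60 * int T + 80 * int ?N) \<le> k2"
          then have k2: "k - 309 - c1 - c2 \<le> k2" using k1 unfolding c2_def by linarith
          have v2: "vars \<sigma>2 x = vars \<sigma>1 x" if "x \<notin> {''c'', ''i'', ''v''}" for x
            by (rule unchangedD(1)[OF u2]) (use that in \<open>simp add: spine_com_def spine_step_def fill_def\<close>)
          have w2: "arrs \<sigma>2 x = arrs \<sigma>1 x" if "x \<notin> {''xv'', ''xi'', ''mk'', ''par''}" for x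
            by (rule unchangedD(2)[OF u2]) (use that in \<open>simp add: spine_com_def spine_step_def fill_def\<close>)
          have e2: "env \<sigma>2" by (rule env_cong[OF e1]) (simp_all add: v2 w2)
          interpret S: spine n T s t A D "arrs \<sigma>1 ''arr''" rk L ?N "arrs \<sigma>2 ''xv''" "arrs \<sigma>2 ''xi''" by (rule S)
          have r2: "S.ready \<sigma>2" unfolding S.ready_def using e2 unfolding env_def by simp
          show "wp sweep (wp ?c3 ?R) \<sigma>2 k2"
          proof (rule S.wp_sweep[OF r2 _ L laid])
            show "arrs \<sigma>2 ''xi'' ?N \<le> T" using xiN by simp
            show "vars \<sigma>2 ''d'' = 0 \<and> D = {} \<or> vars \<sigma>2 ''d'' \<noteq> 0 \<and> vars \<sigma>2 ''d1'' \<in> D" using d' by (simp add: v1 v2)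
            show "W2 = 200 * int (vars \<sigma>2 ''K'') + 300" unfolding W2_def by (simp add: v1 v2)
            show "100 + int (n * Suc T) * (W2 + 60) + int ?N * W2 \<le> k2"
              unfolding c3_def[symmetric] c4_def[symmetric] using k k2 pos by linarith
            fix \<sigma>3 k3
            assume u3: "unchanged sweep \<sigma>2 \<sigma>3"
              and post: "vars \<sigma>3 ''fail'' = 0 \<and> (\<exists>vs ts Z vs' ts' Z'.
                tr (grid T (arrs \<sigma>3 ''par'')) (vars \<sigma>3 ''bv'') (vars \<sigma>3 ''bi'') vs ts Z \<and>
                (vars \<sigma>3 ''bv'', vars \<sigma>3 ''bi'', t) \<in> AF \<and> t \<notin> set vs \<and>
                tr (grid T (arrs \<sigma>3 ''par'')) (arrs \<sigma>2 ''xv'' (?N - 1)) (arrs \<sigma>2 ''xi'' (?N - 1)) vs' ts' Z' \<and>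
                (arrs \<sigma>2 ''xv'' (?N - 1), arrs \<sigma>2 ''xi'' (?N - 1), t) \<in> AF \<and> t \<notin> set vs' \<and> Z \<inter> Z' = {} \<and> Z' \<noteq> {}) \<or>
              vars \<sigma>3 ''fail'' = 1 \<and> S.stuck"
              and "k2 - 100 - int (n * Suc T) * (W2 + 60) - int ?N * W2 \<le> k3"
            then have k3: "k - 409 - c1 - c2 - c3 - c4 \<le> k3" using k2 unfolding c3_def c4_def by linarith
            have v3: "vars \<sigma>3 ''found'' = 0" "vars \<sigma>3 ''N'' = ?N"
              using unchangedD(1)[OF u3, of "''found''"] unchangedD(1)[OF u3, of "''N''"] z vt v1 v2
              by (simp_all add: sweep_def sweep_round_def advance_def sweep_step_def spread_def spread_step_def)
            have w3: "arrs \<sigma>3 ''xv'' = arrs \<sigma>2 ''xv''" "arrs \<sigma>3 ''xi'' = arrs \<sigma>2 ''xi''"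
              using unchangedD(2)[OF u3, of "''xv''"] unchangedD(2)[OF u3, of "''xi''"]
              by (simp_all add: sweep_def sweep_round_def advance_def sweep_step_def spread_def spread_step_def)
            show "wp ?c3 ?R \<sigma>3 k3"
            proof (cases "vars \<sigma>3 ''fail'' = 0")
              case True
              then have "solution (grid T (arrs \<sigma>3 ''par'')) (vars \<sigma>3 ''bv'') (vars \<sigma>3 ''bi'')
                  (arrs \<sigma>2 ''xv'' (?N - 1)) (arrs \<sigma>2 ''xi'' (?N - 1))"
                using post by (elim disjE conjE exE) (rule solution_intro, assumption+, simp)
              then show ?thesis using True v3 w3 k3 unfolding cost by (simp add: wp_simps)
            next
              case False
              have "S.stuck" using post False by (elim disjE conjE) simp_all
              then obtain x i where x: "x \<noteq> s" "x \<noteq> t" "\<And>P. npath P \<Longrightarrow> (x, i) \<in> temporal_verts P"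
                unfolding S.stuck_def by blast
              have "\<not> solvable"
              proof
                assume "solvable"
                then obtain P Q where "npath P" "npath Q"
                  "temporal_verts P \<inter> temporal_verts Q \<subseteq> {s, t} \<times> {1..T}" unfolding solvable_def by blast
                then have "(x, i) \<in> {s, t} \<times> {1..T}" using x(3)[of P] x(3)[of Q] by (meson IntI subsetD)
                then show False using x(1,2) by simp
              qed
              then show ?thesis using False v3 k3 unfolding cost by (simp add: wp_simps)
            qed
          qed
        qed
        then show ?thesis using True t1 by (simp add: wp_Cond wp_Seq_fun)
      qed
    qed
    then show ?thesis using False unfolding solve_def by (simp add: wp_Cond wp_Seq_fun)
  qed
qed (use Q in blast)

end

section \<open>Correctness on temporal graphs\<close>

lemma tp_le_one:
  assumes "\<not> (\<exists>P Q. temporal_path G s t P \<and> temporal_path G s t Q \<and> P \<noteq> Q \<and> t_vertex_disjoint G s t P Q)"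
  shows "tp G s t \<le> 1"
proof -
  let ?C = "{card \<P> | \<P>. finite \<P> \<and> \<P> \<subseteq> {P. temporal_path G s t P} \<and>
     (\<forall>P \<in> \<P>. \<forall>Q \<in> \<P>. P \<noteq> Q \<longrightarrow> t_vertex_disjoint G s t P Q)}"
  have le: "c \<le> 1" if c: "c \<in> ?C" for c
  proof -
    obtain \<P> where cP: "c = card \<P>" and f: "finite \<P>" and P: "\<P> \<subseteq> {P. temporal_path G s t P}"
      "\<forall>P \<in> \<P>. \<forall>Q \<in> \<P>. P \<noteq> Q \<longrightarrow> t_vertex_disjoint G s t P Q" using c by blast
    have "x = y" if "x \<in> \<P>" "y \<in> \<P>" for x y
    proof (rule ccontr)
      assume "x \<noteq> y"
      then have "temporal_path G s t x \<and> temporal_path G s t y \<and> x \<noteq> y \<and> t_vertex_disjoint G s t x y"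
        using P that by auto
      then show False using assms by blast
    qed
    then show ?thesis unfolding cP using f by (simp add: card_le_Suc0_iff_eq)
  qed
  have "finite ?C" by (rule finite_subset[of _ "{..1}"]) (use le in auto)
  \<comment> \<open>The empty family makes the set nonempty, without which \<open>Max\<close> would
    be unspecified.\<close>
  moreover have "0 \<in> ?C" by (rule CollectI, rule exI[of _ "{}"]) simp
  ultimately have "Max ?C \<le> 1" using le by (intro Max.boundedI) auto
  then show ?thesis unfolding tp_def .
qed

lemma temporal_verts_map:
  assumes "length vs = Suc (length ts)"
  shows "temporal_verts (map f vs, ts) = map_prod f id ` temporal_verts (vs, ts)"
proof -
  have "vs \<noteq> []" using assms by auto
  have "{(map f vs ! i, j) | i j. 0 < i \<and> i < length ts \<and> ts ! (i - 1) \<le> j \<and> j \<le> ts ! i} =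
    map_prod f id ` {(vs ! i, j) | i j. 0 < i \<and> i < length ts \<and> ts ! (i - 1) \<le> j \<and> j \<le> ts ! i}"
    (is "?l = map_prod f id ` ?r")
  proof
    show "?l \<subseteq> map_prod f id ` ?r"
    proof
      fix x assume "x \<in> ?l"
      then obtain i j where ij: "x = (map f vs ! i, j)" "0 < i" "i < length ts" "ts ! (i - 1) \<le> j" "j \<le> ts ! i" by blast
      then have "(vs ! i, j) \<in> ?r" "x = map_prod f id (vs ! i, j)" using assms by auto
      then show "x \<in> map_prod f id ` ?r" by blast
    qed
    show "map_prod f id ` ?r \<subseteq> ?l"
    proof
      fix x assume "x \<in> map_prod f id ` ?r"
      then obtain i j where ij: "x = (f (vs ! i), j)" "0 < i" "i < length ts" "ts ! (i - 1) \<le> j" "j \<le> ts ! i" by auto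
      then have "x = (map f vs ! i, j)" using assms by simp
      then show "x \<in> ?l" using ij by blast
    qed
  qed
  then show ?thesis unfolding temporal_verts_def using \<open>vs \<noteq> []\<close>
    by (simp add: image_Un hd_map last_map)
qed

locale numbered =
  fixes G :: "'v temporal_graph" and num :: "'v \<Rightarrow> nat" and es :: "('v \<times> 'v) list" and s t :: 'v
  assumes G: "temporal_graph G" and pres: "presentation G num es" and s_in: "s \<in> verts G" and t_in: "t \<in> verts G"
begin

text \<open>For undirected \<open>G\<close> an edge contributes both of its orientations, since
  \<open>link\<close> is then symmetric.\<close>

definition steps :: "(nat \<times> nat \<times> nat) set" where
  "steps = {(num u, i, num v) | u i v. u \<in> verts G \<and> v \<in> verts G \<and> link G u v \<in> edges G \<and> i \<in> labels G (link G u v)}"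

definition rows :: "(nat \<times> nat \<times> nat list) list" where
  "rows = map (\<lambda>(u, v). (num u, num v, sorted_list_of_set (labels G (link G u v)))) es"

abbreviation flat :: "(nat \<times> nat \<times> nat) list" where
  "flat \<equiv> concat (map row rows)"

lemma inj: "inj_on num (verts G)" and num_lt: "v \<in> verts G \<Longrightarrow> num v < card (verts G)"
  using pres unfolding presentation_def bij_betw_def by auto

lemma es_verts: "(u, v) \<in> set es \<Longrightarrow> u \<in> verts G \<and> v \<in> verts G \<and> link G u v \<in> edges G"
  using pres unfolding presentation_def by fastforce

lemma edge_in_es: "e \<in> edges G \<Longrightarrow> \<exists>u v. (u, v) \<in> set es \<and> e = link G u v"
  using pres unfolding presentation_def by fastforce

lemma labels: "e \<in> edges G \<Longrightarrow> labels G e \<subseteq> {1..lifetime G}"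
  using G unfolding temporal_graph_def by blast

lemma finite_labels: "e \<in> edges G \<Longrightarrow> finite (labels G e)"
  using labels finite_subset by blast

lemma link_neq: "link G u v \<in> edges G \<Longrightarrow> u \<noteq> v"
proof -
  assume "link G u v \<in> edges G"
  then obtain a b where "link G u v = link G a b" "a \<noteq> b" using G unfolding temporal_graph_def by blast
  then show ?thesis by (auto simp: link_def doubleton_eq_iff split: if_splits)
qed

lemma link_eq: "link G u v = link G a b \<longleftrightarrow> (u, v) = (a, b) \<or> \<not> directed G \<and> (u, v) = (b, a)"
  by (auto simp: link_def doubleton_eq_iff)

lemma length_es: "length es = card (edges G)"
  using pres unfolding presentation_def by (metis distinct_card length_map)

lemma flat_mem: "a \<in> set flat \<longleftrightarrow> (\<exists>u v i. (u, v) \<in> set es \<and> i \<in> labels G (link G u v) \<and> a = (num u, i, num v))"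
proof -
  have l: "set (sorted_list_of_set (labels G (link G u v))) = labels G (link G u v)" if "(u, v) \<in> set es" for u v
    using finite_labels es_verts[OF that] by simp
  have "set flat = (\<Union>e \<in> set es. (\<lambda>i. (num (fst e), i, num (snd e))) ` set (sorted_list_of_set (labels G (link G (fst e) (snd e)))))"
    unfolding rows_def row_def by (simp add: case_prod_unfold)
  also have "\<dots> = (\<Union>e \<in> set es. (\<lambda>i. (num (fst e), i, num (snd e))) ` labels G (link G (fst e) (snd e)))"
    by (rule SUP_cong[OF refl]) (simp add: l)
  finally have *: "set flat = (\<Union>e \<in> set es. (\<lambda>i. (num (fst e), i, num (snd e))) ` labels G (link G (fst e) (snd e)))" .
  show ?thesis
  proof
    assume "a \<in> set flat"
    then obtain e i where e: "e \<in> set es" "i \<in> labels G (link G (fst e) (snd e))" "a = (num (fst e), i, num (snd e))"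
      unfolding * by blast
    then show "\<exists>u v i. (u, v) \<in> set es \<and> i \<in> labels G (link G u v) \<and> a = (num u, i, num v)"
      using surjective_pairing[of e] by metis
  next
    assume "\<exists>u v i. (u, v) \<in> set es \<and> i \<in> labels G (link G u v) \<and> a = (num u, i, num v)"
    then show "a \<in> set flat" unfolding * by force
  qed
qed

lemma stepsI:
  "u \<in> verts G \<Longrightarrow> v \<in> verts G \<Longrightarrow> link G u v \<in> edges G \<Longrightarrow> i \<in> labels G (link G u v) \<Longrightarrow>
    (num u, i, num v) \<in> steps"
  unfolding steps_def by blast

lemma flat_steps: "(\<Union>a \<in> set flat. orient (if directed G then 1 else 0) a) = steps"
proof (intro equalityI subsetI)
  fix x assume "x \<in> (\<Union>a \<in> set flat. orient (if directed G then 1 else 0) a)"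
  then obtain a where "a \<in> set flat" "x \<in> orient (if directed G then 1 else 0) a" by blast
  then obtain u v i where uv: "(u, v) \<in> set es" "i \<in> labels G (link G u v)"
    and x: "x = (num u, i, num v) \<or> \<not> directed G \<and> x = (num v, i, num u)"
    unfolding flat_mem by (auto simp: orient_def split: if_splits)
  have l: "\<not> directed G \<Longrightarrow> link G v u = link G u v" by (simp add: link_eq)
  note e = es_verts[OF uv(1)]
  show "x \<in> steps"
  proof (cases "x = (num u, i, num v)")
    case True
    then show ?thesis using stepsI[of u v i] e uv by simp
  next
    case False
    then have "\<not> directed G" "x = (num v, i, num u)" using x by auto
    then show ?thesis using stepsI[of v u i] e uv l by simp
  qed
next
  fix x assume "x \<in> steps"
  then obtain u v i where x: "x = (num u, i, num v)" "link G u v \<in> edges G" "i \<in> labels G (link G u v)"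
    unfolding steps_def by blast
  then obtain a b where ab: "(a, b) \<in> set es" "link G u v = link G a b" using edge_in_es by blast
  then have "(num a, i, num b) \<in> set flat" using x flat_mem by auto
  moreover have "x \<in> orient (if directed G then 1 else 0) (num a, i, num b)"
    using ab(2) x(1) unfolding link_eq orient_def by auto
  ultimately show "x \<in> (\<Union>a \<in> set flat. orient (if directed G then 1 else 0) a)" by blast
qed

lemma length_flat: "length flat \<le> card (edges G) * lifetime G"
proof -
  have le: "length (row r) \<le> lifetime G" if rr: "r \<in> set rows" for r
  proof -
    obtain u v where r: "r = (num u, num v, sorted_list_of_set (labels G (link G u v)))" "(u, v) \<in> set es"
      using rr unfolding rows_def by auto
    have "card (labels G (link G u v)) \<le> card {1..lifetime G}"
      by (rule card_mono) (use labels es_verts[OF r(2)] in auto)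
    then show ?thesis unfolding r row_def by simp
  qed
  have "length (concat (map row R)) \<le> length R * k" if "\<And>r. r \<in> set R \<Longrightarrow> length (row r) \<le> k" for R k
    using that
  proof (induction R)
    case (Cons r R)
    then have "length (row r) \<le> k" "length (concat (map row R)) \<le> length R * k" by auto
    then show ?case by simp
  qed simp
  from this[of rows, OF le] show ?thesis using length_es by (simp add: rows_def)
qed

lemma built_input: "built (input_state G num es s t) rows"
  unfolding built_def
proof (intro conjI allI impI)
  show "vars (input_state G num es s t) ''m'' = length rows"
    by (simp add: input_state_def rows_def length_es)
  fix e assume "e < length rows"
  then have e: "e < length es" by (simp add: rows_def)
  obtain u v where uv: "es ! e = (u, v)" by (cases "es ! e")
  have r: "rows ! e = (num u, num v, sorted_list_of_set (labels G (link G u v)))" using e uv by (simp add: rows_def)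
  have "(u, v) \<in> set es" using e uv nth_mem by metis
  then have "length (sorted_list_of_set (labels G (link G u v))) = card (labels G (link G u v))" by simp
  then show "case rows ! e of (x, y, ls) \<Rightarrow> arrs (input_state G num es s t) ''src'' e = x \<and>
      arrs (input_state G num es s t) ''dst'' e = y \<and> arrs (input_state G num es s t) ''cnt'' e = length ls"
    unfolding r using e uv by (simp add: input_state_def load_def)
next
  fix p assume p: "p < length flat"
  have "concat (map (\<lambda>(u, v). sorted_list_of_set (labels G (link G u v))) es) = map (\<lambda>a. fst (snd a)) flat"
    unfolding rows_def row_def by (simp add: map_concat case_prod_unfold comp_def)
  then show "arrs (input_state G num es s t) ''lab'' p = fst (snd (flat ! p))"
    using p by (simp add: input_state_def load_def)
qed

text \<open>A path with at least one arc needs an edge, a label and two different ends. In the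
  degenerate cases at most the one-vertex path remains, so there are never two paths and the program
  may stop at once.\<close>

lemma trivial_path:
  assumes "card (edges G) = 0 \<or> lifetime G = 0 \<or> s = t" and "temporal_path G s t P"
  shows "P = ([s], [])"
proof -
  obtain vs ts where P: "P = (vs, ts)" by (cases P)
  have len: "length vs = Suc (length ts)" and ends: "hd vs = s" "last vs = t" and dis: "distinct vs"
    and e: "\<And>i. i < length ts \<Longrightarrow> link G (vs ! i) (vs ! Suc i) \<in> edges G \<and> ts ! i \<in> labels G (link G (vs ! i) (vs ! Suc i))"
    using assms(2) unfolding P temporal_path_def by auto
  have vs: "vs ! 0 = s" "vs ! length ts = t"
    using len ends hd_conv_nth[of vs] last_conv_nth[of vs] by (cases "vs = []"; simp)+
  have "length ts = 0"
  proof (rule ccontr)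
    assume l: "length ts \<noteq> 0"
    then have e0: "link G (vs ! 0) (vs ! 1) \<in> edges G" "ts ! 0 \<in> labels G (link G (vs ! 0) (vs ! 1))" using e[of 0] by auto
    have "edges G = set (map (case_prod (link G)) es)" using pres unfolding presentation_def by simp
    then have "finite (edges G)" by (metis List.finite_set)
    then have "card (edges G) \<noteq> 0" using e0 by auto
    moreover have "lifetime G \<noteq> 0" using labels[OF e0(1)] e0(2) by auto
    moreover have "s \<noteq> t" using vs nth_eq_iff_index_eq[OF dis, of 0 "length ts"] len l by auto
    ultimately show False using assms(1) by simp
  qed
  then have "ts = []" "length vs = 1" using len by auto
  then show ?thesis unfolding P using ends by (cases vs) auto
qed

end

section \<open>Transfer between \<open>G\<close> and its numbered arcs\<close>

locale separate = numbered +
  assumes distinct_ends: "s \<noteq> t"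
begin

abbreviation "Arcs \<equiv> {(u, i, v) \<in> steps. \<not> (u = num s \<and> v = num t)}"
abbreviation "Direct \<equiv> {i. (num s, i, num t) \<in> steps}"

lemma num_eq: "u \<in> verts G \<Longrightarrow> v \<in> verts G \<Longrightarrow> num u = num v \<longleftrightarrow> u = v"
  using inj by (auto dest: inj_onD)

lemma steps_bound:
  assumes "(x, i, y) \<in> steps"
  shows "x < card (verts G) \<and> y < card (verts G) \<and> 1 \<le> i \<and> i \<le> lifetime G \<and> x \<noteq> y"
proof -
  obtain u v where uv: "x = num u" "y = num v" "u \<in> verts G" "v \<in> verts G" "link G u v \<in> edges G"
    "i \<in> labels G (link G u v)" using assms unfolding steps_def by blast
  then have "u \<noteq> v" "i \<in> {1..lifetime G}" using link_neq labels by blast+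
  then show ?thesis using uv num_lt num_eq by simp
qed

sublocale net "card (verts G)" "lifetime G" "num s" "num t" Arcs Direct
proof
  show "u < card (verts G) \<and> v < card (verts G) \<and> 1 \<le> i \<and> i \<le> lifetime G \<and> u \<noteq> v" if "(u, i, v) \<in> Arcs" for u i v
    using steps_bound[of u i v] that by blast
  show "num s < card (verts G)" "num t < card (verts G)" using num_lt s_in t_in by auto
  show "num s \<noteq> num t" using num_eq s_in t_in distinct_ends by simp
  show "(num s, i, num t) \<notin> Arcs" for i by simp
  show "Direct \<subseteq> {1..lifetime G}" using steps_bound by fastforce
qed

lemma AF_steps: "AF = steps"
  unfolding AF_def by auto

lemma to_npath:
  assumes "temporal_path G s t (vs, ts)"
  shows "npath (map num vs, ts)"
proof -
  have p: "length vs = Suc (length ts)" "hd vs = s" "last vs = t" "set vs \<subseteq> verts G" "distinct vs" "sorted ts"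
    and e: "\<And>i. i < length ts \<Longrightarrow> link G (vs ! i) (vs ! Suc i) \<in> edges G \<and> ts ! i \<in> labels G (link G (vs ! i) (vs ! Suc i))"
    using assms unfolding temporal_path_def by auto
  have "vs \<noteq> []" using p by auto
  moreover have "(map num vs ! i, ts ! i, map num vs ! Suc i) \<in> AF" if i: "i < length ts" for i
  proof -
    have "vs ! i \<in> verts G" "vs ! Suc i \<in> verts G" using p i by auto
    then show ?thesis using stepsI e[OF i] p i unfolding AF_steps by simp
  qed
  moreover have "set (map num vs) \<subseteq> {..<card (verts G)}" using p num_lt by auto
  moreover have "distinct (map num vs)" using p inj inj_on_subset unfolding distinct_map by blast
  ultimately show ?thesis using p unfolding npath_def by (simp add: hd_map last_map)
qed

lemma from_npath:
  assumes "npath (ws, us)"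
  obtains vs where "ws = map num vs" "temporal_path G s t (vs, us)"
proof -
  have p: "length ws = Suc (length us)" "hd ws = num s" "last ws = num t" "set ws \<subseteq> {..<card (verts G)}" "distinct ws" "sorted us"
    and e: "\<And>i. i < length us \<Longrightarrow> (ws ! i, us ! i, ws ! Suc i) \<in> steps"
    using assms unfolding npath_def AF_steps by auto
  have img: "num ` verts G = {..<card (verts G)}" using pres unfolding presentation_def bij_betw_def by blast
  define f where "f = inv_into (verts G) num"
  have f: "f x \<in> verts G" "num (f x) = x" if "x \<in> set ws" for x
  proof -
    have "x \<in> num ` verts G" using that p(4) img by blast
    then show "f x \<in> verts G" "num (f x) = x"
      unfolding f_def by (rule inv_into_into, rule f_inv_into_f)
  qed
  have g: "f (num u) = u" if "u \<in> verts G" for u using inj that unfolding f_def by (rule inv_into_f_f)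
  let ?vs = "map f ws"
  have "ws \<noteq> []" using p by auto
  have ws: "ws = map num ?vs" using f(2) by (simp add: map_idI)
  have "link G (?vs ! i) (?vs ! Suc i) \<in> edges G \<and> us ! i \<in> labels G (link G (?vs ! i) (?vs ! Suc i))"
    if i: "i < length us" for i
  proof -
    obtain u v where uv: "ws ! i = num u" "ws ! Suc i = num v" "u \<in> verts G" "v \<in> verts G"
      "link G u v \<in> edges G" "us ! i \<in> labels G (link G u v)" using e[OF i] unfolding steps_def by blast
    then have "?vs ! i = u" "?vs ! Suc i = v" using g p i by simp_all
    then show ?thesis using uv by simp
  qed
  moreover have "distinct ?vs" using p(5) ws by (metis distinct_map)
  moreover have "hd ?vs = s" "last ?vs = t" using \<open>ws \<noteq> []\<close> p g s_in t_in by (simp_all add: hd_map last_map)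
  moreover have "set ?vs \<subseteq> verts G" using f by auto
  ultimately have "temporal_path G s t (?vs, us)" unfolding temporal_path_def using p by simp
  then show thesis using that ws by blast
qed

lemma temporal_verts_verts:
  assumes "temporal_path G s t P" "(v, j) \<in> temporal_verts P"
  shows "v \<in> verts G"
proof -
  obtain vs ts where P: "P = (vs, ts)" by (cases P)
  have "length vs = Suc (length ts)" "set vs \<subseteq> verts G" using assms(1) unfolding P temporal_path_def by auto
  moreover from this have "vs \<noteq> []" by auto
  ultimately show ?thesis using assms(2) s_in t_in assms(1) unfolding P temporal_path_def temporal_verts_def
    by (auto split: if_splits)
qed

text \<open>All temporal vertices of the paths lie over \<open>verts G\<close>, where
  \<open>num\<close> is injective, so that numbering neither creates nor hides a common one.\<close>

lemma disjoint_num: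
  assumes P: "temporal_path G s t (vs, ts)" and Q: "temporal_path G s t (vs', ts')"
  shows "t_vertex_disjoint G s t (vs, ts) (vs', ts') \<longleftrightarrow>
    temporal_verts (map num vs, ts) \<inter> temporal_verts (map num vs', ts') \<subseteq> {num s, num t} \<times> {1..lifetime G}"
proof -
  have len: "length vs = Suc (length ts)" "length vs' = Suc (length ts')"
    using P Q unfolding temporal_path_def by auto
  note m = temporal_verts_map[OF len(1), of num] temporal_verts_map[OF len(2), of num]
  note vP = temporal_verts_verts[OF P] and vQ = temporal_verts_verts[OF Q]
  show ?thesis
    unfolding t_vertex_disjoint_def m
  proof
    assume d: "temporal_verts (vs, ts) \<inter> temporal_verts (vs', ts') \<subseteq> {s, t} \<times> {1..lifetime G}"
    show "map_prod num id ` temporal_verts (vs, ts) \<inter> map_prod num id ` temporal_verts (vs', ts')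
        \<subseteq> {num s, num t} \<times> {1..lifetime G}"
    proof
      fix x assume "x \<in> map_prod num id ` temporal_verts (vs, ts) \<inter> map_prod num id ` temporal_verts (vs', ts')"
      then obtain v v' j where "x = (num v, j)" "num v = num v'" "(v, j) \<in> temporal_verts (vs, ts)" "(v', j) \<in> temporal_verts (vs', ts')"
        by auto
      moreover from this have "v = v'" using vP vQ num_eq by blast
      ultimately have x: "x = (num v, j)" and vj: "(v, j) \<in> {s, t} \<times> {1..lifetime G}" using d by auto
      show "x \<in> {num s, num t} \<times> {1..lifetime G}" unfolding x using vj by auto
    qed
  next
    assume d: "map_prod num id ` temporal_verts (vs, ts) \<inter> map_prod num id ` temporal_verts (vs', ts')
        \<subseteq> {num s, num t} \<times> {1..lifetime G}"
    show "temporal_verts (vs, ts) \<inter> temporal_verts (vs', ts') \<subseteq> {s, t} \<times> {1..lifetime G}"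
    proof
      fix x assume "x \<in> temporal_verts (vs, ts) \<inter> temporal_verts (vs', ts')"
      then obtain v j where x: "x = (v, j)" "(v, j) \<in> temporal_verts (vs, ts)" "(v, j) \<in> temporal_verts (vs', ts')"
        by (cases x) auto
      then have "map_prod num id (v, j) \<in> {num s, num t} \<times> {1..lifetime G}" using d by blast
      then show "x \<in> {s, t} \<times> {1..lifetime G}" using x vP num_eq s_in t_in by auto
    qed
  qed
qed

definition two_paths :: bool where
  "two_paths \<longleftrightarrow> (\<exists>P Q. temporal_path G s t P \<and> temporal_path G s t Q \<and> P \<noteq> Q \<and> t_vertex_disjoint G s t P Q)"

lemma two_paths_solvable:
  assumes "two_paths"
  shows "solvable"
proof -
  obtain vs ts vs' ts' where P: "temporal_path G s t (vs, ts)" "temporal_path G s t (vs', ts')"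
    "(vs, ts) \<noteq> (vs', ts')" "t_vertex_disjoint G s t (vs, ts) (vs', ts')"
    using assms unfolding two_paths_def by (metis surj_pair)
  have "set vs \<subseteq> verts G" "set vs' \<subseteq> verts G" using P unfolding temporal_path_def by auto
  then have "set vs \<union> set vs' \<subseteq> verts G" by (rule Un_least)
  then have "inj_on num (set vs \<union> set vs')" by (rule inj_on_subset[OF inj])
  then have "map num vs = map num vs' \<longleftrightarrow> vs = vs'" by (rule inj_on_map_eq_map)
  then have neq: "(map num vs, ts) \<noteq> (map num vs', ts')" using P(3) by simp
  show ?thesis
    unfolding solvable_def
    using to_npath[OF P(1)] to_npath[OF P(2)] neq P(4)[unfolded disjoint_num[OF P(1,2)]]
    by (intro exI[of _ "(map num vs, ts)"] exI[of _ "(map num vs', ts')"]) simp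
qed

lemma solution_paths:
  assumes "solution par bv bi cv ci"
  obtains vs ts Z vs' ts' Z' P Q where "tr par bv bi vs ts Z" "tr par cv ci vs' ts' Z'"
    "bi \<le> lifetime G" "ci \<le> lifetime G"
    "temporal_path G s t P" "temporal_path G s t Q" "P \<noteq> Q" "t_vertex_disjoint G s t P Q"
    "map num (fst P) = vs @ [num t]" "snd P = ts @ [bi]" "map num (fst Q) = vs' @ [num t]" "snd Q = ts' @ [ci]"
proof -
  obtain vs ts Z vs' ts' Z' where tr: "tr par bv bi vs ts Z" "(bv, bi, num t) \<in> AF" "num t \<notin> set vs"
     "tr par cv ci vs' ts' Z'" "(cv, ci, num t) \<in> AF" "num t \<notin> set vs'" and Z: "Z \<inter> Z' = {}"
     "(vs, ts, bi) \<noteq> (vs', ts', ci)" using assms unfolding solution_def by blast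
  note c = tr_complete[OF tr(1-3)] and c' = tr_complete[OF tr(4-6)]
  obtain p where p: "vs @ [num t] = map num p" "temporal_path G s t (p, ts @ [bi])" using from_npath[OF c(1)] .
  obtain q where q: "vs' @ [num t] = map num q" "temporal_path G s t (q, ts' @ [ci])" using from_npath[OF c'(1)] .
  have "temporal_verts (vs @ [num t], ts @ [bi]) \<inter> temporal_verts (vs' @ [num t], ts' @ [ci])
      \<subseteq> {num s, num t} \<times> {1..lifetime G}" using c(2) c'(2) Z(1) by blast
  then have "t_vertex_disjoint G s t (p, ts @ [bi]) (q, ts' @ [ci])"
    unfolding disjoint_num[OF p(2) q(2)] p(1) q(1) .
  moreover have "(p, ts @ [bi]) \<noteq> (q, ts' @ [ci])"
  proof
    assume eq: "(p, ts @ [bi]) = (q, ts' @ [ci])"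
    then have "vs @ [num t] = vs' @ [num t]" unfolding p(1) q(1) by simp
    then show False using Z(2) eq by simp
  qed
  moreover have "bi \<le> lifetime G" "ci \<le> lifetime G"
    using steps_bound tr(2,5) unfolding AF_steps by blast+
  ultimately show thesis
    by (intro that[OF tr(1,4) _ _ p(2) q(2)]) (simp_all add: p(1) q(1))
qed

end

text \<open>Since \<open>n\<close>, \<open>m\<close> and \<open>T\<close> are positive, every
  lower-order product is at most m n T^2; the leading term \<open>n * T * K\<close> is at most twice
  this, by \<open>K \<le> 2 * m * T\<close>. The coefficients then add up to less than
  10000.\<close>

lemma cost_bound:
  fixes n m T l K :: nat
  assumes pos: "0 < n" "0 < m" "0 < T" and l: "l \<le> m * T" and K: "K \<le> 2 * l"
  shows "1000 + 300 * n + 60 * m + 200 * l + 120 * T + (500 + (n + T) * (40 * K + 60) + (60 * T + 80 * (n * Suc T + 2)) +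
     (n * Suc T) * (200 * K + 360) + (n * Suc T + 2) * (200 * K + 300)) \<le> 10000 * (m * n * T ^ 2)"
proof -
  let ?X = "m * n * T ^ 2"
  have le: "a * b \<le> a * b * c" if "0 < c" for a b c :: nat using that by simp
  have X: "?X = m * n * T * T" by (simp add: power2_eq_square)
  have m1: "n \<le> ?X" "m \<le> ?X" "T \<le> ?X" "m * T \<le> ?X" "n * T \<le> ?X" "n * (m * T) \<le> ?X" "T * (m * T) \<le> ?X" "1 \<le> ?X"
    unfolding X using pos by (simp_all add: Suc_le_eq)
  have nT: "n * T * (m * T) = ?X" unfolding X by (simp add: algebra_simps)
  have K': "K \<le> 2 * (m * T)" using K l by linarith
  have "n * K \<le> n * (2 * (m * T))" "T * K \<le> T * (2 * (m * T))" "n * T * K \<le> n * T * (2 * (m * T))"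
    using K' by (rule mult_le_mono2)+
  then have k: "n * K \<le> 2 * ?X" "T * K \<le> 2 * ?X" "n * T * K \<le> 2 * ?X" "K \<le> 2 * ?X" "l \<le> ?X"
    using m1 nT K' l by linarith+
  have "1000 + 300 * n + 60 * m + 200 * l + 120 * T + (500 + (n + T) * (40 * K + 60) + (60 * T + 80 * (n * Suc T + 2)) +
     (n * Suc T) * (200 * K + 360) + (n * Suc T + 2) * (200 * K + 300)) =
     1000 + 300 * n + 60 * m + 200 * l + 120 * T + 500 + 40 * (n * K) + 60 * n + 40 * (T * K) + 60 * T + 60 * T +
     80 * n + 80 * (n * T) + 160 + 200 * (n * K) + 200 * (n * T * K) + 360 * n + 360 * (n * T) +
     200 * (n * K) + 200 * (n * T * K) + 400 * K + 300 * n + 300 * (n * T) + 600"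
    by (simp add: algebra_simps)
  also have "\<dots> \<le> 10000 * ?X" using m1 k by linarith
  finally show ?thesis .
qed

lemma (in separate) wp_algorithm:
  assumes pos: "0 < card (edges G)" "0 < lifetime G"
    and k: "k = int (10000 * (card (edges G) * card (verts G) * lifetime G ^ 2))"
  shows "wp algorithm (\<lambda>\<sigma> k'. 0 \<le> k' \<and>
     (if two_paths then \<exists>P Q. temporal_path G s t P \<and> temporal_path G s t Q \<and> P \<noteq> Q \<and>
         t_vertex_disjoint G s t P Q \<and> outputs_paths \<sigma> num P Q
      else outputs_at_most_one \<sigma>)) (input_state G num es s t) k"
    (is "wp _ ?R ?\<sigma> _")
proof -
  let ?n = "card (verts G)" and ?m = "card (edges G)" and ?T = "lifetime G" and ?l = "length flat"
  let ?out = "Cond (Equal (Var ''found'') (Const 1))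
          (emit ''bv'' ''bi'' ''pv'' ''pt'' ''plen'';; emit ''cv'' ''ci'' ''qv'' ''qt'' ''qlen'')
          Skip"
  let ?N = "?n * Suc ?T + 2"
  have npos: "0 < ?n" using num_lt[OF s_in] by simp
  have vars: "vars ?\<sigma> ''n'' = ?n" "vars ?\<sigma> ''m'' = ?m" "vars ?\<sigma> ''tau'' = ?T" "vars ?\<sigma> ''s'' = num s"
    "vars ?\<sigma> ''t'' = num t" "vars ?\<sigma> ''dir'' = (if directed G then 1 else 0)" "vars ?\<sigma> ''found'' = 0"
    "arrs ?\<sigma> ''arr'' = (\<lambda>_. 0)" "arrs ?\<sigma> ''mk'' = (\<lambda>_. 0)"
    by (simp_all add: input_state_def)
  have rl: "length rows = ?m" by (simp add: rows_def length_es)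
  define c1 where "c1 = 60 + 60 * int ?m + 200 * int ?l"
  define c2 where "c2 = 200 + 60 * int ?T + 100 * int ?n"
  \<comment> \<open>The number of arcs is known only after \<open>build\<close>, so the whole budget
    is checked for every admissible \<open>K\<close> in advance.\<close>
  have budget: "100 + 30 * int ?n + c1 + solve_cost (int K) + 2 * c2 \<le> k" if "K \<le> 2 * ?l" for K
  proof -
    have "int (1000 + 300 * ?n + 60 * ?m + 200 * ?l + 120 * ?T + (500 + (?n + ?T) * (40 * K + 60) + (60 * ?T + 80 * ?N) +
     (?n * Suc ?T) * (200 * K + 360) + ?N * (200 * K + 300))) \<le> k"
      unfolding k using cost_bound[OF npos pos length_flat that] by (rule iffD2[OF of_nat_le_iff])
    moreover have "int (1000 + 300 * ?n + 60 * ?m + 200 * ?l + 120 * ?T + (500 + (?n + ?T) * (40 * K + 60) + (60 * ?T + 80 * ?N) +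
     (?n * Suc ?T) * (200 * K + 360) + ?N * (200 * K + 300))) =
      1000 + 300 * int ?n + 60 * int ?m + 200 * int ?l + 120 * int ?T + solve_cost (int K)"
      unfolding solve_cost_def by (simp only: of_nat_add of_nat_mult of_nat_numeral)
    ultimately have "1000 + 300 * int ?n + 60 * int ?m + 200 * int ?l + 120 * int ?T + solve_cost (int K) \<le> k" by (simp only:)
    moreover have "100 + 30 * a + (60 + 60 * b + 200 * c) + e + 2 * (200 + 60 * d + 100 * a) \<le> k"
      if "1000 + 300 * a + 60 * b + 200 * c + 120 * d + e \<le> k" "0 \<le> a" for a b c d e :: int
      using that unfolding distrib_left by linarith
    ultimately show ?thesis unfolding c1_def c2_def by simp
  qed
  have sc: "0 \<le> solve_cost (int K)" for K unfolding solve_cost_def by simp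
  have c0: "0 \<le> c1" "0 \<le> c2" unfolding c1_def c2_def by simp_all
  have outp: "wp ?out ?R \<sigma>3 k3" if e3: "env \<sigma>3" and k3: "20 + 2 * c2 \<le> k3"
      and post: "vars \<sigma>3 ''found'' = 1 \<and> solution (grid ?T (arrs \<sigma>3 ''par'')) (vars \<sigma>3 ''bv'') (vars \<sigma>3 ''bi'') (vars \<sigma>3 ''cv'') (vars \<sigma>3 ''ci'') \<or>
      vars \<sigma>3 ''found'' = 0 \<and> \<not> solvable" for \<sigma>3 k3
  proof (cases "vars \<sigma>3 ''found'' = 0")
    case True
    then have "\<not> two_paths" using post two_paths_solvable by auto
    then show ?thesis using True k3 c0 by (simp add: wp_simps outputs_at_most_one_def)
  next
    case False
    then have f1: "vars \<sigma>3 ''found'' = 1"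
      and sol: "solution (grid ?T (arrs \<sigma>3 ''par'')) (vars \<sigma>3 ''bv'') (vars \<sigma>3 ''bi'') (vars \<sigma>3 ''cv'') (vars \<sigma>3 ''ci'')"
      using post by auto
    from sol obtain vs ts Z vs' ts' Z' P Q where
      tr: "tr (grid ?T (arrs \<sigma>3 ''par'')) (vars \<sigma>3 ''bv'') (vars \<sigma>3 ''bi'') vs ts Z"
        "tr (grid ?T (arrs \<sigma>3 ''par'')) (vars \<sigma>3 ''cv'') (vars \<sigma>3 ''ci'') vs' ts' Z'"
        "vars \<sigma>3 ''bi'' \<le> ?T" "vars \<sigma>3 ''ci'' \<le> ?T" and
      PQ: "temporal_path G s t P" "temporal_path G s t Q" "P \<noteq> Q" "t_vertex_disjoint G s t P Q" and
      lists: "map num (fst P) = vs @ [num t]" "snd P = ts @ [vars \<sigma>3 ''bi'']"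
        "map num (fst Q) = vs' @ [num t]" "snd Q = ts' @ [vars \<sigma>3 ''ci'']"
      by (rule solution_paths)
    have two: "two_paths" unfolding two_paths_def using PQ by blast
    have "wp (emit ''bv'' ''bi'' ''pv'' ''pt'' ''plen'') (wp (emit ''cv'' ''ci'' ''qv'' ''qt'' ''qlen'') ?R) \<sigma>3 (k3 - 4)"
    proof (rule wp_emit[OF e3 tr(1,3)])
      have "c2 \<le> k3 - 4" using k3 c0 by linarith
      then show "200 + 60 * int ?T + 100 * int ?n \<le> k3 - 4" unfolding c2_def .
      fix \<sigma>4 k4
      assume u4: "unchanged (emit ''bv'' ''bi'' ''pv'' ''pt'' ''plen'') \<sigma>3 \<sigma>4"
        and o4: "stored (vs @ [num t]) (arrs \<sigma>4 ''pv'')" "stored (ts @ [vars \<sigma>3 ''bi'']) (arrs \<sigma>4 ''pt'')"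
          "vars \<sigma>4 ''plen'' = Suc (length ts)"
        and "k3 - 4 - (200 + 60 * int ?T + 100 * int ?n) \<le> k4"
      then have k4: "k3 - 4 - c2 \<le> k4" unfolding c2_def by simp
      have v4: "vars \<sigma>4 x = vars \<sigma>3 x" if "x \<notin> {''v'', ''i'', ''k'', ''u'', ''j'', ''plen''}" for x
        by (rule unchangedD(1)[OF u4]) (use that in \<open>simp add: emit_def trace_step_def copy_step_def\<close>)
      have w4: "arrs \<sigma>4 x = arrs \<sigma>3 x" if "x \<notin> {''tv'', ''tt'', ''pv'', ''pt''}" for x
        by (rule unchangedD(2)[OF u4]) (use that in \<open>simp add: emit_def trace_step_def copy_step_def\<close>)
      have e4: "env \<sigma>4" by (rule env_cong[OF e3]) (simp_all add: v4 w4)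
      show "wp (emit ''cv'' ''ci'' ''qv'' ''qt'' ''qlen'') ?R \<sigma>4 k4"
      proof (rule wp_emit[OF e4])
        show "tr (grid ?T (arrs \<sigma>4 ''par'')) (vars \<sigma>4 ''cv'') (vars \<sigma>4 ''ci'') vs' ts' Z'"
          using tr(2) by (simp add: v4 w4)
        show "vars \<sigma>4 ''ci'' \<le> ?T" using tr(4) by (simp add: v4)
        have "c2 \<le> k4" using k3 k4 by linarith
        then show "200 + 60 * int ?T + 100 * int ?n \<le> k4" unfolding c2_def .
        fix \<sigma>5 k5
        assume u5: "unchanged (emit ''cv'' ''ci'' ''qv'' ''qt'' ''qlen'') \<sigma>4 \<sigma>5"
          and o5: "stored (vs' @ [num t]) (arrs \<sigma>5 ''qv'')" "stored (ts' @ [vars \<sigma>4 ''ci'']) (arrs \<sigma>5 ''qt'')"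
            "vars \<sigma>5 ''qlen'' = Suc (length ts')"
          and "k4 - (200 + 60 * int ?T + 100 * int ?n) \<le> k5"
        then have "k4 - c2 \<le> k5" unfolding c2_def by simp
        then have k5: "0 \<le> k5" using k3 k4 by linarith
        have v5: "vars \<sigma>5 x = vars \<sigma>4 x" if "x \<notin> {''v'', ''i'', ''k'', ''u'', ''j'', ''qlen''}" for x
          by (rule unchangedD(1)[OF u5]) (use that in \<open>simp add: emit_def trace_step_def copy_step_def\<close>)
        have w5: "arrs \<sigma>5 x = arrs \<sigma>4 x" if "x \<notin> {''tv'', ''tt'', ''qv'', ''qt''}" for x
          by (rule unchangedD(2)[OF u5]) (use that in \<open>simp add: emit_def trace_step_def copy_step_def\<close>)
        have "outputs_paths \<sigma>5 num P Q"
          unfolding outputs_paths_def lists using o4 o5 f1 by (simp add: v4 v5 w5)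
        then have "\<exists>P Q. temporal_path G s t P \<and> temporal_path G s t Q \<and> P \<noteq> Q \<and>
            t_vertex_disjoint G s t P Q \<and> outputs_paths \<sigma>5 num P Q" using PQ by blast
        then show "?R \<sigma>5 k5" unfolding if_P[OF two] using k5 by blast
      qed simp_all
    qed simp_all
    then show ?thesis using f1 by (simp add: wp_Cond wp_Seq_fun)
  qed
  have "wp offsets (wp (Assign ''N'' (Add (Var ''x'') (Const 2))) (wp build (wp solve (wp ?out ?R)))) ?\<sigma> (k - x)"
    if x: "x \<le> 20" for x
  proof (rule wp_offsets)
    have b0: "100 + 30 * int ?n + c1 + solve_cost (int 0) + 2 * c2 \<le> k" by (rule budget) simp
    then show "30 + 30 * int (vars ?\<sigma> ''n'') \<le> k - x" unfolding vars using x sc[of 0] c0 by linarith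
    fix \<sigma>1 k1
    assume u1: "unchanged offsets ?\<sigma> \<sigma>1"
      and o1: "\<forall>v < vars ?\<sigma> ''n''. arrs \<sigma>1 ''off'' v = v * Suc (vars ?\<sigma> ''tau'')"
        "vars \<sigma>1 ''x'' = vars ?\<sigma> ''n'' * Suc (vars ?\<sigma> ''tau'')"
      and "k - x - (30 + 30 * int (vars ?\<sigma> ''n'')) \<le> k1"
    then have k1: "k - 50 - 30 * int ?n \<le> k1" unfolding vars using x by linarith
    have v1: "vars \<sigma>1 x = vars ?\<sigma> x" if "x \<notin> {''x'', ''v''}" for x
      by (rule unchangedD(1)[OF u1]) (use that in \<open>simp add: offsets_def\<close>)
    have w1: "arrs \<sigma>1 x = arrs ?\<sigma> x" if "x \<noteq> ''off''" for x
      by (rule unchangedD(2)[OF u1]) (use that in \<open>simp add: offsets_def\<close>)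
    let ?\<sigma>1 = "\<lparr>vars = (vars \<sigma>1)(''N'' := ?N), arrs = arrs \<sigma>1\<rparr>"
    have "wp build (wp solve (wp ?out ?R)) ?\<sigma>1 (k1 - 4)"
    proof (rule wp_build)
      show "built ?\<sigma>1 rows" using built_input unfolding built_def by (simp add: v1 w1)
      have "c1 \<le> k1 - 4" using b0 k1 sc[of 0] c0 by linarith
      then show "60 + 60 * int (length rows) + 200 * int ?l \<le> k1 - 4" unfolding c1_def rl .
      fix \<sigma>2 k2
      assume u2: "unchanged build ?\<sigma>1 \<sigma>2"
        and co: "collected \<sigma>2 (\<Union>a \<in> set flat. orient (vars ?\<sigma>1 ''dir'') a)" and K: "vars \<sigma>2 ''K'' \<le> 2 * ?l"
        and "k1 - 4 - (60 + 60 * int (length rows) + 200 * int ?l) \<le> k2"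
      then have k2: "k - 54 - 30 * int ?n - c1 \<le> k2" using k1 unfolding c1_def rl by linarith
      have v2: "vars \<sigma>2 x = vars ?\<sigma>1 x" if "x \<notin> {''e'', ''j'', ''p'', ''K'', ''d'', ''i'', ''u'', ''v'', ''d1'', ''d2''}" for x
        by (rule unchangedD(1)[OF u2]) (use that in \<open>simp add: build_def build_body_def push_def\<close>)
      have w2: "arrs \<sigma>2 x = arrs ?\<sigma>1 x" if "x \<notin> {''au'', ''ai'', ''av''}" for x
        by (rule unchangedD(2)[OF u2]) (use that in \<open>simp add: build_def build_body_def push_def\<close>)
      have "vars ?\<sigma>1 ''dir'' = (if directed G then 1 else 0)" by (simp add: v1 vars)
      then have "collected \<sigma>2 steps" using co flat_steps by simp
      then have ga: "gathered (arcs \<sigma>2) steps (num s) (num t) (vars \<sigma>2 ''d'') (vars \<sigma>2 ''d1'') (vars \<sigma>2 ''d2'')"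
        unfolding collected_def by (simp add: v1 v2 vars)
      have e2: "env \<sigma>2"
        unfolding env_def using ga o1 unfolding gathered_def vars by (simp add: v1 v2 w2 vars)
      show "wp solve (wp ?out ?R) \<sigma>2 k2"
      proof (rule wp_solve[OF e2])
        show "arrs \<sigma>2 ''arr'' = (\<lambda>_. 0)" "arrs \<sigma>2 ''mk'' = (\<lambda>_. 0)" "vars \<sigma>2 ''found'' = 0"
          by (simp_all add: v1 v2 w1 w2 vars)
        show "vars \<sigma>2 ''d'' = 0 \<and> Direct = {} \<or> vars \<sigma>2 ''d'' = 1 \<and> Direct = {vars \<sigma>2 ''d1''} \<or>
          vars \<sigma>2 ''d'' = 2 \<and> vars \<sigma>2 ''d1'' \<in> Direct \<and> vars \<sigma>2 ''d2'' \<in> Direct \<and> vars \<sigma>2 ''d1'' \<noteq> vars \<sigma>2 ''d2''"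
          using ga unfolding gathered_def Let_def by blast
        show "solve_cost (int (vars \<sigma>2 ''K'')) \<le> k2" using budget[OF K] k2 c0 by linarith
        fix \<sigma>3 k3
        assume u3: "unchanged solve \<sigma>2 \<sigma>3"
          and post: "vars \<sigma>3 ''found'' = 1 \<and> solution (grid ?T (arrs \<sigma>3 ''par'')) (vars \<sigma>3 ''bv'') (vars \<sigma>3 ''bi'') (vars \<sigma>3 ''cv'') (vars \<sigma>3 ''ci'') \<or>
            vars \<sigma>3 ''found'' = 0 \<and> \<not> solvable"
          and k3: "k2 - solve_cost (int (vars \<sigma>2 ''K'')) \<le> k3"
        have "env \<sigma>3"
          by (rule env_unchanged[OF e2 u3])
            (simp_all add: solve_def search_def search_round_def search_step_def spine_com_def spine_step_def fill_def
              sweep_def sweep_round_def advance_def sweep_step_def spread_def spread_step_def)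
        moreover have "20 + 2 * c2 \<le> k3" using budget[OF K] k2 k3 by linarith
        ultimately show "wp ?out ?R \<sigma>3 k3" using outp post by blast
      qed
    qed
    moreover have "vars \<sigma>1 ''x'' = ?n * Suc ?T" using o1(2) unfolding vars .
    ultimately show "wp (Assign ''N'' (Add (Var ''x'') (Const 2))) (wp build (wp solve (wp ?out ?R))) \<sigma>1 k1"
      by (simp add: wp_Assign)
  qed
  moreover have "num s \<noteq> num t" using num_eq s_in t_in distinct_ends by simp
  ultimately show ?thesis unfolding algorithm_def
    using pos by (simp add: wp_Cond wp_Seq_fun vars)
qed

theorem theorem5:
  "\<exists>(algo :: com) (C :: nat).
     \<forall>(G :: 'v temporal_graph) num es s t.
       temporal_graph G \<and> presentation G num es \<and> s \<in> verts G \<and> t \<in> verts G \<longrightarrow>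
       (\<exists>k \<sigma>. exec algo (input_state G num es s t) k \<sigma> \<and>
          k \<le> C * (card (edges G) * card (verts G) * lifetime G ^ 2 + 1) \<and>
          (if \<exists>P Q. temporal_path G s t P \<and> temporal_path G s t Q \<and> P \<noteq> Q \<and>
                    t_vertex_disjoint G s t P Q
           then \<exists>P Q. temporal_path G s t P \<and> temporal_path G s t Q \<and> P \<noteq> Q \<and>
                    t_vertex_disjoint G s t P Q \<and> outputs_paths \<sigma> num P Q
           else tp G s t \<le> 1 \<and> outputs_at_most_one \<sigma>))"
proof (rule exI[of _ algorithm], rule exI[of _ 10000], intro allI impI)
  fix G :: "'v temporal_graph" and num es s t
  assume A: "temporal_graph G \<and> presentation G num es \<and> s \<in> verts G \<and> t \<in> verts G"
  interpret numbered G num es s t by unfold_locales (use A in auto)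
  let ?X = "card (edges G) * card (verts G) * lifetime G ^ 2"
  let ?two = "\<exists>P Q. temporal_path G s t P \<and> temporal_path G s t Q \<and> P \<noteq> Q \<and> t_vertex_disjoint G s t P Q"
  show "\<exists>k \<sigma>. exec algorithm (input_state G num es s t) k \<sigma> \<and> k \<le> 10000 * (?X + 1) \<and>
     (if ?two then \<exists>P Q. temporal_path G s t P \<and> temporal_path G s t Q \<and> P \<noteq> Q \<and>
                    t_vertex_disjoint G s t P Q \<and> outputs_paths \<sigma> num P Q
      else tp G s t \<le> 1 \<and> outputs_at_most_one \<sigma>)"
  proof (cases "card (edges G) = 0 \<or> lifetime G = 0 \<or> s = t")
    case True
    let ?s = "input_state G num es s t"
    have "\<not> (0 < vars ?s ''m'' \<and> 0 < vars ?s ''tau'' \<and> vars ?s ''s'' \<noteq> vars ?s ''t'')"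
      using True by (auto simp: input_state_def)
    \<comment> \<open>The outer conditional costs 13 units with its guard, \<open>Skip\<close> one
      more. The summand 1 in the time bound takes care of this branch, where the product may be
      0.\<close>
    then have "wp algorithm (\<lambda>\<sigma> k'. \<sigma> = ?s \<and> k' = 0) ?s 14"
      unfolding algorithm_def by (auto simp: wp_simps)
    then have ex: "exec algorithm ?s 14 ?s" unfolding wp_def by auto
    have two: "\<not> ?two" using trivial_path[OF True] by blast
    have "outputs_at_most_one ?s" by (simp add: outputs_at_most_one_def input_state_def)
    moreover have "14 \<le> 10000 * (?X + 1)" by simp
    ultimately show ?thesis unfolding if_not_P[OF two] using ex tp_le_one[OF two] by blast
  next
    case False
    interpret separate G num es s t by unfold_locales (use False in simp)
    have "wp algorithm (\<lambda>\<sigma> k'. 0 \<le> k' \<and>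
     (if two_paths then \<exists>P Q. temporal_path G s t P \<and> temporal_path G s t Q \<and> P \<noteq> Q \<and>
         t_vertex_disjoint G s t P Q \<and> outputs_paths \<sigma> num P Q
      else outputs_at_most_one \<sigma>)) (input_state G num es s t) (int (10000 * ?X))"
      by (rule wp_algorithm) (use False in auto)
    then obtain k \<sigma> where ex: "exec algorithm (input_state G num es s t) k \<sigma>" and k: "0 \<le> int (10000 * ?X) - int k"
      and post: "if two_paths then \<exists>P Q. temporal_path G s t P \<and> temporal_path G s t Q \<and> P \<noteq> Q \<and>
         t_vertex_disjoint G s t P Q \<and> outputs_paths \<sigma> num P Q else outputs_at_most_one \<sigma>"
      unfolding wp_def by blast
    have "k \<le> 10000 * ?X" using k unfolding diff_ge_0_iff_ge by (rule iffD1[OF of_nat_le_iff])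
    then have "k \<le> 10000 * (?X + 1)" by simp
    moreover have "?two \<longleftrightarrow> two_paths" unfolding two_paths_def ..
    moreover have "tp G s t \<le> 1" if "\<not> ?two" using that by (rule tp_le_one)
    ultimately show ?thesis using ex post by (cases two_paths) (auto simp only: if_True if_False)
  qed
qed

end
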